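(* Let $\mathbb{X},\mathbb{Y},\mathbb{A}$ be Borel subsets of Polish spaces, let $P(dx'|x,a)$ be a stochastic kernel on $\mathbb{X}$ given $\mathbb{X}\times\mathbb{A}$, let $Q(dy|a,x)$ be a stochastic kernel on $\mathbb{Y}$ given $\mathbb{A}\times\mathbb{X}$, and let the kernels $R$, $R'$, $q$ be as defined in the context. For each open $B\subseteq\mathbb{X}$ let $\mathcal{R}_B=\{(z,a)\mapsto R(B\times C|z,a): C\text{ open in }\mathbb{Y}\}$, a family of functions from $\mathbb{P}(\mathbb{X})\times\mathbb{A}$ to $[0,1]$. Suppose the topology on $\mathbb{X}$ has a countable base $\tau_b^{\mathbb{X}}$ with the following two properties: (a) $\mathbb{X}\in\tau_b^{\mathbb{X}}$; (b) for each finite intersection $\mathcal{O}=\bigcap_{i=1}^k\mathcal{O}_i$ of sets $\mathcal{O}_i\in\tau_b^{\mathbb{X}}$, $i=1,\ldots,k$, the family of functions $\mathcal{R}_{\mathcal{O}}$ is equicontinuous at all the points $(z,a)\in\mathbb{P}(\mathbb{X})\times\mathbb{A}$. Then: (i) the stochastic kernel $R'(dy|z,a)$ on $\mathbb{Y}$ given $\mathbb{P}(\mathbb{X})\times\mathbb{A}$ is continuous in the total variation, and the following holds: there exists a stochastic kernel $H$ on $\mathbb{X}$ given $\mathbb{P}(\mathbb{X})\times\mathbb{A}\times\mathbb{Y}$ satisfying $$R(B\times C|z,a)=\int_C H(B|z,a,y)R'(dy|z,a),\quad B\in\mathcal{B}(\mathbb{X}),\ C\in\mathcal{B}(\mathbb{Y}),\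 z\in\mathbb{P}(\mathbb{X}),\ a\in\mathbb{A},$$ such that, if a sequence $\{z^{(n)}\}\subseteq\mathbb{P}(\mathbb{X})$ converges weakly to $z\in\mathbb{P}(\mathbb{X})$ and a sequence $\{a^{(n)}\}\subseteq\mathbb{A}$ converges to $a\in\mathbb{A}$ as $n\to\infty$, then there exist a subsequence $\{(z^{(n_k)},a^{(n_k)})\}_{k=1,2,\ldots}$ and a measurable subset $C$ of $\mathbb{Y}$ such that $R'(C|z,a)=1$ and, for all $y\in C$, $H(\,\cdot\,|z^{(n_k)},a^{(n_k)},y)$ converges weakly to $H(\,\cdot\,|z,a,y)$ as $k\to\infty$; (ii) the stochastic kernel $q(dz'|z,a)$ on $\mathbb{P}(\mathbb{X})$ given $\mathbb{P}(\mathbb{X})\times\mathbb{A}$ is weakly continuous.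
   Context: $\mathcal{B}(\mathbb{S})$ is the Borel $\sigma$-field of a metric space $\mathbb{S}$, and $\mathbb{P}(\mathbb{S})$ is the set of probability measures on $(\mathbb{S},\mathcal{B}(\mathbb{S}))$, endowed with the topology of weak convergence. A stochastic kernel $K(ds_1|s_2)$ on $\mathbb{S}_1$ given $\mathbb{S}_2$ is a map such that $K(\,\cdot\,|s_2)\in\mathbb{P}(\mathbb{S}_1)$ for each $s_2\in\mathbb{S}_2$ and $K(B|\,\cdot\,)$ is Borel measurable for each $B\in\mathcal{B}(\mathbb{S}_1)$. It is called weakly continuous (continuous in the total variation) if $K(\,\cdot\,|s^{(n)})$ converges weakly (in the total variation) to $K(\,\cdot\,|s)$ whenever $s^{(n)}\to s$ in $\mathbb{S}_2$. The distance in total variation is $\rho_{tv}(\mu,\nu)=\sup\{|\int f\,d\mu-\int f\,d\nu| : f:\mathbb{S}\to[-1,1]\text{ Borel measurable}\}$. A family $\mathcal{A}_0$ of real-valued functions on a metric space is equicontinuous at a point $s$ if $\sup_{f\in\mathcal{A}_0}|f(s')-f(s)|\to0$ as $s'\to s$. Define the stochastic kernel $R$ on $\mathbb{X}\times\mathbb{Y}$ given $\mathbb{P}(\mathbb{X})\times\mathbb{A}$ by $$R(B\times C|z,a):=\int_{\mathbb{X}}\int_B Q(C|a,x')P(dx'|x,a)z(dx),\quad B\in\mathcal{B}(\mathbb{X}),\ C\in\mathcal{B}(\mathbb{Y}),$$ and $R'(C|z,a):=R(\mathbb{X}\times C|z,a)$, a stochastic kernel on $\mathbb{Y}$ given $\mathbb{P}(\mathbb{X})\times\mathbb{A}$.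 There exists a stochastic kernel $H$ on $\mathbb{X}$ given $\mathbb{P}(\mathbb{X})\times\mathbb{A}\times\mathbb{Y}$ with $R(B\times C|z,a)=\int_C H(B|z,a,y)R'(dy|z,a)$ for all $B,C,z,a$. Writing $H(z,a,y):=H(\,\cdot\,|z,a,y)\in\mathbb{P}(\mathbb{X})$, define $$q(D|z,a):=\int_{\mathbb{Y}}\mathbf{I}\{H(z,a,y)\in D\}R'(dy|z,a),\quad D\in\mathcal{B}(\mathbb{P}(\mathbb{X})),\ z\in\mathbb{P}(\mathbb{X}),\ a\in\mathbb{A};$$ $q$ does not depend on the particular choice of $H$. *)

theory Defs
  imports "HOL-Probability.Probability"
begin

text \<open>
  A Borel subset \<^term>\<open>X\<close> of a Polish space is represented by the subspace topology
  \<^term>\<open>top_of_set X\<close>.  All notions below depend on the metrics only through the topologies and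
  are therefore stated for abstract topologies.
\<close>

definition borel_of :: "'a topology \<Rightarrow> 'a measure" where
  "borel_of T = sigma (topspace T) {U. openin T U}"

definition prob_measures :: "'a topology \<Rightarrow> 'a measure set" where
  "prob_measures T = {\<mu>. prob_space \<mu> \<and> sets \<mu> = sets (borel_of T)}"

definition bounded_continuous :: "'a topology \<Rightarrow> ('a \<Rightarrow> real) set" where
  "bounded_continuous T = {f. continuous_map T euclideanreal f \<and> bounded (f ` topspace T)}"

text \<open>The coarsest topology on the probability measures for which every map
  \<open>\<mu> \<mapsto> \<integral> f d\<mu>\<close>, with \<open>f\<close> bounded and continuous, is continuous.\<close>

definition weak_topology :: "'a topology \<Rightarrow> 'a measure topology" where
  "weak_topology T = topology_generated_by
     {{\<mu> \<in> prob_measures T. (\<integral>x. f x \<partial>\<mu>) \<in> U} | f U. f \<in> bounded_continuous T \<and> open U}"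

definition tv_dist :: "'a topology \<Rightarrow> 'a measure \<Rightarrow> 'a measure \<Rightarrow> real" where
  "tv_dist T \<mu> \<nu> =
     (SUP f \<in> {f \<in> borel_measurable (borel_of T). \<forall>x \<in> topspace T. f x \<in> {-1..1}}.
        \<bar>(\<integral>x. f x \<partial>\<mu>) - (\<integral>x. f x \<partial>\<nu>)\<bar>)"

text \<open>\<^term>\<open>K s\<close> is the measure \<open>K(\<cdot> | s)\<close>; the first topology is the target space
  and the second one the conditioning space.\<close>

definition stochastic_kernel :: "'a topology \<Rightarrow> 'b topology \<Rightarrow> ('b \<Rightarrow> 'a measure) \<Rightarrow> bool" where
  "stochastic_kernel T1 T2 K \<longleftrightarrow>
     (\<forall>s \<in> topspace T2. K s \<in> prob_measures T1) \<and>
     (\<forall>B \<in> sets (borel_of T1). (\<lambda>s. measure (K s) B) \<in> borel_measurable (borel_of T2))"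

definition weakly_continuous_kernel :: "'a topology \<Rightarrow> 'b topology \<Rightarrow> ('b \<Rightarrow> 'a measure) \<Rightarrow> bool" where
  "weakly_continuous_kernel T1 T2 K \<longleftrightarrow>
     stochastic_kernel T1 T2 K \<and>
     (\<forall>sn s. (\<forall>n. sn n \<in> topspace T2) \<longrightarrow> limitin T2 sn s sequentially \<longrightarrow>
        limitin (weak_topology T1) (\<lambda>n. K (sn n)) (K s) sequentially)"

definition tv_continuous_kernel :: "'a topology \<Rightarrow> 'b topology \<Rightarrow> ('b \<Rightarrow> 'a measure) \<Rightarrow> bool" where
  "tv_continuous_kernel T1 T2 K \<longleftrightarrow>
     stochastic_kernel T1 T2 K \<and>
     (\<forall>sn s. (\<forall>n. sn n \<in> topspace T2) \<longrightarrow> limitin T2 sn s sequentially \<longrightarrow>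
        (\<lambda>n. tv_dist T1 (K (sn n)) (K s)) \<longlonglongrightarrow> 0)"

text \<open>The supremum over the family is taken in \<^typ>\<open>ennreal\<close>, as it need not be finite.\<close>

definition equicontinuous_at :: "'a topology \<Rightarrow> ('a \<Rightarrow> real) set \<Rightarrow> 'a \<Rightarrow> bool" where
  "equicontinuous_at T F s \<longleftrightarrow>
     ((\<lambda>s'. SUP f \<in> F. ennreal \<bar>f s' - f s\<bar>) \<longlongrightarrow> 0) (atin T s)"

definition countable_base :: "'a topology \<Rightarrow> 'a set set \<Rightarrow> bool" where
  "countable_base T \<B> \<longleftrightarrow> countable \<B> \<and> (\<forall>V \<in> \<B>. openin T V) \<and>
     (\<forall>U x. openin T U \<and> x \<in> U \<longrightarrow> (\<exists>V \<in> \<B>. x \<in> V \<and> V \<subseteq> U))"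

text \<open>
  Arguments of kernels are ordered as in the conditioning: \<^term>\<open>P (x, a)\<close> is \<open>P(dx' | x, a)\<close>
  and \<^term>\<open>Q (a, x')\<close> is \<open>Q(dy | a, x')\<close>.  The kernel \<open>R\<close> is given by its values on measurable
  rectangles; \<open>joint_kernel_unique_exists\<close> below shows that the description is proper.
\<close>

definition joint_kernel ::
  "'x topology \<Rightarrow> 'y topology \<Rightarrow> ('x \<times> 'a \<Rightarrow> 'x measure) \<Rightarrow> ('a \<times> 'x \<Rightarrow> 'y measure)
    \<Rightarrow> 'x measure \<times> 'a \<Rightarrow> ('x \<times> 'y) measure" where
  "joint_kernel TX TY P Q = (\<lambda>(z, a). THE \<rho>. \<rho> \<in> prob_measures (prod_topology TX TY) \<and>
     (\<forall>B \<in> sets (borel_of TX). \<forall>C \<in> sets (borel_of TY).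
        emeasure \<rho> (B \<times> C) = (\<integral>\<^sup>+x. (\<integral>\<^sup>+x'\<in>B. emeasure (Q (a, x')) C \<partial>P (x, a)) \<partial>z)))"

text \<open>\<open>R'(C | z, a) = R(X \<times> C | z, a)\<close>, i.e. the marginal of \<open>R\<close> on the second component.\<close>

definition obs_kernel ::
  "'x topology \<Rightarrow> 'y topology \<Rightarrow> ('x \<times> 'a \<Rightarrow> 'x measure) \<Rightarrow> ('a \<times> 'x \<Rightarrow> 'y measure)
    \<Rightarrow> 'x measure \<times> 'a \<Rightarrow> 'y measure" where
  "obs_kernel TX TY P Q s = distr (joint_kernel TX TY P Q s) (borel_of TY) snd"

text \<open>The stochastic kernels \<open>H\<close> with \<open>R(B \<times> C | z, a) = \<integral>\<^sub>C H(B | z, a, y) R'(dy | z, a)\<close>.\<close>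

definition is_filter_kernel ::
  "'x topology \<Rightarrow> 'y topology \<Rightarrow> 'a topology \<Rightarrow> ('x \<times> 'a \<Rightarrow> 'x measure) \<Rightarrow> ('a \<times> 'x \<Rightarrow> 'y measure)
    \<Rightarrow> ('x measure \<times> 'a \<times> 'y \<Rightarrow> 'x measure) \<Rightarrow> bool" where
  "is_filter_kernel TX TY TA P Q H \<longleftrightarrow>
     stochastic_kernel TX (prod_topology (weak_topology TX) (prod_topology TA TY)) H \<and>
     (\<forall>B \<in> sets (borel_of TX). \<forall>C \<in> sets (borel_of TY). \<forall>z \<in> prob_measures TX. \<forall>a \<in> topspace TA.
        emeasure (joint_kernel TX TY P Q (z, a)) (B \<times> C) =
        (\<integral>\<^sup>+y\<in>C. emeasure (H (z, a, y)) B \<partial>obs_kernel TX TY P Q (z, a)))"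

text \<open>\<open>q(D | z, a) = R'({y. H(z, a, y) \<in> D} | z, a)\<close>, the integral of the indicator of
  \<open>H(z, a, y) \<in> D\<close> with respect to \<open>R'(dy | z, a)\<close>.\<close>

definition belief_transition ::
  "'x topology \<Rightarrow> 'y topology \<Rightarrow> ('x \<times> 'a \<Rightarrow> 'x measure) \<Rightarrow> ('a \<times> 'x \<Rightarrow> 'y measure)
    \<Rightarrow> ('x measure \<times> 'a \<times> 'y \<Rightarrow> 'x measure) \<Rightarrow> 'x measure \<times> 'a \<Rightarrow> 'x measure measure" where
  "belief_transition TX TY P Q H = (\<lambda>(z, a).
     distr (obs_kernel TX TY P Q (z, a)) (borel_of (weak_topology TX)) (\<lambda>y. H (z, a, y)))"

definition rect_family ::
  "'x topology \<Rightarrow> 'y topology \<Rightarrow> ('x \<times> 'a \<Rightarrow> 'x measure) \<Rightarrow> ('a \<times> 'x \<Rightarrow> 'y measure)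
    \<Rightarrow> 'x set \<Rightarrow> ('x measure \<times> 'a \<Rightarrow> real) set" where
  "rect_family TX TY P Q B = {\<lambda>s. measure (joint_kernel TX TY P Q s) (B \<times> C) | C. openin TY C}"

lemma space_borel_of [simp]: "space (borel_of T) = topspace T"
  unfolding borel_of_def by (rule space_measure_of) (auto dest: openin_subset)

lemma sets_borel_of: "sets (borel_of T) = sigma_sets (topspace T) {U. openin T U}"
  unfolding borel_of_def by (rule sets_measure_of) (auto dest: openin_subset)

lemma borel_of_open: "openin T U \<Longrightarrow> U \<in> sets (borel_of T)"
  by (auto simp: sets_borel_of)

lemma sets_borel_of_top_of_set:
  "sets (borel_of (top_of_set X)) = sets (restrict_space borel X)"
proof -
  have "sets (restrict_space borel X) = {(\<lambda>x. x) -` S \<inter> X | S. S \<in> sigma_sets UNIV {U. open U}}"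
    by (auto simp: sets_restrict_space borel_def)
  also have "\<dots> = sigma_sets X {(\<lambda>x. x) -` U \<inter> X | U. U \<in> {U. open U}}"
    by (rule sigma_sets_vimage_commute) simp
  also have "{(\<lambda>x. x) -` U \<inter> X | U. U \<in> {U. open U}} = {U. openin (top_of_set X) U}"
    by (auto simp: openin_open)
  finally show ?thesis
    by (simp add: sets_borel_of)
qed

lemma continuous_map_measurable_borel_of:
  assumes "continuous_map T1 T2 f"
  shows "f \<in> borel_of T1 \<rightarrow>\<^sub>M borel_of T2"
  unfolding borel_of_def[of T2]
proof (rule measurable_measure_of)
  show "{U. openin T2 U} \<subseteq> Pow (topspace T2)" by (auto dest: openin_subset)
  show "f \<in> space (borel_of T1) \<rightarrow> topspace T2"
    using assms by (simp add: continuous_map_funspace)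
next
  fix U assume "U \<in> {U. openin T2 U}"
  then have "openin T1 {x \<in> topspace T1. f x \<in> U}"
    using assms by (auto simp: continuous_map_def)
  moreover have "f -` U \<inter> space (borel_of T1) = {x \<in> topspace T1. f x \<in> U}" by auto
  ultimately show "f -` U \<inter> space (borel_of T1) \<in> sets (borel_of T1)"
    by (auto intro: borel_of_open)
qed

lemma topspace_weak_topology [simp]: "topspace (weak_topology T) = prob_measures T"
proof -
  have "prob_measures T \<in>
     {{\<mu> \<in> prob_measures T. (\<integral>x. f x \<partial>\<mu>) \<in> U} | f U. f \<in> bounded_continuous T \<and> open U}"
    by (rule CollectI, rule exI[of _ "\<lambda>_. 0"], rule exI[of _ UNIV])
       (auto simp: bounded_continuous_def intro: bounded_subset[of "{0}"])
  then show ?thesis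
    unfolding weak_topology_def topology_generated_by_topspace by blast
qed

lemma limitin_weak_topology:
  "limitin (weak_topology T) \<mu> \<nu> F \<longleftrightarrow>
     \<nu> \<in> prob_measures T \<and> (\<forall>\<^sub>F n in F. \<mu> n \<in> prob_measures T) \<and>
     (\<forall>f \<in> bounded_continuous T. ((\<lambda>n. \<integral>x. f x \<partial>\<mu> n) \<longlongrightarrow> (\<integral>x. f x \<partial>\<nu>)) F)"
  (is "?L \<longleftrightarrow> ?R")
proof
  assume L: ?L
  have "((\<lambda>n. \<integral>x. f x \<partial>\<mu> n) \<longlongrightarrow> (\<integral>x. f x \<partial>\<nu>)) F" if f: "f \<in> bounded_continuous T" for f
  proof (rule topological_tendstoI)
    fix U :: "real set" assume U: "open U" "(\<integral>x. f x \<partial>\<nu>) \<in> U"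
    have "openin (weak_topology T) {\<mu> \<in> prob_measures T. (\<integral>x. f x \<partial>\<mu>) \<in> U}"
      unfolding weak_topology_def by (rule topology_generated_by_Basis) (use f U in blast)
    moreover have "\<nu> \<in> {\<mu> \<in> prob_measures T. (\<integral>x. f x \<partial>\<mu>) \<in> U}"
      using L U by (simp add: limitin_def)
    ultimately have "\<forall>\<^sub>F n in F. \<mu> n \<in> {\<mu> \<in> prob_measures T. (\<integral>x. f x \<partial>\<mu>) \<in> U}"
      using L unfolding limitin_def by blast
    then show "\<forall>\<^sub>F n in F. (\<integral>x. f x \<partial>\<mu> n) \<in> U"
      by (rule eventually_mono) simp
  qed
  moreover have "\<forall>\<^sub>F n in F. \<mu> n \<in> prob_measures T"
    using L openin_topspace[of "weak_topology T"] unfolding limitin_def by simp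
  ultimately show ?R using L unfolding limitin_def by simp
next
  assume R: ?R
  have ev: "\<forall>\<^sub>F n in F. \<mu> n \<in> V" if "generate_topology_on
      {{\<mu> \<in> prob_measures T. (\<integral>x. f x \<partial>\<mu>) \<in> U} | f U. f \<in> bounded_continuous T \<and> open U} V"
    "\<nu> \<in> V" for V
    using that
  proof (induction V rule: generate_topology_on.induct)
    case (Int a b)
    then show ?case by (simp add: eventually_conj)
  next
    case (UN K)
    then obtain k where k: "k \<in> K" "\<nu> \<in> k" by auto
    with UN have "\<forall>\<^sub>F n in F. \<mu> n \<in> k" by blast
    then show ?case by (rule eventually_mono) (use k in blast)
  next
    case (Basis s)
    then obtain f U where s: "s = {\<mu> \<in> prob_measures T. (\<integral>x. f x \<partial>\<mu>) \<in> U}"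
      and f: "f \<in> bounded_continuous T" "open U" by blast
    with Basis have "(\<integral>x. f x \<partial>\<nu>) \<in> U" by simp
    with R f have "\<forall>\<^sub>F n in F. (\<integral>x. f x \<partial>\<mu> n) \<in> U"
      by (auto dest!: topological_tendstoD)
    with R have "\<forall>\<^sub>F n in F. \<mu> n \<in> prob_measures T \<and> (\<integral>x. f x \<partial>\<mu> n) \<in> U"
      by (simp add: eventually_conj)
    then show ?case unfolding s by simp
  qed simp
  show ?L
    unfolding limitin_def
  proof (intro conjI allI impI)
    show "\<nu> \<in> topspace (weak_topology T)" using R by simp
    fix V assume "openin (weak_topology T) V \<and> \<nu> \<in> V"
    then show "\<forall>\<^sub>F n in F. \<mu> n \<in> V"
      by (intro ev) (auto simp: weak_topology_def openin_topology_generated_by_iff)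
  qed
qed

lemma stochastic_kernel_measurable:
  assumes "stochastic_kernel T1 T2 K"
  shows "K \<in> borel_of T2 \<rightarrow>\<^sub>M prob_algebra (borel_of T1)"
proof (rule measurable_prob_algebraI)
  show "prob_space (K s)" if "s \<in> space (borel_of T2)" for s
    using assms that by (simp add: stochastic_kernel_def prob_measures_def)
  show "K \<in> borel_of T2 \<rightarrow>\<^sub>M subprob_algebra (borel_of T1)"
  proof (rule measurable_subprob_algebra)
    fix s assume s: "s \<in> space (borel_of T2)"
    then have p: "prob_space (K s)" "sets (K s) = sets (borel_of T1)"
      using assms by (auto simp: stochastic_kernel_def prob_measures_def)
    show "subprob_space (K s)" using p by (simp add: prob_space_imp_subprob_space)
    show "sets (K s) = sets (borel_of T1)" by (rule p)
  next
    fix B assume B: "B \<in> sets (borel_of T1)"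
    have "(\<lambda>s. ennreal (measure (K s) B)) \<in> borel_measurable (borel_of T2)"
      using assms B by (auto simp: stochastic_kernel_def)
    moreover have "emeasure (K s) B = ennreal (measure (K s) B)" if "s \<in> space (borel_of T2)" for s
      using assms that
      by (auto simp: stochastic_kernel_def prob_measures_def prob_space_def
          intro!: finite_measure.emeasure_eq_measure)
    ultimately show "(\<lambda>s. emeasure (K s) B) \<in> borel_measurable (borel_of T2)"
      by (subst measurable_cong[where g = "\<lambda>s. ennreal (measure (K s) B)"]) auto
  qed
qed

lemma sets_borel_of_prod:
  fixes X :: "'x::polish_space set" and Y :: "'y::polish_space set"
  shows "sets (borel_of (prod_topology (top_of_set X) (top_of_set Y))) =
         sets (borel_of (top_of_set X) \<Otimes>\<^sub>M borel_of (top_of_set Y))" (is "sets ?N = sets ?M")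
proof
  have fst: "fst \<in> ?N \<rightarrow>\<^sub>M borel_of (top_of_set X)" and snd: "snd \<in> ?N \<rightarrow>\<^sub>M borel_of (top_of_set Y)"
    by (intro continuous_map_measurable_borel_of continuous_map_fst continuous_map_snd)+
  have "(\<lambda>p. (fst p, snd p)) \<in> ?N \<rightarrow>\<^sub>M ?M"
    using fst snd by (rule measurable_Pair)
  then have id: "(\<lambda>p. p) \<in> ?N \<rightarrow>\<^sub>M ?M" by simp
  show "sets ?M \<subseteq> sets ?N"
  proof
    fix S assume S: "S \<in> sets ?M"
    then have "S \<subseteq> space ?N" using sets.sets_into_space[OF S] by (simp add: space_pair_measure)
    moreover have "(\<lambda>p. p) -` S \<inter> space ?N \<in> sets ?N" using id S by (rule measurable_sets)
    ultimately show "S \<in> sets ?N" by (simp add: Int_absorb2)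
  qed
next
  have "(\<lambda>p. (fst p, snd p)) \<in> ?M \<rightarrow>\<^sub>M (borel :: ('x \<times> 'y) measure)"
  proof (rule borel_measurable_Pair)
    show "fst \<in> borel_measurable ?M"
      using measurable_fst[of "borel_of (top_of_set X)" "borel_of (top_of_set Y)"]
      by (simp add: measurable_cong_sets[OF refl sets_borel_of_top_of_set] measurable_restrict_space2_iff)
    show "snd \<in> borel_measurable ?M"
      using measurable_snd[of "borel_of (top_of_set X)" "borel_of (top_of_set Y)"]
      by (simp add: measurable_cong_sets[OF refl sets_borel_of_top_of_set] measurable_restrict_space2_iff)
  qed
  then have id: "(\<lambda>p. p) \<in> ?M \<rightarrow>\<^sub>M (borel :: ('x \<times> 'y) measure)" by simp
  show "sets ?N \<subseteq> sets ?M"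
  proof
    fix S assume "S \<in> sets ?N"
    then have "S \<in> sets (restrict_space borel (X \<times> Y))" by (simp add: sets_borel_of_top_of_set)
    then obtain S' where S': "S' \<in> sets borel" "S = (X \<times> Y) \<inter> S'"
      by (auto simp: sets_restrict_space)
    have "(\<lambda>p. p) -` S' \<inter> space ?M \<in> sets ?M" using id S'(1) by (rule measurable_sets)
    then show "S \<in> sets ?M" by (simp add: S'(2) space_pair_measure Int_commute)
  qed
qed

lemma joint_kernel_unique_exists:
  fixes X :: "'x::polish_space set" and Y :: "'y::polish_space set" and A :: "'a::polish_space set"
  defines "TX \<equiv> top_of_set X" and "TY \<equiv> top_of_set Y" and "TA \<equiv> top_of_set A"
  assumes P: "stochastic_kernel TX (prod_topology TX TA) P"
    and Q: "stochastic_kernel TY (prod_topology TA TX) Q"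
    and z: "z \<in> prob_measures TX" and a: "a \<in> A"
  shows "\<exists>!\<rho>. \<rho> \<in> prob_measures (prod_topology TX TY) \<and>
     (\<forall>B \<in> sets (borel_of TX). \<forall>C \<in> sets (borel_of TY).
        emeasure \<rho> (B \<times> C) = (\<integral>\<^sup>+x. (\<integral>\<^sup>+x'\<in>B. emeasure (Q (a, x')) C \<partial>P (x, a)) \<partial>z))"
    (is "\<exists>!\<rho>. \<rho> \<in> _ \<and> ?rect \<rho>")
proof -
  let ?X = "borel_of TX" and ?Y = "borel_of TY" and ?N = "borel_of TX \<Otimes>\<^sub>M borel_of TY"
  have N: "sets (borel_of (prod_topology TX TY)) = sets ?N"
    unfolding TX_def TY_def by (rule sets_borel_of_prod)
  have Pa: "(\<lambda>x. P (x, a)) \<in> ?X \<rightarrow>\<^sub>M prob_algebra ?X"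
    by (rule measurable_compose[OF continuous_map_measurable_borel_of
          stochastic_kernel_measurable[OF P]])
       (use a in \<open>simp add: continuous_map_pairwise o_def TA_def\<close>)
  have Qa: "(\<lambda>x. Q (a, x)) \<in> ?X \<rightarrow>\<^sub>M prob_algebra ?Y"
    by (rule measurable_compose[OF continuous_map_measurable_borel_of
          stochastic_kernel_measurable[OF Q]])
       (use a in \<open>simp add: continuous_map_pairwise o_def TA_def\<close>)
  define G where "G x = distr (Q (a, x)) ?N (Pair x)" for x
  have Qp: "prob_space (Q (a, x))" "sets (Q (a, x)) = sets ?Y" if "x \<in> space ?X" for x
    using measurable_space[OF Qa that] by (simp_all add: space_prob_algebra)
  have Pp: "prob_space (P (x, a))" "sets (P (x, a)) = sets ?X" if "x \<in> space ?X" for x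
    using measurable_space[OF Pa that] by (simp_all add: space_prob_algebra)
  have Pair: "Pair x \<in> Q (a, x) \<rightarrow>\<^sub>M ?N" if "x \<in> space ?X" for x
    using measurable_Pair1'[OF that] by (simp add: measurable_cong_sets[OF Qp(2)[OF that] refl])
  have "G \<in> ?X \<rightarrow>\<^sub>M subprob_algebra ?N"
    unfolding G_def
    by (rule measurable_distr2[where M = ?Y]) (use Qa in \<open>auto dest: measurable_prob_algebraD\<close>)
  then have G: "G \<in> ?X \<rightarrow>\<^sub>M prob_algebra ?N"
    by (rule measurable_prob_algebraI[rotated])
       (auto simp: G_def intro!: prob_space.prob_space_distr Qp Pair simp del: space_borel_of)
  have Gr: "emeasure (G x) (B \<times> C) = emeasure (Q (a, x)) C * indicator B x"
    if "x \<in> space ?X" "B \<in> sets ?X" "C \<in> sets ?Y" for x B C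
  proof -
    have "emeasure (G x) (B \<times> C) = emeasure (Q (a, x)) (Pair x -` (B \<times> C) \<inter> space (Q (a, x)))"
      unfolding G_def using that by (intro emeasure_distr Pair) auto
    also have "Pair x -` (B \<times> C) \<inter> space (Q (a, x)) = (if x \<in> B then C else {})"
      using sets.sets_into_space[OF that(3)] sets_eq_imp_space_eq[OF Qp(2)[OF that(1)]] by auto
    finally show ?thesis by (auto simp: indicator_def)
  qed
  define K where "K x = P (x, a) \<bind> G" for x
  have K: "K \<in> ?X \<rightarrow>\<^sub>M prob_algebra ?N"
    unfolding K_def by (rule measurable_bind_prob_space[OF Pa G])
  have Kr: "emeasure (K x) (B \<times> C) = (\<integral>\<^sup>+x'\<in>B. emeasure (Q (a, x')) C \<partial>P (x, a))"
    if x: "x \<in> space ?X" and BC: "B \<in> sets ?X" "C \<in> sets ?Y" for x B C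
  proof -
    have sp: "space (P (x, a)) = space ?X" by (rule sets_eq_imp_space_eq[OF Pp(2)[OF x]])
    have "emeasure (K x) (B \<times> C) = (\<integral>\<^sup>+x'. emeasure (G x') (B \<times> C) \<partial>P (x, a))"
      unfolding K_def
      by (rule emeasure_bind[where N = ?N])
         (use sp x BC G Pp(2)[OF x] in \<open>auto dest: measurable_prob_algebraD cong: measurable_cong_sets\<close>)
    also have "\<dots> = (\<integral>\<^sup>+x'\<in>B. emeasure (Q (a, x')) C \<partial>P (x, a))"
      by (rule nn_integral_cong) (use sp Gr BC in simp)
    finally show ?thesis .
  qed
  have zs: "prob_space z" "sets z = sets ?X" "space z = space ?X"
    using z by (auto simp: prob_measures_def dest: sets_eq_imp_space_eq)
  have zin: "z \<in> space (prob_algebra ?X)" using zs by (simp add: space_prob_algebra)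
  define \<rho> where "\<rho> = z \<bind> K"
  have \<rho>: "prob_space \<rho>" "sets \<rho> = sets ?N"
    unfolding \<rho>_def using prob_space_bind'[OF zin K] sets_bind'[OF zin K] by auto
  have rect: "?rect \<rho>"
  proof (intro ballI)
    fix B C assume BC: "B \<in> sets ?X" "C \<in> sets ?Y"
    have "emeasure \<rho> (B \<times> C) = (\<integral>\<^sup>+x. emeasure (K x) (B \<times> C) \<partial>z)"
      unfolding \<rho>_def
      by (rule emeasure_bind[where N = ?N])
         (use zs BC K prob_space.not_empty[OF zs(1)] in
           \<open>auto dest: measurable_prob_algebraD cong: measurable_cong_sets\<close>)
    also have "\<dots> = (\<integral>\<^sup>+x. (\<integral>\<^sup>+x'\<in>B. emeasure (Q (a, x')) C \<partial>P (x, a)) \<partial>z)"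
      by (rule nn_integral_cong) (use zs Kr BC in simp)
    finally show "emeasure \<rho> (B \<times> C) = \<dots>" .
  qed
  show ?thesis
  proof (rule ex1I[of _ \<rho>], safe)
    show "\<rho> \<in> prob_measures (prod_topology TX TY)"
      using \<rho> N by (simp add: prob_measures_def)
    show "emeasure \<rho> (B \<times> C) = (\<integral>\<^sup>+x. (\<integral>\<^sup>+x'\<in>B. emeasure (Q (a, x')) C \<partial>P (x, a)) \<partial>z)"
      if "B \<in> sets ?X" "C \<in> sets ?Y" for B C
      using rect that by blast
  next
    fix \<rho>' assume \<rho>': "\<rho>' \<in> prob_measures (prod_topology TX TY)"
      and rect': "?rect \<rho>'"
    have sN: "sets ?N = sigma_sets (space ?X \<times> space ?Y) {B \<times> C | B C. B \<in> sets ?X \<and> C \<in> sets ?Y}"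
      by (simp add: sets_pair_measure)
    have fin: "finite_measure \<rho>'" using \<rho>' by (simp add: prob_measures_def prob_space_def)
    show "\<rho>' = \<rho>"
    proof (rule measure_eqI_generator_eq[where A = "\<lambda>_::nat. space ?X \<times> space ?Y",
          OF Int_stable_pair_measure_generator pair_measure_closed])
      show "emeasure \<rho>' S = emeasure \<rho> S"
        if "S \<in> {B \<times> C | B C. B \<in> sets ?X \<and> C \<in> sets ?Y}" for S
        using that rect rect' by auto
      show "sets \<rho>' = sigma_sets (space ?X \<times> space ?Y) {B \<times> C | B C. B \<in> sets ?X \<and> C \<in> sets ?Y}"
        using \<rho>' N sN by (simp add: prob_measures_def)
      show "sets \<rho> = sigma_sets (space ?X \<times> space ?Y) {B \<times> C | B C. B \<in> sets ?X \<and> C \<in> sets ?Y}"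
        using \<rho>(2) sN by simp
      show "range (\<lambda>_::nat. space ?X \<times> space ?Y) \<subseteq> {B \<times> C | B C. B \<in> sets ?X \<and> C \<in> sets ?Y}"
        by (auto simp del: space_borel_of)
      show "emeasure \<rho>' (space ?X \<times> space ?Y) \<noteq> \<infinity>"
        using fin by (simp add: finite_measure.emeasure_finite)
    qed simp
  qed
qed

lemma joint_kernel_rect:
  fixes X :: "'x::polish_space set" and Y :: "'y::polish_space set" and A :: "'a::polish_space set"
  defines "TX \<equiv> top_of_set X" and "TY \<equiv> top_of_set Y" and "TA \<equiv> top_of_set A"
  assumes "stochastic_kernel TX (prod_topology TX TA) P"
    and "stochastic_kernel TY (prod_topology TA TX) Q"
    and "z \<in> prob_measures TX" and "a \<in> A"
  shows "joint_kernel TX TY P Q (z, a) \<in> prob_measures (prod_topology TX TY)"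
    and "B \<in> sets (borel_of TX) \<Longrightarrow> C \<in> sets (borel_of TY) \<Longrightarrow>
      emeasure (joint_kernel TX TY P Q (z, a)) (B \<times> C) =
      (\<integral>\<^sup>+x. (\<integral>\<^sup>+x'\<in>B. emeasure (Q (a, x')) C \<partial>P (x, a)) \<partial>z)"
  using theI'[OF joint_kernel_unique_exists[OF assms(4-7)[unfolded TX_def TY_def TA_def]]]
  unfolding joint_kernel_def TX_def TY_def by auto

lemma emeasure_obs_kernel:
  fixes X :: "'x::polish_space set" and Y :: "'y::polish_space set" and A :: "'a::polish_space set"
  defines "TX \<equiv> top_of_set X" and "TY \<equiv> top_of_set Y" and "TA \<equiv> top_of_set A"
  assumes "stochastic_kernel TX (prod_topology TX TA) P"
    and "stochastic_kernel TY (prod_topology TA TX) Q"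
    and "z \<in> prob_measures TX" and "a \<in> A" and C: "C \<in> sets (borel_of TY)"
  shows "emeasure (obs_kernel TX TY P Q (z, a)) C = emeasure (joint_kernel TX TY P Q (z, a)) (X \<times> C)"
proof -
  let ?R = "joint_kernel TX TY P Q (z, a)"
  have R: "sets ?R = sets (borel_of (prod_topology TX TY))"
    using joint_kernel_rect(1)[OF assms(4-7)[unfolded TX_def TY_def TA_def]]
    by (simp add: prob_measures_def TX_def TY_def)
  have "snd \<in> ?R \<rightarrow>\<^sub>M borel_of TY"
    using continuous_map_measurable_borel_of[OF continuous_map_snd]
    by (simp add: measurable_cong_sets[OF R refl])
  then have "emeasure (obs_kernel TX TY P Q (z, a)) C = emeasure ?R (snd -` C \<inter> space ?R)"
    unfolding obs_kernel_def using C by (rule emeasure_distr)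
  also have "snd -` C \<inter> space ?R = X \<times> C"
    using sets_eq_imp_space_eq[OF R] sets.sets_into_space[OF C] by (auto simp: TX_def TY_def)
  finally show ?thesis .
qed

end

theory Submission
  imports Defs "HOL-Library.Diagonal_Subsequence"
begin

text \<open>
  Let \<open>\<P>(X)\<close> be the space of probability measures on \<open>X\<close> with the weak topology, and write
  \<open>s = (z, a)\<close> for a point of \<open>\<P>(X) \<times> A\<close>. The kernels \<open>P\<close> and \<open>Q\<close> enter the theorem only
  through the joint law \<open>R(\<cdot> | s)\<close>, and the argument works for every family of joint laws on
  \<open>X \<times> Y\<close> that is indexed by a second countable space and satisfies the equicontinuity condition;
  this is the setting of the locale \<open>equicontinuous_joint_kernel\<close>.

  Equicontinuity of \<open>R(E \<times> C | \<cdot>)\<close> over open \<open>C\<close> says that \<open>R(E \<times> C | s')\<close> is close to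
  \<open>R(E \<times> C | s)\<close> uniformly in open \<open>C\<close>, and by outer regularity of finite measures on a metric space
  uniformly in Borel \<open>C\<close> (\<open>uniform_near\<close>). For \<open>E = X\<close> this is continuity of the marginal
  \<open>R'\<close> in total variation. It also yields one measure \<open>m\<close> that dominates all the measures
  \<open>R(E \<times> \<cdot> | s)\<close>: average the marginals over a countable dense set of points \<open>s\<close>
  (\<open>dominating_measure\<close>). With respect to \<open>m\<close>, uniform closeness in \<open>C\<close> is closeness of densities
  in \<open>L\<^sup>1(m)\<close>.

  Let \<open>p\<^sub>s\<close> be the density of \<open>R'(\<cdot> | s)\<close> and let \<open>H\<close> be any filter kernel. The measure
  \<open>R(E \<times> \<cdot> | s)\<close> has density \<open>H(E | s, y) p\<^sub>s(y)\<close>. If \<open>s\<^sub>n \<rightarrow> s\<close>, these densities converge in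
  \<open>L\<^sup>1(m)\<close> for each of the countably many finite intersections \<open>E\<close> of base sets, so along one diagonal
  subsequence they converge for almost all \<open>y\<close> and all \<open>E\<close> at once. As \<open>E = X\<close> gives
  \<open>p\<^sub>s\<^sub>n(y) \<rightarrow> p\<^sub>s(y)\<close>, division gives \<open>H(E | s\<^sub>n, y) \<rightarrow> H(E | s, y)\<close> wherever \<open>p\<^sub>s(y) > 0\<close>, which is
  \<open>R'(\<cdot> | s)\<close>-almost everywhere. Inclusion-exclusion extends this to finite unions of base sets, and
  these determine weak convergence (\<open>weak_topology_eq_generated\<close>). This proves the convergence in (i),
  for every filter kernel (\<open>disintegration_subsequence\<close>). Statement (ii) follows by dominated
  convergence along subsequences together with total variation continuity of \<open>R'\<close>
  (\<open>integral_disintegration_tendsto\<close>).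

  What remains is to produce a filter kernel that is jointly measurable in \<open>(z, a, y)\<close>. Continuity of
  \<open>s \<mapsto> R(E \<times> \<cdot> | s)\<close> into \<open>L\<^sup>1(m)\<close> provides jointly measurable densities for the sets \<open>E\<close>
  (\<open>jointly_measurable_density\<close>); Dynkin's theorem extends them to all Borel sets; and a coding of the
  Polish space by real numbers turns these versions into a kernel by way of quantile functions
  (\<open>disintegration_kernel\<close>). Since the Borel sets of \<open>\<P>(X)\<close> are those of its
  weak topology, second countability of that topology is used throughout to pass between it and the
  evaluations \<open>z \<mapsto> z(B)\<close>.
\<close>

section \<open>Generated topologies and countable bases\<close>

lemma openin_topology_generated_by_minimal:
  assumes "openin (topology_generated_by \<S>) U" and "\<And>V. V \<in> \<S> \<Longrightarrow> openin T V"
  shows "openin T U"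
proof -
  have "generate_topology_on \<S> U"
    using assms(1) by (simp add: openin_topology_generated_by_iff)
  then show ?thesis
    by induction (use assms(2) in auto)
qed

lemma limitin_topology_generated_by:
  assumes "l \<in> \<Union>\<S>" and ev: "\<And>V. V \<in> \<S> \<Longrightarrow> l \<in> V \<Longrightarrow> \<forall>\<^sub>F n in F. x n \<in> V"
  shows "limitin (topology_generated_by \<S>) x l F"
  unfolding limitin_def
proof (intro conjI allI impI)
  fix U assume "openin (topology_generated_by \<S>) U \<and> l \<in> U"
  then have "generate_topology_on \<S> U" "l \<in> U"
    by (auto simp: openin_topology_generated_by_iff)
  then show "\<forall>\<^sub>F n in F. x n \<in> U"
  proof induction
    case (UN K)
    then obtain k where k: "k \<in> K" "l \<in> k" by auto
    with UN have "\<forall>\<^sub>F n in F. x n \<in> k" by blast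
    then show ?case by (rule eventually_mono) (use k in blast)
  qed (auto simp: eventually_conj ev)
qed (use assms in auto)

lemma topology_generated_by_base:
  assumes "openin (topology_generated_by \<S>) U" "x \<in> U"
  obtains \<F> where "finite \<F>" "\<F> \<noteq> {}" "\<F> \<subseteq> \<S>" "x \<in> \<Inter>\<F>" "\<Inter>\<F> \<subseteq> U"
proof -
  have "generate_topology_on \<S> U"
    using assms(1) by (simp add: openin_topology_generated_by_iff)
  then have "\<exists>\<F>. finite \<F> \<and> \<F> \<noteq> {} \<and> \<F> \<subseteq> \<S> \<and> x \<in> \<Inter>\<F> \<and> \<Inter>\<F> \<subseteq> U"
    using assms(2)
  proof induction
    case (Int a b)
    then obtain F G where
      "finite F \<and> F \<noteq> {} \<and> F \<subseteq> \<S> \<and> x \<in> \<Inter>F \<and> \<Inter>F \<subseteq> a"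
      "finite G \<and> G \<noteq> {} \<and> G \<subseteq> \<S> \<and> x \<in> \<Inter>G \<and> \<Inter>G \<subseteq> b" by auto
    then show ?case by (intro exI[of _ "F \<union> G"]) auto
  next
    case (UN K)
    then obtain k where k: "k \<in> K" "x \<in> k" by auto
    from UN.IH[OF this] obtain F where
      "finite F \<and> F \<noteq> {} \<and> F \<subseteq> \<S> \<and> x \<in> \<Inter>F \<and> \<Inter>F \<subseteq> k" by blast
    with k show ?case by (intro exI[of _ F]) auto
  next
    case (Basis s)
    then show ?case by (intro exI[of _ "{s}"]) auto
  qed auto
  then show ?thesis using that by blast
qed

lemma second_countable_iff_countable_base: "second_countable T \<longleftrightarrow> (\<exists>\<B>. countable_base T \<B>)"
  by (simp add: second_countable_def countable_base_def)

lemma countable_base_topology_generated_by: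
  assumes "countable \<S>"
  shows "countable_base (topology_generated_by \<S>) (Inter ` {\<F>. finite \<F> \<and> \<F> \<subseteq> \<S> \<and> \<F> \<noteq> {}})"
    (is "countable_base _ ?\<B>")
  unfolding countable_base_def
proof (intro conjI ballI allI impI; (elim conjE)?)
  have "countable {\<F>. finite \<F> \<and> \<F> \<subseteq> \<S>}"
    using countable_Collect_finite_subset[OF assms] by (simp add: conj_commute)
  then show "countable ?\<B>"
    by (intro countable_image) (rule countable_subset[rotated], auto)
  show "openin (topology_generated_by \<S>) V" if "V \<in> ?\<B>" for V
    using that by (auto simp del: Inter_iff intro!: openin_Inter intro: topology_generated_by_Basis)
  show "\<exists>V\<in>?\<B>. x \<in> V \<and> V \<subseteq> U" if "openin (topology_generated_by \<S>) U" "x \<in> U" for U x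
    using topology_generated_by_base[OF that] by (metis (mono_tags, lifting) image_eqI mem_Collect_eq)
qed

lemma countable_base_prod_topology:
  assumes 1: "countable_base T1 \<B>1" and 2: "countable_base T2 \<B>2"
  shows "countable_base (prod_topology T1 T2) ((\<lambda>(U, V). U \<times> V) ` (\<B>1 \<times> \<B>2))"
    (is "countable_base _ ?\<B>")
  unfolding countable_base_def
proof (intro conjI ballI allI impI; (elim conjE)?)
  show "countable ?\<B>" using 1 2 by (simp add: countable_base_def)
  show "openin (prod_topology T1 T2) V" if "V \<in> ?\<B>" for V
    using that 1 2 by (auto simp: openin_prod_Times_iff countable_base_def)
  fix W p assume "openin (prod_topology T1 T2) W" "p \<in> W"
  then obtain U V where UV: "openin T1 U" "openin T2 V" "fst p \<in> U" "snd p \<in> V" "U \<times> V \<subseteq> W"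
    unfolding openin_prod_topology_alt by (metis prod.collapse)
  have "\<exists>U'\<in>\<B>1. fst p \<in> U' \<and> U' \<subseteq> U" "\<exists>V'\<in>\<B>2. snd p \<in> V' \<and> V' \<subseteq> V"
    using 1 2 UV(1-4) by (simp_all add: countable_base_def)
  then obtain U' V' where U': "U' \<in> \<B>1" "fst p \<in> U'" "U' \<subseteq> U" and V': "V' \<in> \<B>2" "snd p \<in> V'" "V' \<subseteq> V"
    by blast
  show "\<exists>V\<in>?\<B>. p \<in> V \<and> V \<subseteq> W"
    using U' V' UV(5) by (intro bexI[of _ "U' \<times> V'"]) (auto simp: mem_Times_iff)
qed

lemma second_countable_prod_topology:
  "second_countable T1 \<Longrightarrow> second_countable T2 \<Longrightarrow> second_countable (prod_topology T1 T2)"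
  unfolding second_countable_iff_countable_base using countable_base_prod_topology by blast

lemma second_countable_top_of_set:
  "second_countable (top_of_set (X :: 'a::second_countable_topology set))"
proof (rule second_countable_subtopology)
  obtain \<B> :: "'a set set" where "countable \<B>" "topological_basis \<B>"
    using ex_countable_basis by blast
  then show "second_countable (euclidean :: 'a topology)"
    unfolding second_countable_def
    by (intro exI[of _ \<B>]) (metis open_openin topological_basisE topological_basis_open)
qed

lemma openin_countable_Union_base:
  assumes "countable_base T \<B>" "openin T U"
  obtains \<V> where "countable \<V>" "\<V> \<subseteq> \<B>" "U = \<Union>\<V>"
proof (rule that[of "{V \<in> \<B>. V \<subseteq> U}"])
  show "countable {V \<in> \<B>. V \<subseteq> U}" using assms(1) by (simp add: countable_base_def)
  have "\<exists>V\<in>\<B>. x \<in> V \<and> V \<subseteq> U" if "x \<in> U" for x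
    using assms that by (simp add: countable_base_def)
  then show "U = \<Union>{V \<in> \<B>. V \<subseteq> U}" by fastforce
qed auto

text \<open>A base has to be countable here: an arbitrary open set must be a countable union of base sets, since
only countable unions of preimages are known to be measurable.\<close>

lemma measurable_borel_of_base:
  assumes base: "countable_base T \<B>" and f: "f \<in> space M \<rightarrow> topspace T"
    and pre: "\<And>V. V \<in> \<B> \<Longrightarrow> f -` V \<inter> space M \<in> sets M"
  shows "f \<in> M \<rightarrow>\<^sub>M borel_of T"
  unfolding borel_of_def
proof (rule measurable_measure_of)
  fix U assume "U \<in> {U. openin T U}"
  then obtain \<V> where \<V>: "countable \<V>" "\<V> \<subseteq> \<B>" "U = \<Union>\<V>"
    using openin_countable_Union_base[OF base] by blast
  have "f -` U \<inter> space M = (\<Union>V\<in>\<V>. f -` V \<inter> space M)" using \<V>(3) by auto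
  also have "\<dots> \<in> sets M" using \<V> pre by (intro sets.countable_UN'') auto
  finally show "f -` U \<inter> space M \<in> sets M" .
qed (use f in \<open>auto dest: openin_subset\<close>)

lemma measurable_borel_of_topology_generated_by:
  assumes "countable \<S>" and f: "f \<in> space M \<rightarrow> \<Union>\<S>"
    and pre: "\<And>V. V \<in> \<S> \<Longrightarrow> f -` V \<inter> space M \<in> sets M"
  shows "f \<in> M \<rightarrow>\<^sub>M borel_of (topology_generated_by \<S>)"
proof (rule measurable_borel_of_base[OF countable_base_topology_generated_by[OF assms(1)]])
  fix V assume "V \<in> Inter ` {\<F>. finite \<F> \<and> \<F> \<subseteq> \<S> \<and> \<F> \<noteq> {}}"
  then obtain \<F> where \<F>: "finite \<F>" "\<F> \<subseteq> \<S>" "\<F> \<noteq> {}" "V = \<Inter>\<F>" by auto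
  have "f -` V \<inter> space M = (\<Inter>W\<in>\<F>. f -` W \<inter> space M)" using \<F> by auto
  also have "\<dots> \<in> sets M" using \<F> pre by (intro sets.finite_INT) auto
  finally show "f -` V \<inter> space M \<in> sets M" .
qed (use f in auto)

text \<open>The Borel sets of a product of two second countable spaces are generated by measurable rectangles, so
measurability can be tested componentwise. For general topologies this can fail.\<close>

lemma measurable_borel_of_prod_topology:
  assumes "second_countable T1" "second_countable T2"
    and f: "f \<in> M \<rightarrow>\<^sub>M borel_of T1" and g: "g \<in> M \<rightarrow>\<^sub>M borel_of T2"
  shows "(\<lambda>x. (f x, g x)) \<in> M \<rightarrow>\<^sub>M borel_of (prod_topology T1 T2)"
proof -
  obtain \<B>1 \<B>2 where 1: "countable_base T1 \<B>1" and 2: "countable_base T2 \<B>2"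
    using assms(1,2) unfolding second_countable_iff_countable_base by blast
  show ?thesis
  proof (rule measurable_borel_of_base[OF countable_base_prod_topology[OF 1 2]])
    show "(\<lambda>x. (f x, g x)) \<in> space M \<rightarrow> topspace (prod_topology T1 T2)"
      using measurable_space[OF f] measurable_space[OF g] by auto
    fix W assume "W \<in> (\<lambda>(U, V). U \<times> V) ` (\<B>1 \<times> \<B>2)"
    then obtain U V where UV: "W = U \<times> V" "U \<in> \<B>1" "V \<in> \<B>2" by auto
    have "(\<lambda>x. (f x, g x)) -` W \<inter> space M = (f -` U \<inter> space M) \<inter> (g -` V \<inter> space M)"
      using UV by auto
    also have "\<dots> \<in> sets M"
      using UV 1 2 f g
      by (intro sets.Int measurable_sets) (auto intro: borel_of_open simp: countable_base_def)
    finally show "(\<lambda>x. (f x, g x)) -` W \<inter> space M \<in> sets M" .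
  qed
qed

section \<open>The weak topology has a countable subbase\<close>

text \<open>Lower semicontinuity is the one-sided continuity that \<open>z \<mapsto> z(U)\<close> has for open \<open>U\<close>; it is stable under
sums, nonnegative multiples and suprema, which makes it the tool to compare the topologies below.\<close>

definition lsc_map :: "'a topology \<Rightarrow> ('a \<Rightarrow> real) \<Rightarrow> bool" where
  "lsc_map T \<phi> \<longleftrightarrow> (\<forall>r. openin T {z \<in> topspace T. r < \<phi> z})"

lemma lsc_map_const: "lsc_map T (\<lambda>_. c)"
  unfolding lsc_map_def
proof
  show "openin T {z \<in> topspace T. r < c}" for r by (cases "r < c") auto
qed

lemma lsc_map_add:
  assumes "lsc_map T \<phi>" "lsc_map T \<psi>"
  shows "lsc_map T (\<lambda>z. \<phi> z + \<psi> z)"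
  unfolding lsc_map_def
proof
  fix r
  have "{z \<in> topspace T. r < \<phi> z + \<psi> z} =
      (\<Union>q. {z \<in> topspace T. q < \<phi> z} \<inter> {z \<in> topspace T. r - q < \<psi> z})"
  proof (intro equalityI subsetI)
    fix z assume z: "z \<in> {z \<in> topspace T. r < \<phi> z + \<psi> z}"
    then have "\<phi> z - (\<phi> z + \<psi> z - r) / 2 < \<phi> z" "r - (\<phi> z - (\<phi> z + \<psi> z - r) / 2) < \<psi> z"
      by (auto simp: field_simps)
    with z show "z \<in> (\<Union>q. {z \<in> topspace T. q < \<phi> z} \<inter> {z \<in> topspace T. r - q < \<psi> z})"
      by blast
  qed auto
  also have "openin T \<dots>"
    using assms unfolding lsc_map_def by (intro openin_Union) auto
  finally show "openin T {z \<in> topspace T. r < \<phi> z + \<psi> z}" .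
qed

lemma lsc_map_scale:
  assumes "lsc_map T \<phi>" "0 \<le> c"
  shows "lsc_map T (\<lambda>z. c * \<phi> z)"
proof (cases "c = 0")
  case False
  then have "{z \<in> topspace T. r < c * \<phi> z} = {z \<in> topspace T. r / c < \<phi> z}" for r
    using assms(2) by (auto simp: field_simps)
  then show ?thesis using assms(1) unfolding lsc_map_def by simp
qed (simp add: lsc_map_const)

lemma lsc_map_sum:
  assumes "\<And>i. i \<in> I \<Longrightarrow> lsc_map T (\<phi> i)"
  shows "lsc_map T (\<lambda>z. \<Sum>i\<in>I. \<phi> i z)"
  using assms by (induction I rule: infinite_finite_induct) (auto intro: lsc_map_const lsc_map_add)

lemma lsc_map_sup:
  assumes lsc: "\<And>n. lsc_map T (\<phi> n)" and le: "\<And>n z. z \<in> topspace T \<Longrightarrow> \<phi> n z \<le> \<psi> z"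
    and ge: "\<And>z r. z \<in> topspace T \<Longrightarrow> r < \<psi> z \<Longrightarrow> \<exists>n. r < \<phi> n z"
  shows "lsc_map T \<psi>"
  unfolding lsc_map_def
proof
  fix r
  have "{z \<in> topspace T. r < \<psi> z} = (\<Union>n. {z \<in> topspace T. r < \<phi> n z})"
    using le ge by (auto intro: less_le_trans)
  also have "openin T \<dots>" using lsc unfolding lsc_map_def by auto
  finally show "openin T {z \<in> topspace T. r < \<psi> z}" .
qed

lemma prob_measuresD:
  assumes "z \<in> prob_measures T"
  shows "prob_space z" "sets z = sets (borel_of T)" "space z = topspace T"
  using assms sets_eq_imp_space_eq[of z "borel_of T"] by (auto simp: prob_measures_def)

lemma continuous_map_borel_measurable:
  fixes f :: "'a \<Rightarrow> real"
  assumes "continuous_map T euclideanreal f"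
  shows "f \<in> borel_measurable (borel_of T)"
proof -
  have "sets (borel_of euclideanreal) = sets (borel :: real measure)"
    using sets_borel_of_top_of_set[of "UNIV :: real set"] by (simp add: sets_restrict_space)
  then show ?thesis
    using continuous_map_measurable_borel_of[OF assms] by (simp cong: measurable_cong_sets)
qed

lemma bounded_continuous_measurable:
  assumes "f \<in> bounded_continuous T" "z \<in> prob_measures T"
  shows "f \<in> borel_measurable z"
  using continuous_map_borel_measurable[of T f] assms prob_measuresD(2)[OF assms(2)]
  by (simp add: bounded_continuous_def cong: measurable_cong_sets)

lemma bounded_continuous_integrable:
  assumes f: "f \<in> bounded_continuous T" and z: "z \<in> prob_measures T"
  shows "integrable z f"
proof -
  interpret prob_space z using prob_measuresD[OF z] by simp
  obtain B where "\<And>x. x \<in> topspace T \<Longrightarrow> norm (f x) \<le> B"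
    using f by (auto simp: bounded_continuous_def bounded_iff)
  then show ?thesis
    using prob_measuresD(3)[OF z]
    by (intro integrable_const_bound[of _ B] bounded_continuous_measurable[OF f z]) auto
qed

lemma openin_weak_topology_integral:
  assumes "f \<in> bounded_continuous T" "open U"
  shows "openin (weak_topology T) {\<mu> \<in> prob_measures T. (\<integral>x. f x \<partial>\<mu>) \<in> U}"
  unfolding weak_topology_def by (rule topology_generated_by_Basis) (use assms in blast)

text \<open>The indicator of an open set is the increasing limit of the bounded continuous functions
\<open>min 1 (n * d(x, U\<^sup>c))\<close>, so \<open>z(U)\<close> is the supremum of their integrals.\<close>

lemma lsc_map_weak_topology_open:
  fixes X :: "'x::metric_space set"
  assumes "openin (top_of_set X) U"
  shows "lsc_map (weak_topology (top_of_set X)) (\<lambda>z. measure z U)"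
proof -
  let ?T = "top_of_set X"
  obtain V where V: "open V" "U = X \<inter> V" using assms by (auto simp: openin_open)
  \<comment> \<open>The distance to the empty set is 0 by convention, so the whole space is a separate case.\<close>
  define f where "f n x = (if V = UNIV then 1 else min 1 (real n * infdist x (- V)))" for n x
  have f: "f n \<in> bounded_continuous ?T" for n
  proof -
    have "continuous_on X (f n)"
      unfolding f_def by (cases "V = UNIV") (auto intro!: continuous_intros)
    moreover have "bounded (f n ` X)"
      by (rule boundedI[of _ 1]) (auto simp: f_def infdist_nonneg)
    ultimately show ?thesis by (simp add: bounded_continuous_def)
  qed
  have f01: "0 \<le> f n x" "f n x \<le> 1" for n x by (auto simp: f_def infdist_nonneg)
  have f0: "f n x = 0" if "x \<notin> V" for n x using that by (auto simp: f_def)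
  have flim: "(\<lambda>n. f n x) \<longlonglongrightarrow> indicator V x" for x
  proof (cases "x \<in> V \<and> V \<noteq> UNIV")
    case True
    then have pos: "0 < infdist x (- V)"
      using V(1) in_closed_iff_infdist_zero[of "- V" x] infdist_nonneg[of x "- V"]
      by (auto simp: closed_Compl less_le)
    obtain N where N: "1 < real N * infdist x (- V)" using reals_Archimedean3[OF pos] by blast
    have "f n x = 1" if "n \<ge> N" for n
    proof -
      have "real N * infdist x (- V) \<le> real n * infdist x (- V)"
        using that pos by (intro mult_right_mono) auto
      then show ?thesis using N True by (simp add: f_def)
    qed
    then have "\<forall>\<^sub>F n in sequentially. f n x = indicator V x"
      using True by (auto simp: eventually_sequentially)
    then show ?thesis by (rule tendsto_eventually)
  qed (use f0 in \<open>auto simp: f_def indicator_def\<close>)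
  have lim: "(\<lambda>n. \<integral>x. f n x \<partial>z) \<longlonglongrightarrow> measure z U"
    and le: "(\<integral>x. f n x \<partial>z) \<le> measure z U" if z: "z \<in> prob_measures ?T" for z n
  proof -
    interpret prob_space z using prob_measuresD[OF z] by simp
    have sp: "space z = X" using prob_measuresD(3)[OF z] by simp
    have U: "U \<in> sets z" using prob_measuresD(2)[OF z] assms by (simp add: borel_of_open)
    have mU: "(\<integral>x. indicator U x \<partial>z) = measure z U"
      using U by simp
    have "(\<lambda>n. \<integral>x. f n x \<partial>z) \<longlonglongrightarrow> (\<integral>x. indicator U x \<partial>z)"
    proof (rule integral_dominated_convergence[where w = "\<lambda>_. 1"])
      show "AE x in z. (\<lambda>n. f n x) \<longlonglongrightarrow> indicator U x"
        using flim sp V(2) by (intro AE_I2) (simp add: indicator_def)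
    qed (use U f01 bounded_continuous_measurable[OF f z] in auto)
    then show "(\<lambda>n. \<integral>x. f n x \<partial>z) \<longlonglongrightarrow> measure z U" using mU by simp
    have "(\<integral>x. f n x \<partial>z) \<le> (\<integral>x. indicator U x \<partial>z)"
    proof (rule integral_mono[OF bounded_continuous_integrable[OF f z]])
      show "f n x \<le> indicator U x" if "x \<in> space z" for x
        using that sp V(2) f01 f0 by (auto simp: indicator_def)
    qed (use U in \<open>simp add: emeasure_eq_measure\<close>)
    then show "(\<integral>x. f n x \<partial>z) \<le> measure z U" using mU by simp
  qed
  show ?thesis
  proof (rule lsc_map_sup[of _ "\<lambda>n z. \<integral>x. f n x \<partial>z"])
    show "lsc_map (weak_topology ?T) (\<lambda>z. \<integral>x. f n x \<partial>z)" for n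
      using openin_weak_topology_integral[OF f, of "{r<..}" n for r]
      unfolding lsc_map_def by simp
    show "\<exists>n. r < (\<integral>x. f n x \<partial>z)" if "z \<in> topspace (weak_topology ?T)" "r < measure z U" for z r
      using order_tendstoD(1)[OF lim, of z r] that
      by (auto simp: eventually_sequentially)
  qed (use le in auto)
qed

text \<open>Up to an error of one, a number \<open>t\<close> in the unit interval exceeds \<open>n t\<close> of the levels \<open>1/n, \<dots>, n/n\<close>.
Applied to \<open>t = f(x)\<close>, this approximates \<open>f\<close> from below by an average of indicators of open sets.\<close>

lemma sum_indicator_levels:
  fixes t :: real
  assumes t: "0 \<le> t" "t \<le> 1" and n: "0 < n"
  shows "(\<Sum>k<n. of_bool (real (Suc k) / n < t)) / n \<le> t"
    and "t - 1 / n \<le> (\<Sum>k<n. of_bool (real (Suc k) / n < t)) / n"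
proof -
  define N where "N = nat (\<lceil>n * t\<rceil> - 1)"
  have lt: "real (Suc k) / n < t \<longleftrightarrow> k < N" for k
    unfolding N_def using n by (simp add: divide_less_eq mult.commute) linarith
  have "\<lceil>n * t\<rceil> \<le> n" using t n by (simp add: ceiling_le_iff mult_left_le)
  then have "N \<le> n" unfolding N_def by simp
  have "(\<Sum>k<n. of_bool (real (Suc k) / n < t)) = (\<Sum>k<n. if k < N then 1 else (0::real))"
    by (intro sum.cong) (simp_all add: lt del: of_nat_Suc)
  also have "\<dots> = real (card {k. k < n \<and> k < N})"
    by (simp add: sum.If_cases Int_def)
  also have "{k. k < n \<and> k < N} = {..<N}" using \<open>N \<le> n\<close> by auto
  finally have eq: "(\<Sum>k<n. of_bool (real (Suc k) / n < t)) = real N" by simp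
  have "real N \<le> n * t" "n * t - 1 \<le> real N"
    unfolding N_def using t ceiling_correct[of "n * t"] by (cases "\<lceil>real n * t\<rceil> \<ge> 1"; simp; fail | simp; linarith)+
  moreover have "(n * t) / n = t" "(n * t - 1) / n = t - 1 / n"
    using n by (simp_all add: diff_divide_distrib)
  ultimately show "(\<Sum>k<n. of_bool (real (Suc k) / n < t)) / n \<le> t"
    and "t - 1 / n \<le> (\<Sum>k<n. of_bool (real (Suc k) / n < t)) / n"
    unfolding eq
    using divide_right_mono[of "real N" "n * t" "real n"] divide_right_mono[of "n * t - 1" "real N" "real n"]
    by simp_all
qed

text \<open>By \<open>sum_indicator_levels\<close>, the integral of \<open>f\<close> is the supremum of averages of measures of the open level
sets of \<open>f\<close>.\<close>

lemma lsc_map_integral_unit: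
  assumes top: "topspace W = prob_measures T"
    and lsc: "\<And>U. openin T U \<Longrightarrow> lsc_map W (\<lambda>z. measure z U)"
    and f: "f \<in> bounded_continuous T" and f01: "\<And>x. x \<in> topspace T \<Longrightarrow> 0 \<le> f x \<and> f x \<le> 1"
  shows "lsc_map W (\<lambda>z. \<integral>x. f x \<partial>z)"
proof (rule lsc_map_sup[of _ "\<lambda>m z. 1 / real (Suc m) *
    (\<Sum>k<Suc m. measure z {x \<in> topspace T. real (Suc k) / real (Suc m) < f x})"])
  have op: "openin T {x \<in> topspace T. r < f x}" for r
    using f by (auto simp: bounded_continuous_def continuous_map_upper_lower_semicontinuous_lt)
  then show "lsc_map W (\<lambda>z. 1 / real (Suc m) *
    (\<Sum>k<Suc m. measure z {x \<in> topspace T. real (Suc k) / real (Suc m) < f x}))" for m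
    by (intro lsc_map_scale lsc_map_sum lsc) auto
  have eq: "1 / real (Suc m) *
      (\<Sum>k<Suc m. measure z {x \<in> topspace T. real (Suc k) / real (Suc m) < f x}) =
      (\<integral>x. (\<Sum>k<Suc m. of_bool (real (Suc k) / real (Suc m) < f x)) / real (Suc m) \<partial>z)"
    and int: "integrable z (\<lambda>x. (\<Sum>k<Suc m. of_bool (real (Suc k) / real (Suc m) < f x)) / real (Suc m))"
    if z: "z \<in> prob_measures T" for m z
  proof -
    interpret prob_space z using prob_measuresD[OF z] by simp
    have sp: "space z = topspace T" by (rule prob_measuresD(3)[OF z])
    have [measurable]: "f \<in> borel_measurable z" by (rule bounded_continuous_measurable[OF f z])
    have i: "integrable z (\<lambda>x. of_bool (r < f x) :: real)" for r
      by (rule integrable_const_bound[of _ 1]) auto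
    have "(\<integral>x. of_bool (r < f x) \<partial>z) = measure z {x \<in> topspace T. r < f x}" for r
    proof -
      have "(\<integral>x. of_bool (r < f x) \<partial>z) = (\<integral>x. indicator {x \<in> space z. r < f x} x \<partial>z)"
        by (intro Bochner_Integration.integral_cong) (auto simp: indicator_def)
      also have "\<dots> = measure z {x \<in> space z. r < f x}"
        by simp
      finally show ?thesis using sp by simp
    qed
    then show "1 / real (Suc m) *
      (\<Sum>k<Suc m. measure z {x \<in> topspace T. real (Suc k) / real (Suc m) < f x}) =
      (\<integral>x. (\<Sum>k<Suc m. of_bool (real (Suc k) / real (Suc m) < f x)) / real (Suc m) \<partial>z)"
      using i by (simp del: of_nat_Suc sum.lessThan_Suc sum_of_bool_eq)
    show "integrable z (\<lambda>x. (\<Sum>k<Suc m. of_bool (real (Suc k) / real (Suc m) < f x)) / real (Suc m))"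
      using i by (intro integrable_divide Bochner_Integration.integrable_sum) auto
  qed
  fix z assume "z \<in> topspace W"
  then have z: "z \<in> prob_measures T" using top by simp
  interpret prob_space z using prob_measuresD[OF z] by simp
  have sp: "space z = topspace T" by (rule prob_measuresD(3)[OF z])
  show "1 / real (Suc m) *
      (\<Sum>k<Suc m. measure z {x \<in> topspace T. real (Suc k) / real (Suc m) < f x}) \<le> (\<integral>x. f x \<partial>z)" for m
    unfolding eq[OF z]
    by (rule integral_mono[OF int[OF z] bounded_continuous_integrable[OF f z]])
       (use f01 sp in \<open>auto intro!: sum_indicator_levels(1) simp del: of_nat_Suc sum.lessThan_Suc sum_of_bool_eq\<close>)
  fix r assume r: "r < (\<integral>x. f x \<partial>z)"
  then obtain m where m: "1 / real (Suc m) < (\<integral>x. f x \<partial>z) - r"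
    using nat_approx_posE[of "(\<integral>x. f x \<partial>z) - r"] by auto
  have "(\<integral>x. f x \<partial>z) - 1 / real (Suc m) = (\<integral>x. f x - 1 / real (Suc m) \<partial>z)"
    using bounded_continuous_integrable[OF f z] by (simp add: prob_space del: of_nat_Suc)
  also have "\<dots> \<le> (\<integral>x. (\<Sum>k<Suc m. of_bool (real (Suc k) / real (Suc m) < f x)) / real (Suc m) \<partial>z)"
    using bounded_continuous_integrable[OF f z] f01 sp
    by (intro integral_mono[OF _ int[OF z]])
       (auto intro!: sum_indicator_levels(2) simp del: of_nat_Suc sum.lessThan_Suc sum_of_bool_eq)
  finally show "\<exists>m. r < 1 / real (Suc m) *
      (\<Sum>k<Suc m. measure z {x \<in> topspace T. real (Suc k) / real (Suc m) < f x})"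
    using m unfolding eq[OF z] by (intro exI[of _ m]) linarith
qed

lemma lsc_map_integral:
  assumes top: "topspace W = prob_measures T"
    and lsc: "\<And>U. openin T U \<Longrightarrow> lsc_map W (\<lambda>z. measure z U)"
    and f: "f \<in> bounded_continuous T"
  shows "lsc_map W (\<lambda>z. \<integral>x. f x \<partial>z)"
proof -
  obtain B0 where B0: "\<And>x. x \<in> topspace T \<Longrightarrow> \<bar>f x\<bar> \<le> B0"
    using f by (auto simp: bounded_continuous_def bounded_iff)
  define B where "B = max B0 1"
  have B: "\<bar>f x\<bar> \<le> B" if "x \<in> topspace T" for x using B0[OF that] by (simp add: B_def)
  have "B > 0" by (simp add: B_def)
  define g where "g x = (f x + B) / (2 * B)" for x
  have g01: "0 \<le> g x \<and> g x \<le> 1" if "x \<in> topspace T" for x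
    using B[OF that] \<open>B > 0\<close> by (auto simp: g_def field_simps abs_le_iff)
  have g: "g \<in> bounded_continuous T"
  proof -
    have "continuous_map T euclideanreal g"
      unfolding g_def using f \<open>B > 0\<close>
      by (auto simp: bounded_continuous_def intro!: continuous_intros)
    moreover have "bounded (g ` topspace T)"
      using g01 by (intro boundedI[of _ 1]) auto
    ultimately show ?thesis by (simp add: bounded_continuous_def)
  qed
  have lsc': "lsc_map W (\<lambda>z. 2 * B * (\<integral>x. g x \<partial>z) + (- B))"
    by (intro lsc_map_add lsc_map_scale lsc_map_const lsc_map_integral_unit[OF top lsc g g01])
       (use \<open>B > 0\<close> in auto)
  have "2 * B * (\<integral>x. g x \<partial>z) + (- B) = (\<integral>x. f x \<partial>z)" if "z \<in> topspace W" for z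
  proof -
    have z: "z \<in> prob_measures T" using that top by simp
    interpret prob_space z using prob_measuresD[OF z] by simp
    show ?thesis
      unfolding g_def using bounded_continuous_integrable[OF f z] \<open>B > 0\<close>
      by (simp add: prob_space)
  qed
  then have "{z \<in> topspace W. r < 2 * B * (\<integral>x. g x \<partial>z) + (- B)} =
      {z \<in> topspace W. r < (\<integral>x. f x \<partial>z)}" for r by auto
  then show ?thesis using lsc' unfolding lsc_map_def by simp
qed

text \<open>Finite unions of base sets and rational thresholds suffice to describe the weak topology; restricting to
them is what keeps the subbase countable.\<close>

definition weak_subbase :: "'x topology \<Rightarrow> 'x set set \<Rightarrow> 'x measure set set" where
  "weak_subbase T \<B> = {{z \<in> prob_measures T. real_of_rat q < measure z (\<Union>\<F>)} | q \<F>. finite \<F> \<and> \<F> \<subseteq> \<B>}"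

lemma countable_weak_subbase:
  assumes "countable \<B>"
  shows "countable (weak_subbase T \<B>)"
proof -
  have "weak_subbase T \<B> = (\<lambda>(q, \<F>). {z \<in> prob_measures T. real_of_rat q < measure z (\<Union>\<F>)}) `
      (UNIV \<times> {\<F>. finite \<F> \<and> \<F> \<subseteq> \<B>})"
    by (auto simp: weak_subbase_def image_def)
  also have "countable \<dots>"
    using countable_Collect_finite_subset[OF assms] by (intro countable_image countable_SIGMA) (auto simp: conj_commute)
  finally show ?thesis .
qed

lemma Union_weak_subbase: "\<Union>(weak_subbase T \<B>) = prob_measures T"
proof
  show "prob_measures T \<subseteq> \<Union>(weak_subbase T \<B>)"
  proof
    fix z assume "z \<in> prob_measures T"
    then have "z \<in> {z \<in> prob_measures T. real_of_rat (-1) < measure z (\<Union>{})}" by simp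
    moreover have "\<dots> \<in> weak_subbase T \<B>" unfolding weak_subbase_def by blast
    ultimately show "z \<in> \<Union>(weak_subbase T \<B>)" by blast
  qed
qed (auto simp: weak_subbase_def)

text \<open>This is the portmanteau theorem in topological form. The subbasic sets are weakly open by
\<open>lsc_map_weak_topology_open\<close>. Conversely, continuity from below makes \<open>z \<mapsto> z(U)\<close> lower
semicontinuous in the generated topology for every open \<open>U\<close>, hence by \<open>lsc_map_integral\<close> also the
integrals of \<open>f\<close> and of \<open>-f\<close>, and so the integral of \<open>f\<close> is continuous.\<close>

lemma weak_topology_eq_generated:
  fixes X :: "'x::metric_space set"
  defines "T \<equiv> top_of_set X"
  assumes base: "countable_base T \<B>"
  shows "weak_topology T = topology_generated_by (weak_subbase T \<B>)" (is "_ = ?W")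
proof (rule topology_eq[THEN iffD2], intro allI iffI)
  have open_base: "openin T V" if "V \<in> \<B>" for V using base that by (simp add: countable_base_def)
  have topW: "topspace ?W = prob_measures T" by (simp add: Union_weak_subbase)
  show "openin (weak_topology T) D" if "openin ?W D" for D
    using that
  proof (rule openin_topology_generated_by_minimal)
    fix V assume "V \<in> weak_subbase T \<B>"
    then obtain q \<F> where V: "V = {z \<in> prob_measures T. real_of_rat q < measure z (\<Union>\<F>)}"
      and \<F>: "\<F> \<subseteq> \<B>" by (auto simp: weak_subbase_def)
    have "openin T (\<Union>\<F>)" using \<F> open_base by auto
    then show "openin (weak_topology T) V"
      using lsc_map_weak_topology_open[of X] unfolding V lsc_map_def T_def by simp
  qed
  have lscU: "lsc_map ?W (\<lambda>z. measure z U)" if U: "openin T U" for U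
    unfolding lsc_map_def
  proof
    fix r
    obtain \<V> where \<V>: "countable \<V>" "\<V> \<subseteq> \<B>" "U = \<Union>\<V>"
      using openin_countable_Union_base[OF base U] by blast
    have Un: "{z \<in> topspace ?W. r < measure z U} =
        (\<Union>(q, \<F>) \<in> {(q, \<F>). r \<le> real_of_rat q \<and> finite \<F> \<and> \<F> \<subseteq> \<V>}.
          {z \<in> prob_measures T. real_of_rat q < measure z (\<Union>\<F>)})" (is "?L = ?R")
    proof (intro equalityI subsetI)
      fix z assume "z \<in> ?L"
      then have z: "z \<in> prob_measures T" and r: "r < measure z U" using topW by auto
      interpret prob_space z using prob_measuresD[OF z] by simp
      obtain q where q: "r < real_of_rat q" "real_of_rat q < measure z U" using of_rat_dense[OF r] by blast
      have meas: "\<Union>\<F> \<in> sets z" if "\<F> \<subseteq> \<V>" for \<F>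
        using that \<V> open_base prob_measuresD(2)[OF z] by (auto intro!: borel_of_open openin_Union)
      have "\<exists>\<F>. finite \<F> \<and> \<F> \<subseteq> \<V> \<and> real_of_rat q < measure z (\<Union>\<F>)"
      proof (cases "\<V> = {}")
        case True
        then show ?thesis using q \<V> by (intro exI[of _ "{}"]) auto
      next
        case False
        define e where "e = from_nat_into \<V>"
        have e: "range e = \<V>" unfolding e_def using False \<V>(1) by (rule range_from_nat_into)
        have "(\<lambda>n. measure z (\<Union>(e ` {..n}))) \<longlonglongrightarrow> measure z (\<Union>n. \<Union>(e ` {..n}))"
        proof (rule finite_Lim_measure_incseq)
          have "\<Union>(e ` {..n}) \<in> sets z" for n by (rule meas) (use e in blast)
          then show "range (\<lambda>n. \<Union>(e ` {..n})) \<subseteq> sets z" by blast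
          show "incseq (\<lambda>n. \<Union>(e ` {..n}))" by (force simp: incseq_def)
        qed
        also have "(\<Union>n. \<Union>(e ` {..n})) = \<Union>(range e)" by blast
        also have "\<dots> = U" using \<V>(3) e by simp
        finally have "\<forall>\<^sub>F n in sequentially. real_of_rat q < measure z (\<Union>(e ` {..n}))"
          using q by (intro order_tendstoD) auto
        then obtain n where "real_of_rat q < measure z (\<Union>(e ` {..n}))"
          by (auto simp: eventually_sequentially)
        then show ?thesis using e by (intro exI[of _ "e ` {..n}"]) auto
      qed
      then obtain \<F> where \<F>: "finite \<F>" "\<F> \<subseteq> \<V>" "real_of_rat q < measure z (\<Union>\<F>)" by blast
      show "z \<in> ?R" by (rule UN_I[of "(q, \<F>)"]) (use \<F> z q in auto)
    next
      fix z assume "z \<in> ?R"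
      then obtain q \<F> where *: "r \<le> real_of_rat q" "\<F> \<subseteq> \<V>" "z \<in> prob_measures T"
        "real_of_rat q < measure z (\<Union>\<F>)" by auto
      interpret prob_space z using prob_measuresD[OF *(3)] by simp
      have "measure z (\<Union>\<F>) \<le> measure z U"
        using * \<V> U prob_measuresD(2)[OF *(3)]
        by (intro finite_measure_mono) (auto simp: borel_of_open)
      then show "z \<in> ?L" using * topW by auto
    qed
    have "openin ?W {z \<in> prob_measures T. real_of_rat q < measure z (\<Union>\<F>)}"
      if "finite \<F>" "\<F> \<subseteq> \<V>" for q \<F>
      by (rule topology_generated_by_Basis) (use that \<V> in \<open>auto simp: weak_subbase_def\<close>)
    then show "openin ?W {z \<in> topspace ?W. r < measure z U}" unfolding Un by (intro openin_Union) auto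
  qed
  show "openin ?W D" if "openin (weak_topology T) D" for D
    using that unfolding weak_topology_def
  proof (rule openin_topology_generated_by_minimal)
    fix V assume "V \<in> {{\<mu> \<in> prob_measures T. integral\<^sup>L \<mu> f \<in> U} |f U. f \<in> bounded_continuous T \<and> open U}"
    then obtain f U where V: "V = {\<mu> \<in> prob_measures T. (\<integral>x. f x \<partial>\<mu>) \<in> U}"
      and f: "f \<in> bounded_continuous T" and U: "open U" by auto
    have mf: "(\<lambda>x. - f x) \<in> bounded_continuous T"
      using f by (auto simp: bounded_continuous_def intro!: continuous_intros boundedI simp: bounded_iff)
    have "continuous_map ?W euclideanreal (\<lambda>z. \<integral>x. f x \<partial>z)"
      unfolding continuous_map_upper_lower_semicontinuous_lt
    proof safe
      show "openin ?W {z \<in> topspace ?W. a < (\<integral>x. f x \<partial>z)}" for a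
        using lsc_map_integral[OF topW lscU f] unfolding lsc_map_def by blast
      show "openin ?W {z \<in> topspace ?W. (\<integral>x. f x \<partial>z) < a}" for a
        using lsc_map_integral[OF topW lscU mf, unfolded lsc_map_def, rule_format, of "- a"] by simp
    qed
    then show "openin ?W V"
      using U unfolding V continuous_map_def topW by auto
  qed
qed

lemma second_countable_weak_topology:
  fixes X :: "'x::{metric_space, second_countable_topology} set"
  shows "second_countable (weak_topology (top_of_set X))"
proof -
  obtain \<B> where \<B>: "countable_base (top_of_set X) \<B>"
    using second_countable_top_of_set[of X] unfolding second_countable_iff_countable_base by blast
  then have "countable (weak_subbase (top_of_set X) \<B>)"
    by (simp add: countable_base_def countable_weak_subbase)
  then show ?thesis
    unfolding weak_topology_eq_generated[OF \<B>] second_countable_iff_countable_base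
    using countable_base_topology_generated_by by blast
qed

text \<open>A kernel, that is, a map whose evaluations at Borel sets are measurable, is measurable for the Borel sets
of the weak topology: the countable subbase consists of conditions on evaluations.\<close>

lemma measurable_borel_of_weak_topology:
  fixes X :: "'x::{metric_space, second_countable_topology} set"
  assumes f: "f \<in> M \<rightarrow>\<^sub>M prob_algebra (borel_of (top_of_set X))"
  shows "f \<in> M \<rightarrow>\<^sub>M borel_of (weak_topology (top_of_set X))"
proof -
  let ?T = "top_of_set X"
  obtain \<B> where \<B>: "countable_base ?T \<B>"
    using second_countable_top_of_set[of X] unfolding second_countable_iff_countable_base by blast
  show ?thesis
    unfolding weak_topology_eq_generated[OF \<B>]
  proof (rule measurable_borel_of_topology_generated_by)
    show "countable (weak_subbase ?T \<B>)" using \<B> by (simp add: countable_base_def countable_weak_subbase)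
    have sp: "f w \<in> prob_measures ?T" if "w \<in> space M" for w
      using measurable_space[OF f that] by (simp add: space_prob_algebra prob_measures_def)
    then show "f \<in> space M \<rightarrow> \<Union> (weak_subbase ?T \<B>)" by (auto simp: Union_weak_subbase)
    fix V assume "V \<in> weak_subbase ?T \<B>"
    then obtain q \<F> where V: "V = {z \<in> prob_measures ?T. real_of_rat q < measure z (\<Union>\<F>)}"
      and \<F>: "\<F> \<subseteq> \<B>" by (auto simp: weak_subbase_def)
    have "\<Union>\<F> \<in> sets (borel_of ?T)"
      using \<F> \<B> by (intro borel_of_open openin_Union) (auto simp: countable_base_def)
    then have "(\<lambda>\<mu>. measure \<mu> (\<Union>\<F>)) \<in> borel_measurable (subprob_algebra (borel_of ?T))"
      by (rule measurable_measure_subprob_algebra)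
    from measurable_compose[OF measurable_prob_algebraD[OF f] this]
    have "{w \<in> space M. real_of_rat q < measure (f w) (\<Union>\<F>)} \<in> sets M"
      by simp
    moreover have "f -` V \<inter> space M = {w \<in> space M. real_of_rat q < measure (f w) (\<Union>\<F>)}"
      using sp by (auto simp: V)
    ultimately show "f -` V \<inter> space M \<in> sets M" by simp
  qed
qed

section \<open>A Borel code of a Polish space by real numbers\<close>

text \<open>Only the digits 0 and 1 are used in base 4, so the tail after digit \<open>n\<close> contributes less than one unit
of that digit, and the digit is the parity of an integer part. In base 2 the tail could be a full unit.\<close>

lemma base4_digit:
  fixes b :: "nat \<Rightarrow> bool"
  defines "t \<equiv> \<Sum>n. of_bool (b n) / 4 ^ Suc n :: real"
  shows "odd \<lfloor>4 ^ Suc n * t\<rfloor> \<longleftrightarrow> b n"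
    and "0 \<le> t" and "t < 1"
proof -
  define a where "a k = (of_bool (b k) / 4 ^ Suc k :: real)" for k
  have geo: "summable (\<lambda>k. (1 / 4) ^ Suc k :: real)" by (subst summable_Suc_iff) (simp add: summable_geometric)
  have le: "0 \<le> a k" "a k \<le> (1 / 4) ^ Suc k" for k by (auto simp: a_def power_one_over of_bool_def)
  have sa: "summable a" by (rule summable_comparison_test'[OF geo, of 0]) (use le in auto)
  have tail: "0 \<le> (\<Sum>k. a (k + m))" "4 ^ m * (\<Sum>k. a (k + m)) < 1" for m
  proof -
    have sm: "summable (\<lambda>k. a (k + m))" using sa by (simp add: summable_iff_shift)
    show "0 \<le> (\<Sum>k. a (k + m))" by (rule suminf_nonneg[OF sm]) (rule le)
    have geo_sums: "(\<lambda>k. (1/4) ^ Suc m * (1/4) ^ k) sums ((1/4) ^ Suc m * (1 / (1 - 1/4)) :: real)"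
      by (intro sums_mult geometric_sums) simp
    have "(\<Sum>k. a (k + m)) \<le> (\<Sum>k. (1/4) ^ Suc m * (1/4) ^ k)"
      by (rule suminf_le[OF _ sm sums_summable[OF geo_sums]])
         (use le(2)[of "k + m" for k] in \<open>simp add: power_add[symmetric] add.commute\<close>)
    also have "\<dots> = (1/4) ^ Suc m * (4 / 3)" using sums_unique[OF geo_sums] by simp
    finally have "4 ^ m * (\<Sum>k. a (k + m)) \<le> 4 ^ m * ((1/4) ^ Suc m * (4 / 3))"
      by (intro mult_left_mono) auto
    also have "\<dots> < 1" by (simp add: power_one_over)
    finally show "4 ^ m * (\<Sum>k. a (k + m)) < 1" .
  qed
  have t: "t = (\<Sum>k. a k)" by (simp add: t_def a_def)
  show "0 \<le> t" "t < 1" using tail[of 0] by (auto simp: t)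
  define I :: int where "I = (\<Sum>k<n. of_bool (b k) * 4 ^ (n - k))"
  have "4 ^ Suc n * t = 4 ^ Suc n * (\<Sum>k<Suc n. a k) + 4 ^ Suc n * (\<Sum>k. a (k + Suc n))"
    unfolding t suminf_split_initial_segment[OF sa, of "Suc n"] by (simp only: distrib_left add.commute)
  also have "4 ^ Suc n * (\<Sum>k<Suc n. a k) = (\<Sum>k<Suc n. of_bool (b k) * 4 ^ (n - k))"
    unfolding sum_distrib_left
  proof (intro sum.cong refl)
    fix k assume "k \<in> {..<Suc n}"
    then have "Suc n = (n - k) + Suc k" by simp
    then have "(4::real) ^ Suc n = 4 ^ (n - k) * 4 ^ Suc k" by (metis power_add)
    then show "4 ^ Suc n * a k = of_bool (b k) * 4 ^ (n - k)" by (simp add: a_def)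
  qed
  also have "\<dots> = real_of_int (I + of_bool (b n))" by (simp add: I_def)
  finally have "4 ^ Suc n * t = real_of_int (I + of_bool (b n)) + 4 ^ Suc n * (\<Sum>k. a (k + Suc n))" .
  then have "\<lfloor>4 ^ Suc n * t\<rfloor> = I + of_bool (b n)"
    using tail[of "Suc n"] by (intro floor_unique) auto
  moreover have "even I" unfolding I_def by (intro dvd_sum) (auto simp: dvd_power)
  ultimately show "odd \<lfloor>4 ^ Suc n * t\<rfloor> \<longleftrightarrow> b n" by (simp add: of_bool_def)
qed

text \<open>A point is coded by the bits that tell in which balls of radius \<open>2\<^sup>-\<^sup>n\<close> around a dense sequence it lies.
To decode, take for each \<open>n\<close> the first centre whose bit is set, and pass to the limit. The decoder is a
Borel function on the whole line, so nothing has to be known about the range of the code.\<close>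

lemma polish_real_code:
  obtains c :: "'x::polish_space \<Rightarrow> real" and d :: "real \<Rightarrow> 'x"
  where "c \<in> borel_measurable borel" "d \<in> borel_measurable borel"
    "\<And>x. 0 \<le> c x" "\<And>x. c x < 1" "\<And>x. d (c x) = x"
proof -
  obtain D :: "'x set" where D: "countable D" "\<And>V. open V \<Longrightarrow> V \<noteq> {} \<Longrightarrow> \<exists>x\<in>D. x \<in> V"
    using countable_dense_setE by blast
  have "D \<noteq> {}" using D(2)[of UNIV] by auto
  define e where "e = from_nat_into D"
  have dense: "\<exists>k. dist x (e k) < r" if "r > 0" for x r
  proof -
    have "ball x r \<noteq> {}" using that by simp
    then obtain y where "y \<in> D" "y \<in> ball x r" using D(2)[OF open_ball] by blast
    then show ?thesis using from_nat_into_surj[OF D(1), of y] by (auto simp: e_def)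
  qed
  define ball_bit where "ball_bit x j =
    (case prod_decode j of (n, k) \<Rightarrow> dist x (e k) < (1/2) ^ n)" for x j
  define c where "c x = (\<Sum>j. of_bool (ball_bit x j) / 4 ^ Suc j :: real)" for x
  define near where "near t n = e (LEAST k. odd \<lfloor>4 ^ Suc (prod_encode (n, k)) * t\<rfloor>)" for t :: real and n
  \<comment> \<open>Arbitrary reals need not be codes; the guard makes the limit exist everywhere.\<close>
  define d where "d t = (if Cauchy (near t) then lim (near t) else e 0)" for t
  have bit: "odd \<lfloor>4 ^ Suc j * c x\<rfloor> \<longleftrightarrow> ball_bit x j" for x j
    unfolding c_def by (rule base4_digit)
  have near_c: "dist x (near (c x) n) < (1/2) ^ n" for x n
  proof -
    let ?P = "\<lambda>k. dist x (e k) < (1/2) ^ n"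
    have "near (c x) n = e (LEAST k. ?P k)" by (simp add: near_def bit ball_bit_def del: power_Suc)
    moreover have "?P (LEAST k. ?P k)" by (rule LeastI_ex) (rule dense, simp)
    ultimately show ?thesis by simp
  qed
  have lim: "near (c x) \<longlonglongrightarrow> x" for x
  proof (rule metric_tendsto_imp_tendsto)
    show "(\<lambda>n. (1/2) ^ n :: real) \<longlonglongrightarrow> 0" by (rule LIMSEQ_power_zero) simp
    show "\<forall>\<^sub>F n in sequentially. dist (near (c x) n) x \<le> dist ((1/2) ^ n :: real) 0"
      using near_c[of x] by (auto simp: dist_commute less_imp_le)
  qed
  have near_meas[measurable]: "(\<lambda>t. near t n) \<in> borel_measurable borel" for n
    unfolding near_def
    by (rule measurable_compose[OF measurable_Least, of _ _ e]) auto
  have Cauchy_iff: "Cauchy (near t) \<longleftrightarrow>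
      (\<forall>p. \<exists>M. \<forall>m\<ge>M. \<forall>n\<ge>M. dist (near t m) (near t n) < 1 / real (Suc p))" for t
    by (subst metric_Cauchy_iff2) (simp add: inverse_eq_divide)
  have C[measurable]: "Measurable.pred borel (\<lambda>t. Cauchy (near t))"
    unfolding Cauchy_iff by measurable
  show ?thesis
  proof (rule that[of c d])
    have [measurable]: "Measurable.pred borel (\<lambda>x. ball_bit x j)" for j
      unfolding ball_bit_def by (cases "prod_decode j") (simp, measurable)
    show "c \<in> borel_measurable borel"
      unfolding c_def by measurable
    show "d \<in> borel_measurable borel"
    proof (rule borel_measurable_LIMSEQ_metric[of "\<lambda>n t. if Cauchy (near t) then near t n else e 0"])
      show "(\<lambda>n. if Cauchy (near t) then near t n else e 0) \<longlonglongrightarrow> d t" for t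
        by (auto simp: d_def Cauchy_convergent_iff convergent_LIMSEQ_iff)
    qed measurable
    show "0 \<le> c x" "c x < 1" for x unfolding c_def by (rule base4_digit(2,3))+
    show "d (c x) = x" for x
      using lim[of x] by (auto simp: d_def limI LIMSEQ_imp_Cauchy)
  qed
qed

section \<open>A common conditional distribution for a family of measures\<close>

lemma AE_le_if_set_nn_integral_le:
  assumes "h \<in> borel_measurable M" "h' \<in> borel_measurable M"
    and le: "\<And>C. C \<in> sets M \<Longrightarrow> (\<integral>\<^sup>+w\<in>C. h w \<partial>M) \<le> (\<integral>\<^sup>+w\<in>C. h' w \<partial>M)"
    and fin: "(\<integral>\<^sup>+w. h' w \<partial>M) < \<infinity>"
  shows "AE w in M. h w \<le> h' w"
proof -
  note [measurable] = assms(1,2)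
  define C where "C = {w \<in> space M. h' w < h w}"
  have [measurable]: "C \<in> sets M" unfolding C_def by measurable
  have fin': "(\<integral>\<^sup>+w\<in>C. h' w \<partial>M) \<noteq> \<infinity>"
    by (rule less_imp_neq[OF le_less_trans[OF nn_integral_mono fin]]) (auto simp: indicator_def)
  have "(\<integral>\<^sup>+w. h w * indicator C w - h' w * indicator C w \<partial>M) =
      (\<integral>\<^sup>+w\<in>C. h w \<partial>M) - (\<integral>\<^sup>+w\<in>C. h' w \<partial>M)"
    using fin' by (intro nn_integral_diff AE_I2) (auto simp: C_def indicator_def)
  also have "\<dots> = 0"
    using le[of C] fin' by (intro diff_eq_0_ennreal) (auto simp: less_top intro: le_less_trans)
  finally have "AE w in M. h w * indicator C w - h' w * indicator C w = 0"
    by (subst (asm) nn_integral_0_iff_AE) auto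
  then show ?thesis
    by (rule AE_mp) (auto intro!: AE_I2 simp: C_def indicator_def split: if_splits dest: ennreal_minus_eq_0)
qed

text \<open>A family of probability measures on \<open>N \<times> M\<close>. In the application \<open>M\<close> consists of the pairs \<open>(s, y)\<close>, and
the member with index \<open>s\<close> is the law of \<open>(x, (s, y))\<close> for \<open>(x, y)\<close> distributed by \<open>R(\<cdot> | s)\<close>. A conditional
probability that serves all members simultaneously is thus the same as one that depends measurably on the
parameter \<open>s\<close>.\<close>

locale measure_family =
  fixes N :: "'x measure" and M :: "'w measure" and \<Lambda> :: "('x \<times> 'w) measure set"
  assumes prob: "\<rho> \<in> \<Lambda> \<Longrightarrow> prob_space \<rho>"
    and sets_eq: "\<rho> \<in> \<Lambda> \<Longrightarrow> sets \<rho> = sets (N \<Otimes>\<^sub>M M)"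
begin

text \<open>The function \<open>h\<close> is a version of the conditional probability of \<open>B\<close> given the second component, one and
the same for all members of the family.\<close>

definition cond_version :: "'x set \<Rightarrow> ('w \<Rightarrow> ennreal) \<Rightarrow> bool" where
  "cond_version B h \<longleftrightarrow> h \<in> borel_measurable M \<and>
     (\<forall>\<rho>\<in>\<Lambda>. \<forall>C\<in>sets M. emeasure \<rho> (B \<times> C) = (\<integral>\<^sup>+w\<in>C. h w \<partial>distr \<rho> M snd))"

lemma cond_versionD:
  assumes "cond_version B h"
  shows "h \<in> borel_measurable M"
    and "\<rho> \<in> \<Lambda> \<Longrightarrow> C \<in> sets M \<Longrightarrow> emeasure \<rho> (B \<times> C) = (\<integral>\<^sup>+w\<in>C. h w \<partial>distr \<rho> M snd)"
  using assms by (auto simp: cond_version_def)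

lemma snd_measurable: "\<rho> \<in> \<Lambda> \<Longrightarrow> snd \<in> \<rho> \<rightarrow>\<^sub>M M"
  using measurable_cong_sets[OF sets_eq refl] measurable_snd by blast

lemma prob_marginal: "\<rho> \<in> \<Lambda> \<Longrightarrow> prob_space (distr \<rho> M snd)"
  by (intro prob_space.prob_space_distr prob snd_measurable)

lemma cond_version_cong_AE:
  assumes h: "cond_version B h" and h': "h' \<in> borel_measurable M"
    and ae: "\<And>\<rho>. \<rho> \<in> \<Lambda> \<Longrightarrow> AE w in distr \<rho> M snd. h w = h' w"
  shows "cond_version B h'"
  unfolding cond_version_def
proof (intro conjI ballI h')
  fix \<rho> C assume *: "\<rho> \<in> \<Lambda>" "C \<in> sets M"
  have "(\<integral>\<^sup>+w\<in>C. h w \<partial>distr \<rho> M snd) = (\<integral>\<^sup>+w\<in>C. h' w \<partial>distr \<rho> M snd)"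
    using ae[OF *(1)] by (intro nn_integral_cong_AE) auto
  then show "emeasure \<rho> (B \<times> C) = (\<integral>\<^sup>+w\<in>C. h' w \<partial>distr \<rho> M snd)"
    using cond_versionD(2)[OF h *] by simp
qed

lemma cond_version_cong:
  assumes "cond_version B h" "\<And>w. w \<in> space M \<Longrightarrow> h w = h' w"
  shows "cond_version B h'"
proof (rule cond_version_cong_AE[OF assms(1)])
  show "h' \<in> borel_measurable M"
    using cond_versionD(1)[OF assms(1)] assms(2) by (subst measurable_cong[of _ _ h]) auto
qed (auto intro!: AE_I2 simp: assms(2))

lemma cond_version_empty: "cond_version {} (\<lambda>_. 0)"
  by (simp add: cond_version_def)

lemma cond_version_space: "cond_version (space N) (\<lambda>_. 1)"
  unfolding cond_version_def
proof (intro conjI ballI)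
  fix \<rho> C assume *: "\<rho> \<in> \<Lambda>" "C \<in> sets M"
  have "space \<rho> = space N \<times> space M"
    using sets_eq_imp_space_eq[OF sets_eq[OF *(1)]] by (simp add: space_pair_measure)
  then have "snd -` C \<inter> space \<rho> = space N \<times> C"
    using sets.sets_into_space[OF *(2)] by auto
  then show "emeasure \<rho> (space N \<times> C) = (\<integral>\<^sup>+w\<in>C. 1 \<partial>distr \<rho> M snd)"
    using * snd_measurable[OF *(1)] by (simp add: emeasure_distr)
qed simp

lemma cond_version_mono:
  assumes h: "cond_version B h" and h': "cond_version B' h'" and B: "B \<subseteq> B'" "B' \<in> sets N"
    and \<rho>: "\<rho> \<in> \<Lambda>"
  shows "AE w in distr \<rho> M snd. h w \<le> h' w"
proof (rule AE_le_if_set_nn_integral_le)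
  show "h \<in> borel_measurable (distr \<rho> M snd)" "h' \<in> borel_measurable (distr \<rho> M snd)"
    using cond_versionD(1)[OF h] cond_versionD(1)[OF h'] by auto
  show "(\<integral>\<^sup>+w\<in>C. h w \<partial>distr \<rho> M snd) \<le> (\<integral>\<^sup>+w\<in>C. h' w \<partial>distr \<rho> M snd)"
    if "C \<in> sets (distr \<rho> M snd)" for C
  proof -
    have C: "C \<in> sets M" using that by simp
    show ?thesis
      unfolding cond_versionD(2)[OF h \<rho> C, symmetric] cond_versionD(2)[OF h' \<rho> C, symmetric]
      using C B sets_eq[OF \<rho>] by (intro emeasure_mono) auto
  qed
  have "(\<integral>\<^sup>+w. h' w \<partial>distr \<rho> M snd) = (\<integral>\<^sup>+w\<in>space M. h' w \<partial>distr \<rho> M snd)"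
    by (intro nn_integral_cong) auto
  also have "\<dots> = emeasure \<rho> (B' \<times> space M)" using cond_versionD(2)[OF h' \<rho>] by simp
  also have "\<dots> < \<infinity>"
    using prob[OF \<rho>] by (simp add: prob_space_def finite_measure.emeasure_finite less_top[symmetric])
  finally show "(\<integral>\<^sup>+w. h' w \<partial>distr \<rho> M snd) < \<infinity>" .
qed

lemma cond_version_compl:
  assumes h: "cond_version B h" and B: "B \<in> sets N"
  shows "cond_version (space N - B) (\<lambda>w. 1 - h w)"
  unfolding cond_version_def
proof (intro conjI ballI)
  note [measurable] = cond_versionD(1)[OF h]
  show "(\<lambda>w. 1 - h w) \<in> borel_measurable M" by measurable
  fix \<rho> C assume \<rho>: "\<rho> \<in> \<Lambda>" and C[measurable]: "C \<in> sets M"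
  interpret prob_space \<rho> by (rule prob[OF \<rho>])
  have le: "AE w in distr \<rho> M snd. h w \<le> 1"
    by (rule cond_version_mono[OF h cond_version_space sets.sets_into_space[OF B] sets.top \<rho>])
  have "(space N - B) \<times> C = space N \<times> C - B \<times> C" by auto
  also have "emeasure \<rho> \<dots> = emeasure \<rho> (space N \<times> C) - emeasure \<rho> (B \<times> C)"
    using B C sets.sets_into_space[OF B] sets_eq[OF \<rho>]
    by (intro emeasure_Diff) (auto simp: emeasure_finite)
  also have "\<dots> = (\<integral>\<^sup>+w\<in>C. 1 \<partial>distr \<rho> M snd) - (\<integral>\<^sup>+w\<in>C. h w \<partial>distr \<rho> M snd)"
    using cond_versionD(2)[OF cond_version_space \<rho> C] cond_versionD(2)[OF h \<rho> C] by simp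
  also have "\<dots> = (\<integral>\<^sup>+w. 1 * indicator C w - h w * indicator C w \<partial>distr \<rho> M snd)"
  proof (rule nn_integral_diff[symmetric])
    show "(\<integral>\<^sup>+w\<in>C. h w \<partial>distr \<rho> M snd) \<noteq> \<infinity>"
      using cond_versionD(2)[OF h \<rho> C] emeasure_finite[of "B \<times> C"] by simp
    show "AE w in distr \<rho> M snd. h w * indicator C w \<le> 1 * indicator C w"
      using le by eventually_elim (auto simp: indicator_def)
  qed auto
  also have "\<dots> = (\<integral>\<^sup>+w\<in>C. (1 - h w) \<partial>distr \<rho> M snd)"
    by (intro nn_integral_cong) (auto simp: indicator_def)
  finally show "emeasure \<rho> ((space N - B) \<times> C) = \<dots>" .
qed

lemma cond_version_UN_disjoint:
  fixes B :: "nat \<Rightarrow> 'x set"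
  assumes h: "\<And>i. cond_version (B i) (h i)" and B: "\<And>i. B i \<in> sets N" "disjoint_family B"
  shows "cond_version (\<Union>i. B i) (\<lambda>w. \<Sum>i. h i w)"
  unfolding cond_version_def
proof (intro conjI ballI)
  note [measurable] = cond_versionD(1)[OF h]
  show "(\<lambda>w. \<Sum>i. h i w) \<in> borel_measurable M" by measurable
  fix \<rho> C assume \<rho>: "\<rho> \<in> \<Lambda>" and C[measurable]: "C \<in> sets M"
  have "(\<Union>i. B i) \<times> C = (\<Union>i. B i \<times> C)" by auto
  also have "emeasure \<rho> \<dots> = (\<Sum>i. emeasure \<rho> (B i \<times> C))"
    using B C sets_eq[OF \<rho>]
    by (intro suminf_emeasure[symmetric]) (auto simp: disjoint_family_on_def)
  also have "\<dots> = (\<Sum>i. \<integral>\<^sup>+w\<in>C. h i w \<partial>distr \<rho> M snd)"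
    using cond_versionD(2)[OF h \<rho> C] by simp
  also have "\<dots> = (\<integral>\<^sup>+w. (\<Sum>i. h i w * indicator C w) \<partial>distr \<rho> M snd)"
    by (rule nn_integral_suminf[symmetric]) auto
  also have "\<dots> = (\<integral>\<^sup>+w\<in>C. (\<Sum>i. h i w) \<partial>distr \<rho> M snd)"
    by (intro nn_integral_cong) (auto simp: indicator_def)
  finally show "emeasure \<rho> ((\<Union>i. B i) \<times> C) = \<dots>" .
qed

text \<open>The sets that have a version form a Dynkin system.\<close>

lemma cond_version_exists_sigma_sets:
  assumes G: "Int_stable G" "G \<subseteq> Pow (space N)" "sets N = sigma_sets (space N) G"
    and ex: "\<And>B. B \<in> G \<Longrightarrow> \<exists>h. cond_version B h"
    and B: "B \<in> sets N"
  shows "\<exists>h. cond_version B h"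
  using G(1,2) B[unfolded G(3)]
proof (induction rule: sigma_sets_induct_disjoint)
  case (union B)
  then obtain h where h: "\<And>i. cond_version (B i) (h i)" by metis
  have "cond_version (\<Union>i. B i) (\<lambda>w. \<Sum>i. h i w)"
    using union(1,2) h by (intro cond_version_UN_disjoint) (auto simp: G(3))
  then show ?case by blast
next
  case (compl B)
  then show ?case using cond_version_compl[of B] G(3) by blast
qed (use ex cond_version_empty in auto)

lemma cond_version_kernel_sigma_sets:
  assumes G: "Int_stable G" "G \<subseteq> Pow (space L)" "sets L = sigma_sets (space L) G"
    and \<kappa>: "\<kappa> \<in> M \<rightarrow>\<^sub>M prob_algebra L" and f: "f \<in> N \<rightarrow>\<^sub>M L"
    and cond: "\<And>D. D \<in> G \<Longrightarrow> cond_version (f -` D \<inter> space N) (\<lambda>w. emeasure (\<kappa> w) D)"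
    and D: "D \<in> sets L"
  shows "cond_version (f -` D \<inter> space N) (\<lambda>w. emeasure (\<kappa> w) D)"
proof -
  have \<kappa>w: "prob_space (\<kappa> w)" "sets (\<kappa> w) = sets L" if "w \<in> space M" for w
    using measurable_space[OF \<kappa> that] by (auto simp: space_prob_algebra)
  show ?thesis
    using G(1,2) D[unfolded G(3)]
  proof (induction rule: sigma_sets_induct_disjoint)
    case (basic D)
    then show ?case by (rule cond)
  next
    case empty
    then show ?case by (simp add: cond_version_empty)
  next
    case (compl D)
    then have D: "D \<in> sets L" by (simp add: G(3))
    have "f -` (space L - D) \<inter> space N = space N - (f -` D \<inter> space N)"
      using measurable_space[OF f] by auto
    moreover have "emeasure (\<kappa> w) (space L - D) = 1 - emeasure (\<kappa> w) D" if w: "w \<in> space M" for w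
    proof -
      interpret prob_space "\<kappa> w" by (rule \<kappa>w(1)[OF w])
      show ?thesis
        using emeasure_compl[of D "\<kappa> w"] D \<kappa>w(2)[OF w] sets_eq_imp_space_eq[OF \<kappa>w(2)[OF w]]
        by (simp flip: emeasure_space_1)
    qed
    ultimately show ?case
      using cond_version_compl[OF compl.IH measurable_sets[OF f D]] by (auto intro: cond_version_cong)
  next
    case (union D)
    then have D: "D i \<in> sets L" for i by (auto simp: G(3))
    have "f -` (\<Union>i. D i) \<inter> space N = (\<Union>i. f -` D i \<inter> space N)" by auto
    moreover have "emeasure (\<kappa> w) (\<Union>i. D i) = (\<Sum>i. emeasure (\<kappa> w) (D i))" if w: "w \<in> space M" for w
      using D \<kappa>w(2)[OF w] union(1) by (intro suminf_emeasure[symmetric]) auto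
    moreover have "cond_version (\<Union>i. f -` D i \<inter> space N) (\<lambda>w. \<Sum>i. emeasure (\<kappa> w) (D i))"
      using union(1,3) measurable_sets[OF f D]
      by (intro cond_version_UN_disjoint) (auto simp: disjoint_family_on_def)
    ultimately show ?case by (auto intro: cond_version_cong)
  qed
qed

end

text \<open>Code \<open>X\<close> into \<open>[0, 1)\<close> by \<open>c\<close>, and let \<open>F t\<close> be a version of the conditional probability of \<open>c < t\<close>.
For fixed \<open>w\<close> the function \<open>t \<mapsto> F t w\<close> need not be a distribution function, but its quantile
function \<open>G w\<close>, formed over rational \<open>t\<close>, always is a Borel function. The image of the uniform
distribution under \<open>G w\<close> is therefore a probability measure for every \<open>w\<close>, with no exceptional set to
remove, and it is measurable in \<open>w\<close>. Its mass below \<open>t\<close> is the supremum of \<open>F q w\<close> over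
rational \<open>q < t\<close>, which almost everywhere equals \<open>F t w\<close>. Decoding transports the measure back to \<open>X\<close>.\<close>

lemma disintegration_kernel:
  fixes X :: "'x::polish_space set" and \<Lambda> :: "('x \<times> 'w) measure set"
  assumes X: "X \<in> sets borel" "X \<noteq> {}"
    and family: "measure_family (borel_of (top_of_set X)) M \<Lambda>"
    and ex: "\<And>B. B \<in> sets (borel_of (top_of_set X)) \<Longrightarrow>
      \<exists>h. measure_family.cond_version M \<Lambda> B h"
  obtains K where "K \<in> M \<rightarrow>\<^sub>M prob_algebra (borel_of (top_of_set X))"
    "\<And>B. B \<in> sets (borel_of (top_of_set X)) \<Longrightarrow>
      measure_family.cond_version M \<Lambda> B (\<lambda>w. emeasure (K w) B)"
proof -
  let ?N = "borel_of (top_of_set X)"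
  interpret measure_family ?N M \<Lambda> by (rule family)
  obtain c :: "'x \<Rightarrow> real" and d :: "real \<Rightarrow> 'x" where c: "c \<in> borel_measurable borel"
    and d: "d \<in> borel_measurable borel" and c01: "\<And>x. 0 \<le> c x" "\<And>x. c x < 1" and dc: "\<And>x. d (c x) = x"
    using polish_real_code by blast
  have cN: "c \<in> ?N \<rightarrow>\<^sub>M borel"
    using measurable_restrict_space1[OF c, of X]
    by (simp add: measurable_cong_sets[OF sets_borel_of_top_of_set refl])
  obtain x0 where x0: "x0 \<in> X" using X(2) by blast
  define d' where "d' t = (if d t \<in> X then d t else x0)" for t
  have d': "d' \<in> borel \<rightarrow>\<^sub>M ?N"
  proof -
    have "d' \<in> borel_measurable borel" unfolding d'_def using d X(1) by measurable
    then have "d' \<in> borel \<rightarrow>\<^sub>M restrict_space borel X"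
      using x0 by (intro measurable_restrict_space2) (auto simp: d'_def)
    then show ?thesis by (simp add: measurable_cong_sets[OF refl sets_borel_of_top_of_set])
  qed
  define Below where "Below t = {x \<in> X. c x < t}" for t
  have Below_eq: "Below t = c -` {..<t} \<inter> space ?N" for t by (auto simp: Below_def)
  have Below: "Below t \<in> sets ?N" for t unfolding Below_eq by (rule measurable_sets[OF cN]) simp
  have "\<exists>h. cond_version (Below t) h \<and> (\<forall>w. h w \<le> 1) \<and> (t \<le> 0 \<longrightarrow> (\<forall>w. h w = 0)) \<and> (1 \<le> t \<longrightarrow> (\<forall>w. h w = 1))" for t
  proof -
    consider "t \<le> 0" | "1 \<le> t" | "0 < t" "t < 1" by linarith
    then show ?thesis
    proof cases
      case 1
      have "Below t = {}" unfolding Below_def using c01(1) 1 by (auto simp: not_less intro: order_trans)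
      then show ?thesis using 1 cond_version_empty by (intro exI[of _ "\<lambda>_. 0"]) auto
    next
      case 2
      have "Below t = space ?N" unfolding Below_def using c01(2) 2 by (auto intro: less_le_trans)
      then show ?thesis using 2 cond_version_space by (intro exI[of _ "\<lambda>_. 1"]) auto
    next
      case 3
      obtain h where h: "cond_version (Below t) h" using ex[OF Below] by blast
      note [measurable] = cond_versionD(1)[OF h]
      have "cond_version (Below t) (\<lambda>w. min 1 (h w))"
      proof (rule cond_version_cong_AE[OF h])
        show "AE w in distr \<rho> M snd. h w = min 1 (h w)" if "\<rho> \<in> \<Lambda>" for \<rho>
          using cond_version_mono[OF h cond_version_space sets.sets_into_space[OF Below] sets.top that]
          by eventually_elim (simp add: min_def)
      qed measurable
      then show ?thesis using 3 by (intro exI[of _ "\<lambda>w. min 1 (h w)"]) auto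
    qed
  qed
  then obtain F where F: "\<And>t. cond_version (Below t) (F t)" and F1: "\<And>t w. F t w \<le> 1"
    and F_0: "\<And>t w. t \<le> 0 \<Longrightarrow> F t w = 0" and F_1: "\<And>t w. 1 \<le> t \<Longrightarrow> F t w = 1"
    by metis
  note [measurable] = cond_versionD(1)[OF F]
  \<comment> \<open>Rationals outside the infimum get the value 1, which changes nothing for \<open>u < 1\<close> since \<open>F 1 w = 1\<close>.\<close>
  define V where "V w u q = (if ennreal u < F (real_of_rat q) w then real_of_rat q else 1)" for w u q
  define G where "G w u = (INF q. V w u q)" for w u
  have V0: "0 \<le> V w u q" for w u q
    using F_0[of "real_of_rat q" w] by (cases "0 \<le> q") (auto simp: V_def)
  have bdd: "bdd_below (range (V w u))" for w u using V0 by (intro bdd_belowI[of _ 0]) auto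
  have G_meas[measurable]: "case_prod G \<in> borel_measurable (M \<Otimes>\<^sub>M borel)"
    unfolding G_def case_prod_beta
    by (rule borel_measurable_cINF) (use bdd in \<open>auto simp: V_def\<close>)
  have G_less: "G w u < t \<longleftrightarrow> (\<exists>q. real_of_rat q < t \<and> ennreal u < F (real_of_rat q) w)" if "t \<le> 1" for w u t
    unfolding G_def cINF_less_iff[OF UNIV_not_empty bdd] using that by (auto simp: V_def split: if_splits)
  have G_le: "G w u \<le> 1" for w u
    unfolding G_def by (rule cINF_lower2[OF bdd, of 1]) (auto simp: V_def)
  define U where "U = uniform_measure lborel {0..<1::real}"
  have sU: "sets U = sets borel" "space U = UNIV" by (simp_all add: U_def)
  interpret U: prob_space U unfolding U_def by (rule prob_space_uniform_measure) auto
  have emU: "emeasure U D = emeasure lborel ({0..<1} \<inter> D)" if "D \<in> sets borel" for D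
    using that by (simp add: U_def divide_ennreal_def)
  define \<kappa> where "\<kappa> w = distr U borel (G w)" for w
  have Gw[measurable]: "G w \<in> borel_measurable borel" if "w \<in> space M" for w
    using measurable_Pair2[OF G_meas that] by simp
  have Gw': "G w \<in> U \<rightarrow>\<^sub>M borel" if "w \<in> space M" for w
    using Gw[OF that] by (simp add: measurable_cong_sets[OF sU(1) refl])
  have \<kappa>: "\<kappa> \<in> M \<rightarrow>\<^sub>M prob_algebra borel"
  proof (rule measurable_prob_algebraI)
    show "prob_space (\<kappa> w)" if "w \<in> space M" for w
      unfolding \<kappa>_def by (rule U.prob_space_distr[OF Gw'[OF that]])
    show "\<kappa> \<in> M \<rightarrow>\<^sub>M subprob_algebra borel"
      unfolding \<kappa>_def
    proof (rule measurable_distr2[OF G_meas])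
      show "(\<lambda>w. U) \<in> M \<rightarrow>\<^sub>M subprob_algebra borel"
        using sU U.subprob_space_axioms by (intro measurable_const) (simp add: space_subprob_algebra)
    qed
  qed
  have below_t: "cond_version (Below t) (\<lambda>w. emeasure (\<kappa> w) {..<t})" for t
  proof (cases "t \<le> 1")
    case False
    have "Below t = space ?N" unfolding Below_def using c01(2) False by (force intro: less_trans)
    moreover have "emeasure (\<kappa> w) {..<t} = 1" if "w \<in> space M" for w
    proof -
      have "emeasure (\<kappa> w) {..<t} = emeasure U (G w -` {..<t} \<inter> space U)"
        unfolding \<kappa>_def by (rule emeasure_distr[OF Gw'[OF that]]) simp
      also have "G w -` {..<t} \<inter> space U = space U" using G_le False by (force simp: sU intro: le_less_trans)
      finally show ?thesis by (simp add: U.emeasure_space_1)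
    qed
    ultimately show ?thesis using cond_version_space by (auto intro: cond_version_cong)
  next
    case True
    define S where "S w = (SUP q\<in>{q. real_of_rat q < t}. F (real_of_rat q) w)" for w
    have [measurable]: "S \<in> borel_measurable M" unfolding S_def by measurable
    have S1: "S w \<le> 1" for w unfolding S_def by (intro SUP_least F1)
    have "emeasure (\<kappa> w) {..<t} = S w" if "w \<in> space M" for w
    proof -
      have Dm: "G w -` {..<t} \<in> sets borel" using measurable_sets[OF Gw[OF that], of "{..<t}"] by simp
      have "emeasure (\<kappa> w) {..<t} = emeasure U (G w -` {..<t} \<inter> space U)"
        unfolding \<kappa>_def by (rule emeasure_distr[OF Gw'[OF that]]) simp
      also have "\<dots> = emeasure lborel ({0..<1} \<inter> G w -` {..<t})" using emU[OF Dm] by (simp add: sU)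
      also have "{0..<1} \<inter> G w -` {..<t} = {0..<enn2real (S w)}"
      proof -
        obtain s where s: "S w = ennreal s" "0 \<le> s" "s \<le> 1"
          using S1[of w] by (cases "S w") (auto simp: ennreal_le_1 top_unique)
        have "G w u < t \<longleftrightarrow> ennreal u < S w" for u
          unfolding G_less[OF True] S_def less_SUP_iff by auto
        then have "G w u < t \<longleftrightarrow> u < s" if "0 \<le> u" for u
          using that unfolding s(1) by (simp add: ennreal_less_iff)
        moreover have "enn2real (S w) = s" using s by simp
        ultimately show ?thesis using s(3) by (auto simp del: s(1))
      qed
      also have "emeasure lborel \<dots> = S w"
        using le_less_trans[OF S1[of w]] by (simp add: less_top)
      finally show ?thesis .
    qed
    moreover have "cond_version (Below t) S"
    proof (rule cond_version_cong_AE[OF F])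
      fix \<rho> assume \<rho>: "\<rho> \<in> \<Lambda>"
      let ?\<nu> = "distr \<rho> M snd"
      interpret \<rho>: prob_space \<rho> by (rule prob[OF \<rho>])
      have mono: "AE w in ?\<nu>. F s w \<le> F s' w" if "s \<le> s'" for s s'
        by (rule cond_version_mono[OF F F _ Below \<rho>]) (use that in \<open>auto simp: Below_def\<close>)
      have "AE w in ?\<nu>. \<forall>q. real_of_rat q < t \<longrightarrow> F (real_of_rat q) w \<le> F t w"
        unfolding AE_all_countable using mono by (auto intro: AE_mp)
      then have 1: "AE w in ?\<nu>. S w \<le> F t w"
        by eventually_elim (auto simp: S_def intro: SUP_least)
      have 2: "AE w in ?\<nu>. F t w \<le> S w"
      proof (rule AE_le_if_set_nn_integral_le)
        fix C assume "C \<in> sets ?\<nu>"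
        then have C[measurable]: "C \<in> sets M" by simp
        have lower: "emeasure \<rho> (Below s \<times> C) \<le> (\<integral>\<^sup>+w\<in>C. S w \<partial>?\<nu>)" if st: "s < t" for s
        proof -
          obtain q where q: "s < real_of_rat q" "real_of_rat q < t" using of_rat_dense[OF st] by blast
          have "AE w in ?\<nu>. F s w \<le> F (real_of_rat q) w" using mono q by simp
          moreover have "F (real_of_rat q) w \<le> S w" for w unfolding S_def using q by (intro SUP_upper) simp
          ultimately have "AE w in ?\<nu>. F s w * indicator C w \<le> S w * indicator C w"
            by (auto elim!: eventually_mono simp: indicator_def intro: order_trans)
          then show ?thesis unfolding cond_versionD(2)[OF F \<rho> C] by (rule nn_integral_mono_AE)
        qed
        have "Below t = (\<Union>n. Below (t - 1 / real (Suc n)))"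
        proof -
          have "\<exists>n. c x < t - 1 / real (Suc n)" if "c x < t" for x
            using nat_approx_posE[of "t - c x"] that by (metis diff_gt_0_iff_gt less_diff_eq add.commute)
          then show ?thesis
            by (auto simp: Below_def simp del: of_nat_Suc) (smt (verit) divide_nonneg_nonneg of_nat_0_le_iff)
        qed
        then have "Below t \<times> C = (\<Union>n. Below (t - 1 / real (Suc n)) \<times> C)" by auto
        moreover have "(SUP n. emeasure \<rho> (Below (t - 1 / real (Suc n)) \<times> C)) =
            emeasure \<rho> (\<Union>n. Below (t - 1 / real (Suc n)) \<times> C)"
        proof (rule SUP_emeasure_incseq)
          show "range (\<lambda>n. Below (t - 1 / real (Suc n)) \<times> C) \<subseteq> sets \<rho>"
            using Below C sets_eq[OF \<rho>] by (auto simp del: of_nat_Suc)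
          have "1 / real (Suc n) \<le> 1 / real (Suc m)" if "m \<le> n" for m n
            using that by (intro divide_left_mono) auto
          then show "incseq (\<lambda>n. Below (t - 1 / real (Suc n)) \<times> C)"
            by (fastforce simp: incseq_def Below_def simp del: of_nat_Suc)
        qed
        moreover have "(SUP n. emeasure \<rho> (Below (t - 1 / real (Suc n)) \<times> C)) \<le> (\<integral>\<^sup>+w\<in>C. S w \<partial>?\<nu>)"
          by (intro SUP_least lower) simp
        ultimately show "(\<integral>\<^sup>+w\<in>C. F t w \<partial>?\<nu>) \<le> (\<integral>\<^sup>+w\<in>C. S w \<partial>?\<nu>)"
          using cond_versionD(2)[OF F \<rho> C, of t] by simp
      next
        interpret \<nu>: prob_space ?\<nu> by (rule prob_marginal[OF \<rho>])
        have "(\<integral>\<^sup>+w. S w \<partial>?\<nu>) \<le> (\<integral>\<^sup>+w. 1 \<partial>?\<nu>)" by (intro nn_integral_mono S1)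
        then show "(\<integral>\<^sup>+w. S w \<partial>?\<nu>) < \<infinity>"
          using \<nu>.emeasure_space_1 by (auto intro: le_less_trans simp del: space_distr)
      qed auto
      from 1 2 show "AE w in ?\<nu>. F t w = S w" by eventually_elim auto
    qed simp
    ultimately show ?thesis by (auto intro: cond_version_cong)
  qed
  have real_sets: "cond_version (c -` D \<inter> space ?N) (\<lambda>w. emeasure (\<kappa> w) D)" if "D \<in> sets borel" for D
  proof (rule cond_version_kernel_sigma_sets[where G = "range lessThan" and L = borel])
    show "Int_stable (range lessThan :: real set set)"
    proof (rule Int_stableI)
      fix a b :: "real set" assume "a \<in> range lessThan" "b \<in> range lessThan"
      then obtain s t where "a = {..<s}" "b = {..<t}" by auto
      then have "a \<inter> b = {..<min s t}" by auto
      then show "a \<inter> b \<in> range lessThan" by blast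
    qed
    show "sets borel = sigma_sets (space borel) (range lessThan :: real set set)"
      by (subst borel_Iio) (simp add: sets_measure_of)
  qed (use \<kappa> cN below_t that in \<open>auto simp: Below_eq\<close>)
  define K where "K w = distr (\<kappa> w) ?N d'" for w
  have \<kappa>w: "sets (\<kappa> w) = sets borel" "space (\<kappa> w) = UNIV" for w by (simp_all add: \<kappa>_def)
  show ?thesis
  proof (rule that[of K])
    show "K \<in> M \<rightarrow>\<^sub>M prob_algebra ?N"
      unfolding K_def by (rule measurable_compose[OF \<kappa> measurable_distr_prob_space[OF d']])
    fix B assume B: "B \<in> sets ?N"
    have D: "d' -` B \<in> sets borel" using measurable_sets[OF d' B] by simp
    have "c -` (d' -` B) \<inter> space ?N = B"
      using sets.sets_into_space[OF B] by (auto simp: d'_def dc)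
    moreover have "emeasure (K w) B = emeasure (\<kappa> w) (d' -` B)" for w
      unfolding K_def using d' B \<kappa>w(1)[of w]
      by (subst emeasure_distr) (auto simp: \<kappa>w(2) cong: measurable_cong_sets)
    ultimately show "cond_version B (\<lambda>w. emeasure (K w) B)" using real_sets[OF D] by simp
  qed
qed

section \<open>Uniform closeness of measures\<close>

text \<open>Outer regularity on an arbitrary subset \<open>Y\<close> of a Polish space, obtained from outer regularity of the
image measure on the whole space.\<close>

lemma openin_outer_approximation:
  fixes Y :: "'y::polish_space set"
  assumes fin: "finite_measure \<mu>" and sets: "sets \<mu> = sets (borel_of (top_of_set Y))"
    and C: "C \<in> sets \<mu>" and \<eta>: "0 < \<eta>"
  obtains U where "openin (top_of_set Y) U" "C \<subseteq> U" "measure \<mu> U \<le> measure \<mu> C + \<eta>"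
proof -
  interpret finite_measure \<mu> by (rule fin)
  let ?\<mu> = "distr \<mu> borel (\<lambda>y. y)"
  have sp: "space \<mu> = Y" using sets_eq_imp_space_eq[OF sets] by simp
  have id: "(\<lambda>y. y) \<in> \<mu> \<rightarrow>\<^sub>M borel"
    using measurable_restrict_space1[OF measurable_ident[of borel], of Y]
    by (simp add: measurable_cong_sets[OF sets refl] measurable_cong_sets[OF sets_borel_of_top_of_set refl] id_def)
  obtain C' where C': "C' \<in> sets borel" "C = C' \<inter> Y"
    using C unfolding sets sets_borel_of_top_of_set by (auto simp: sets_restrict_space)
  have em: "emeasure ?\<mu> D = emeasure \<mu> (D \<inter> Y)" if "D \<in> sets borel" for D
    using emeasure_distr[OF id that] sp by simp
  have "emeasure ?\<mu> C' = (INF U \<in> {U. C' \<subseteq> U \<and> open U}. emeasure ?\<mu> U)"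
    using C'(1) by (intro outer_regular) (auto simp: em)
  moreover have "emeasure ?\<mu> C' < emeasure ?\<mu> C' + ennreal \<eta>"
    using \<eta> by (simp add: em[OF C'(1)] emeasure_eq_measure ennreal_less_iff flip: ennreal_plus)
  ultimately obtain U where U: "C' \<subseteq> U" "open U" "emeasure ?\<mu> U < emeasure ?\<mu> C' + ennreal \<eta>"
    by (auto simp: INF_less_iff)
  have "emeasure \<mu> (U \<inter> Y) < emeasure \<mu> C + ennreal \<eta>"
    using U C' em[of U] em[of C'] by (simp add: borel_open)
  then have "measure \<mu> (U \<inter> Y) < measure \<mu> C + \<eta>"
    using \<eta> by (simp add: emeasure_eq_measure ennreal_less_iff flip: ennreal_plus)
  then show ?thesis
    using U(1,2) C'(2) by (intro that[of "U \<inter> Y"]) (auto simp: openin_open Int_commute)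
qed

text \<open>A Borel set is approximated from outside by one open set that is good for both measures.\<close>

lemma measure_diff_le_of_openin:
  fixes Y :: "'y::polish_space set"
  assumes "finite_measure \<mu>" "sets \<mu> = sets (borel_of (top_of_set Y))"
    and "finite_measure \<nu>" "sets \<nu> = sets (borel_of (top_of_set Y))"
    and le: "\<And>U. openin (top_of_set Y) U \<Longrightarrow> \<bar>measure \<mu> U - measure \<nu> U\<bar> \<le> \<epsilon>"
    and C: "C \<in> sets (borel_of (top_of_set Y))"
  shows "\<bar>measure \<mu> C - measure \<nu> C\<bar> \<le> \<epsilon>"
proof (rule field_le_epsilon)
  fix \<eta> :: real assume "0 < \<eta>"
  interpret \<mu>: finite_measure \<mu> by fact
  interpret \<nu>: finite_measure \<nu> by fact
  obtain U where U: "openin (top_of_set Y) U" "C \<subseteq> U" "measure \<mu> U \<le> measure \<mu> C + \<eta>"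
    using openin_outer_approximation[OF assms(1,2) _ \<open>0 < \<eta>\<close>] C assms(2) by blast
  obtain V where V: "openin (top_of_set Y) V" "C \<subseteq> V" "measure \<nu> V \<le> measure \<nu> C + \<eta>"
    using openin_outer_approximation[OF assms(3,4) _ \<open>0 < \<eta>\<close>] C assms(4) by blast
  have W: "openin (top_of_set Y) (U \<inter> V)" using U V by blast
  have "measure \<mu> C \<le> measure \<mu> (U \<inter> V)" "measure \<mu> (U \<inter> V) \<le> measure \<mu> U"
    "measure \<nu> C \<le> measure \<nu> (U \<inter> V)" "measure \<nu> (U \<inter> V) \<le> measure \<nu> V"
    using U V W assms(2,4) by (auto intro!: \<mu>.finite_measure_mono \<nu>.finite_measure_mono borel_of_open)
  then show "\<bar>measure \<mu> C - measure \<nu> C\<bar> \<le> \<epsilon> + \<eta>"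
    using le[OF W] U V by linarith
qed

text \<open>Split the integral over the sets where \<open>g\<close> is positive and where it is not.\<close>

lemma integral_abs_le_of_set_integrals:
  fixes g :: "'a \<Rightarrow> real"
  assumes g: "integrable M g"
    and le: "\<And>C. C \<in> sets M \<Longrightarrow> \<bar>\<integral>x. g x * indicator C x \<partial>M\<bar> \<le> \<epsilon>"
  shows "(\<integral>x. \<bar>g x\<bar> \<partial>M) \<le> 2 * \<epsilon>"
proof -
  have [measurable]: "g \<in> borel_measurable M" using g by auto
  define C where "C = {x \<in> space M. 0 < g x}"
  have C: "C \<in> sets M" "space M - C \<in> sets M" unfolding C_def by measurable
  have i: "integrable M (\<lambda>x. g x * indicator D x)" if "D \<in> sets M" for D
    using integrable_mult_indicator[OF that g] by (simp add: mult.commute)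
  have "(\<integral>x. \<bar>g x\<bar> \<partial>M) = (\<integral>x. g x * indicator C x - g x * indicator (space M - C) x \<partial>M)"
    by (intro Bochner_Integration.integral_cong) (auto simp: C_def indicator_def)
  also have "\<dots> = (\<integral>x. g x * indicator C x \<partial>M) - (\<integral>x. g x * indicator (space M - C) x \<partial>M)"
    using i C by (intro Bochner_Integration.integral_diff) auto
  also have "\<dots> \<le> 2 * \<epsilon>" using le[OF C(1)] le[OF C(2)] by linarith
  finally show ?thesis .
qed

lemma finite_density_enn2real:
  assumes f: "f \<in> borel_measurable M" and fin: "finite_measure (density M f)"
  shows "AE x in M. f x < \<infinity>"
    and "integrable M (\<lambda>x. enn2real (f x))"
    and "C \<in> sets M \<Longrightarrow> (\<integral>x. enn2real (f x) * indicator C x \<partial>M) = measure (density M f) C"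
proof -
  note [measurable] = f
  have nn: "(\<integral>\<^sup>+x. f x \<partial>M) < \<infinity>"
    using finite_measure.emeasure_finite[OF fin, of "space M"]
    by (simp add: emeasure_density less_top[symmetric] cong: nn_integral_cong)
  show ae: "AE x in M. f x < \<infinity>"
    using nn_integral_PInf_AE[OF f] nn by (auto simp: less_top)
  have e: "AE x in M. ennreal (enn2real (f x)) = f x" using ae by eventually_elim simp
  have "(\<integral>\<^sup>+x. ennreal (enn2real (f x)) \<partial>M) = (\<integral>\<^sup>+x. f x \<partial>M)" using e by (rule nn_integral_cong_AE)
  then show "integrable M (\<lambda>x. enn2real (f x))"
    using nn by (intro integrableI_nonneg) auto
  assume C: "C \<in> sets M"
  have "(\<integral>x. enn2real (f x) * indicator C x \<partial>M) =
      enn2real (\<integral>\<^sup>+x. ennreal (enn2real (f x) * indicator C x) \<partial>M)"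
    using C by (intro integral_eq_nn_integral) auto
  also have "(\<integral>\<^sup>+x. ennreal (enn2real (f x) * indicator C x) \<partial>M) = (\<integral>\<^sup>+x\<in>C. f x \<partial>M)"
    using e by (intro nn_integral_cong_AE) (auto simp: indicator_def elim: eventually_mono)
  also have "\<dots> = emeasure (density M f) C" using C by (simp add: emeasure_density)
  finally show "(\<integral>x. enn2real (f x) * indicator C x \<partial>M) = measure (density M f) C"
    by (simp add: measure_def)
qed

lemma integral_abs_diff_densities_le:
  assumes f: "f \<in> borel_measurable M" "finite_measure (density M f)"
    and g: "g \<in> borel_measurable M" "finite_measure (density M g)"
    and le: "\<And>C. C \<in> sets M \<Longrightarrow> \<bar>measure (density M f) C - measure (density M g) C\<bar> \<le> \<epsilon>"
  shows "(\<integral>x. \<bar>enn2real (f x) - enn2real (g x)\<bar> \<partial>M) \<le> 2 * \<epsilon>"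
proof (rule integral_abs_le_of_set_integrals)
  note F = finite_density_enn2real[OF f] and G = finite_density_enn2real[OF g]
  show "integrable M (\<lambda>x. enn2real (f x) - enn2real (g x))" using F(2) G(2) by simp
  fix C assume C: "C \<in> sets M"
  have i: "integrable M (\<lambda>x. enn2real (f x) * indicator C x)" "integrable M (\<lambda>x. enn2real (g x) * indicator C x)"
    using integrable_mult_indicator[OF C F(2)] integrable_mult_indicator[OF C G(2)]
    by (simp_all add: mult.commute)
  have "(\<integral>x. (enn2real (f x) - enn2real (g x)) * indicator C x \<partial>M) =
      measure (density M f) C - measure (density M g) C"
    using i F(3)[OF C] G(3)[OF C] by (simp add: left_diff_distrib)
  then show "\<bar>\<integral>x. (enn2real (f x) - enn2real (g x)) * indicator C x \<partial>M\<bar> \<le> \<epsilon>" using le[OF C] by simp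
qed

section \<open>Setwise equicontinuous joint kernels\<close>

text \<open>The parameter space \<open>S\<close> plays the role of \<open>\<P>(X) \<times> A\<close>, and \<open>R s\<close> that of \<open>R(\<cdot> | z, a)\<close>. Points
of \<open>S\<close> exist by assumption; the dominating measure is built from a dense sequence of them.\<close>

locale equicontinuous_joint_kernel =
  fixes X :: "'x::polish_space set" and Y :: "'y::polish_space set"
    and S :: "'s topology" and R :: "'s \<Rightarrow> ('x \<times> 'y) measure" and \<tau> :: "'x set set"
  assumes X_borel: "X \<in> sets borel"
    and R_prob: "s \<in> topspace S \<Longrightarrow> R s \<in> prob_measures (prod_topology (top_of_set X) (top_of_set Y))"
    and second_countable_S: "second_countable S" and S_nonempty: "topspace S \<noteq> {}"
    and base: "countable_base (top_of_set X) \<tau>" and X_in_base: "X \<in> \<tau>"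
    and equicontinuous: "\<F> \<subseteq> \<tau> \<Longrightarrow> finite \<F> \<Longrightarrow> \<F> \<noteq> {} \<Longrightarrow> s \<in> topspace S \<Longrightarrow>
      equicontinuous_at S {\<lambda>s. measure (R s) (\<Inter>\<F> \<times> C) | C. openin (top_of_set Y) C} s"
begin

abbreviation "TX \<equiv> top_of_set X"
abbreviation "TY \<equiv> top_of_set Y"
abbreviation "BX \<equiv> borel_of TX"
abbreviation "BY \<equiv> borel_of TY"

definition base_Int :: "'x set set" where
  "base_Int = Inter ` {\<F>. finite \<F> \<and> \<F> \<subseteq> \<tau> \<and> \<F> \<noteq> {}}"

definition marginal :: "'s \<Rightarrow> 'y measure" where
  "marginal s = distr (R s) BY snd"

text \<open>The measure \<open>C \<mapsto> R(B \<times> C | s)\<close>.\<close>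

definition slice :: "'x set \<Rightarrow> 's \<Rightarrow> 'y measure" where
  "slice B s = distr (density (R s) (indicator (B \<times> Y))) BY snd"

lemma base_Int_nonempty: "X \<in> base_Int"
  unfolding base_Int_def using X_in_base by (intro image_eqI[of _ _ "{X}"]) auto

lemma base_subset_base_Int: "\<tau> \<subseteq> base_Int"
proof
  fix B assume "B \<in> \<tau>"
  then show "B \<in> base_Int" unfolding base_Int_def by (intro image_eqI[of _ _ "{B}"]) auto
qed

lemma base_Int_open: "E \<in> base_Int \<Longrightarrow> openin TX E"
  unfolding base_Int_def using base by (auto simp del: Inter_iff simp: countable_base_def intro!: openin_Inter)

lemma base_Int_sets: "E \<in> base_Int \<Longrightarrow> E \<in> sets BX"
  by (intro borel_of_open base_Int_open)

lemma countable_base_Int: "countable base_Int"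
  using countable_base_topology_generated_by[of \<tau>] base by (simp add: countable_base_def base_Int_def)

lemma Int_base_Int: "E \<in> base_Int \<Longrightarrow> E' \<in> base_Int \<Longrightarrow> E \<inter> E' \<in> base_Int"
proof -
  assume "E \<in> base_Int" "E' \<in> base_Int"
  then obtain F F' where "finite F" "F \<subseteq> \<tau>" "F \<noteq> {}" "E = \<Inter>F" "finite F'" "F' \<subseteq> \<tau>" "F' \<noteq> {}" "E' = \<Inter>F'"
    unfolding base_Int_def by auto
  then show ?thesis unfolding base_Int_def by (intro image_eqI[of _ _ "F \<union> F'"]) auto
qed

lemma sets_BX: "sets BX = sigma_sets (space BX) base_Int"
proof
  have "U \<in> sigma_sets X base_Int" if U: "openin TX U" for U
  proof -
    obtain \<V> where \<V>: "countable \<V>" "\<V> \<subseteq> \<tau>" "U = \<Union>\<V>"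
      using openin_countable_Union_base[OF base U] by blast
    interpret sigma_algebra X "sigma_sets X base_Int"
      using openin_subset[OF base_Int_open] by (intro sigma_algebra_sigma_sets) auto
    show ?thesis
      unfolding \<V>(3) using \<V>(1,2) base_subset_base_Int by (intro countable_Union) auto
  qed
  then show "sets BX \<subseteq> sigma_sets (space BX) base_Int"
    unfolding sets_borel_of space_borel_of topspace_euclidean_subtopology
    by (intro sigma_sets_mono) auto
  show "sigma_sets (space BX) base_Int \<subseteq> sets BX"
    using base_Int_sets by (intro sets.sigma_sets_subset) auto
qed

lemma R_props:
  assumes "s \<in> topspace S"
  shows "prob_space (R s)" "sets (R s) = sets (BX \<Otimes>\<^sub>M BY)" "space (R s) = X \<times> Y"
    "snd \<in> R s \<rightarrow>\<^sub>M BY"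
proof -
  show "prob_space (R s)" and sets: "sets (R s) = sets (BX \<Otimes>\<^sub>M BY)"
    using prob_measuresD(1,2)[OF R_prob[OF assms]] sets_borel_of_prod[of X Y] by (simp_all only:)
  show "space (R s) = X \<times> Y" using prob_measuresD(3)[OF R_prob[OF assms]] by simp
  show "snd \<in> R s \<rightarrow>\<^sub>M BY" using measurable_cong_sets[OF sets refl] measurable_snd by blast
qed

lemma emeasure_slice:
  assumes s: "s \<in> topspace S" and B: "B \<in> sets BX" and C: "C \<in> sets BY"
  shows "emeasure (slice B s) C = emeasure (R s) (B \<times> C)"
proof -
  have m: "B \<times> Y \<in> sets (R s)" "snd -` C \<inter> space (R s) \<in> sets (R s)"
    using B sets.top[of BY] R_props[OF s] measurable_sets[OF R_props(4)[OF s] C] by auto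
  have "emeasure (slice B s) C = emeasure (density (R s) (indicator (B \<times> Y))) (snd -` C \<inter> space (R s))"
    unfolding slice_def using C R_props(4)[OF s] by (subst emeasure_distr) auto
  also have "\<dots> = emeasure (R s) (B \<times> Y \<inter> (snd -` C \<inter> space (R s)))"
    using m by (rule emeasure_restricted)
  also have "B \<times> Y \<inter> (snd -` C \<inter> space (R s)) = B \<times> C"
    using sets.sets_into_space[OF B] sets.sets_into_space[OF C] R_props(3)[OF s] by auto
  finally show ?thesis .
qed

lemma sets_slice [simp]: "sets (slice B s) = sets BY" "space (slice B s) = Y"
  by (simp_all add: slice_def)

lemma measure_slice:
  "s \<in> topspace S \<Longrightarrow> B \<in> sets BX \<Longrightarrow> C \<in> sets BY \<Longrightarrow> measure (slice B s) C = measure (R s) (B \<times> C)"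
  by (simp add: measure_def emeasure_slice)

lemma finite_slice:
  assumes "s \<in> topspace S" "B \<in> sets BX"
  shows "finite_measure (slice B s)"
proof
  interpret prob_space "R s" by (rule R_props[OF assms(1)])
  show "emeasure (slice B s) (space (slice B s)) \<noteq> \<infinity>"
    using emeasure_slice[OF assms sets.top] by simp
qed

lemma marginal_eq_slice:
  assumes s: "s \<in> topspace S"
  shows "marginal s = slice X s"
proof -
  have "density (R s) (indicator (X \<times> Y)) = density (R s) (\<lambda>_. 1)"
    using R_props(3)[OF s] sets.top[of "R s"] by (intro density_cong AE_I2) auto
  then show ?thesis by (simp add: marginal_def slice_def density_1)
qed

lemma marginal_prob:
  assumes "s \<in> topspace S"
  shows "prob_space (marginal s)" "sets (marginal s) = sets BY" "space (marginal s) = Y"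
  unfolding marginal_def using R_props[OF assms]
  by (auto intro: prob_space.prob_space_distr)

text \<open>The hypothesis controls \<open>R(E \<times> C | s')\<close> uniformly for open \<open>C\<close> only; \<open>measure_diff_le_of_openin\<close> carries
the bound over to all Borel sets \<open>C\<close>.\<close>

lemma uniform_near:
  assumes E: "E \<in> base_Int" and s: "s \<in> topspace S" and \<epsilon>: "0 < \<epsilon>"
  obtains U where "openin S U" "s \<in> U"
    "\<And>s' C. s' \<in> U \<Longrightarrow> C \<in> sets BY \<Longrightarrow> \<bar>measure (R s') (E \<times> C) - measure (R s) (E \<times> C)\<bar> \<le> \<epsilon>"
proof -
  obtain \<F> where \<F>: "finite \<F>" "\<F> \<subseteq> \<tau>" "\<F> \<noteq> {}" "E = \<Inter>\<F>" using E unfolding base_Int_def by auto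
  let ?fam = "{\<lambda>s. measure (R s) (E \<times> C) | C. openin TY C}"
  have "((\<lambda>s'. SUP f\<in>?fam. ennreal \<bar>f s' - f s\<bar>) \<longlongrightarrow> 0) (atin S s)"
    using equicontinuous[OF \<F>(2,1,3) s] unfolding equicontinuous_at_def \<F>(4) .
  then have "\<forall>\<^sub>F s' in atin S s. (SUP f\<in>?fam. ennreal \<bar>f s' - f s\<bar>) < ennreal \<epsilon>"
    using \<epsilon> by (intro order_tendstoD) auto
  then obtain U where U: "openin S U" "s \<in> U"
    "\<And>s'. s' \<in> U - {s} \<Longrightarrow> (SUP f\<in>?fam. ennreal \<bar>f s' - f s\<bar>) < ennreal \<epsilon>"
    using s unfolding eventually_atin by blast
  have near: "\<bar>measure (R s') (E \<times> C) - measure (R s) (E \<times> C)\<bar> \<le> \<epsilon>" if "s' \<in> U" "openin TY C" for s' C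
  proof (cases "s' = s")
    case False
    have "ennreal \<bar>measure (R s') (E \<times> C) - measure (R s) (E \<times> C)\<bar> \<le> (SUP f\<in>?fam. ennreal \<bar>f s' - f s\<bar>)"
      using that(2) by (intro SUP_upper2[of "\<lambda>s. measure (R s) (E \<times> C)"]) auto
    also have "\<dots> < ennreal \<epsilon>" using U(3) that(1) False by blast
    finally show ?thesis using \<epsilon> by (simp add: ennreal_less_iff)
  qed (use \<epsilon> in simp)
  show ?thesis
  proof (rule that[OF U(1,2)])
    fix s' C assume s': "s' \<in> U" and C: "C \<in> sets BY"
    have s'S: "s' \<in> topspace S" using s' U(1) openin_subset by blast
    note Os = base_Int_sets[OF E]
    have "\<bar>measure (slice E s') C - measure (slice E s) C\<bar> \<le> \<epsilon>"
    proof (rule measure_diff_le_of_openin[OF finite_slice[OF s'S Os] _ finite_slice[OF s Os] _ _ C])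
      fix V assume V: "openin TY V"
      show "\<bar>measure (slice E s') V - measure (slice E s) V\<bar> \<le> \<epsilon>"
        using near[OF s' V] measure_slice[OF s Os borel_of_open[OF V]]
          measure_slice[OF s'S Os borel_of_open[OF V]] by simp
    qed simp_all
    then show "\<bar>measure (R s') (E \<times> C) - measure (R s) (E \<times> C)\<bar> \<le> \<epsilon>"
      using measure_slice[OF s Os C] measure_slice[OF s'S Os C] by simp
  qed
qed

lemma continuous_map_rect:
  assumes E: "E \<in> base_Int" and C: "C \<in> sets BY"
  shows "continuous_map S euclideanreal (\<lambda>s. measure (R s) (E \<times> C))"
proof -
  have "\<exists>U. openin S U \<and> s \<in> U \<and> (\<forall>s'\<in>U. measure (R s') (E \<times> C) \<in> ball (measure (R s) (E \<times> C)) \<epsilon>)"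
    if s: "s \<in> topspace S" and \<epsilon>: "\<epsilon> > 0" for s \<epsilon>
  proof -
    have "\<epsilon> / 2 > 0" using \<epsilon> by simp
    then obtain U where U: "openin S U" "s \<in> U"
      and near: "\<And>s' C. s' \<in> U \<Longrightarrow> C \<in> sets BY \<Longrightarrow>
        \<bar>measure (R s') (E \<times> C) - measure (R s) (E \<times> C)\<bar> \<le> \<epsilon> / 2"
      using uniform_near[OF E s] by blast
    have "measure (R s') (E \<times> C) \<in> ball (measure (R s) (E \<times> C)) \<epsilon>" if "s' \<in> U" for s'
      using near[OF that C] \<epsilon> unfolding mem_ball dist_real_def by linarith
    then show ?thesis using U by blast
  qed
  then show ?thesis
    using Met_TC.continuous_map_to_metric[of S "\<lambda>s. measure (R s) (E \<times> C)"] by simp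
qed

lemma rect_measurable:
  assumes "E \<in> base_Int" "C \<in> sets BY"
  shows "(\<lambda>s. measure (R s) (E \<times> C)) \<in> borel_measurable (borel_of S)"
  by (intro continuous_map_borel_measurable continuous_map_rect assms)

lemma measure_marginal:
  "s \<in> topspace S \<Longrightarrow> C \<in> sets BY \<Longrightarrow> measure (marginal s) C = measure (R s) (X \<times> C)"
  using base_Int_nonempty by (simp add: marginal_eq_slice measure_slice base_Int_sets)

lemma marginal_stochastic_kernel: "stochastic_kernel TY S marginal"
  unfolding stochastic_kernel_def
proof (intro conjI ballI)
  show "marginal s \<in> prob_measures TY" if "s \<in> topspace S" for s
    using marginal_prob[OF that] by (simp add: prob_measures_def)
  fix C assume C: "C \<in> sets BY"
  show "(\<lambda>s. measure (marginal s) C) \<in> borel_measurable (borel_of S)"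
    using rect_measurable[OF base_Int_nonempty C] C
    by (subst measurable_cong[of _ _ "\<lambda>s. measure (R s) (X \<times> C)"]) (simp_all add: measure_marginal)
qed

end

section \<open>A dominating measure and jointly measurable densities\<close>

context equicontinuous_joint_kernel
begin

lemma exists_dense_sequence:
  obtains d :: "nat \<Rightarrow> 's" where "range d \<subseteq> topspace S"
    "\<And>U s. openin S U \<Longrightarrow> s \<in> U \<Longrightarrow> \<exists>n. d n \<in> U"
proof -
  obtain D where D: "countable D" "D \<subseteq> topspace S" "S closure_of D = topspace S"
    using second_countable_imp_separable_space[OF second_countable_S] unfolding separable_space_def by blast
  have "D \<noteq> {}" using D(3) S_nonempty closure_of_empty[of S] by metis
  then have r: "range (from_nat_into D) = D" using D(1) by (rule range_from_nat_into)
  have "\<exists>n. from_nat_into D n \<in> U" if "openin S U" "s \<in> U" for U s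
  proof -
    have "D \<inter> U \<noteq> {}"
      using D(3)[unfolded dense_intersects_open, rule_format, of U] that by blast
    then obtain t where "t \<in> D" "t \<in> U" by blast
    with r obtain n where "t = from_nat_into D n" by (metis rangeE)
    then show ?thesis using \<open>t \<in> U\<close> by blast
  qed
  then show ?thesis using that[of "from_nat_into D"] r D(2) by blast
qed

text \<open>Mix the marginals at a dense sequence of points with the strictly positive weights of a geometric
distribution. A null set of the mixture is null for all these marginals, and by \<open>uniform_near\<close> for
\<open>E = X\<close> then for all marginals, which dominate the slices.\<close>

lemma dominating_measure:
  obtains m where "prob_space m" "sets m = sets BY"
    "\<And>s B. s \<in> topspace S \<Longrightarrow> B \<in> sets BX \<Longrightarrow> absolutely_continuous m (slice B s)"
proof -
  obtain d :: "nat \<Rightarrow> 's" where d: "range d \<subseteq> topspace S"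
    and dense: "\<And>U s. openin S U \<Longrightarrow> s \<in> U \<Longrightarrow> \<exists>n. d n \<in> U"
    using exists_dense_sequence by blast
  have dS: "d n \<in> topspace S" for n using d by blast
  let ?G = "measure_pmf (geometric_pmf (1 / 2))"
  define m where "m = ?G \<bind> (\<lambda>n. marginal (d n))"
  have K: "(\<lambda>n. marginal (d n)) \<in> ?G \<rightarrow>\<^sub>M prob_algebra BY"
    using marginal_prob[OF dS] by (auto simp: space_prob_algebra measurable_def)
  have G: "?G \<in> space (prob_algebra ?G)"
    by (simp add: space_prob_algebra measure_pmf.prob_space_axioms)
  show ?thesis
  proof (rule that[of m])
    show "prob_space m" unfolding m_def by (rule prob_space_bind'[OF G K])
    show sm: "sets m = sets BY" unfolding m_def by (rule sets_bind'[OF G K])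
    fix s B assume s: "s \<in> topspace S" and B: "B \<in> sets BX"
    show "absolutely_continuous m (slice B s)"
      unfolding absolutely_continuous_def
    proof
      fix C assume "C \<in> null_sets m"
      then have C: "C \<in> sets BY" and 0: "emeasure m C = 0" using sm by (auto simp: null_sets_def)
      have "emeasure m C = (\<integral>\<^sup>+n. emeasure (marginal (d n)) C \<partial>?G)"
        unfolding m_def by (rule emeasure_bind[OF _ measurable_prob_algebraD[OF K] C]) simp
      then have "AE n in ?G. emeasure (marginal (d n)) C = 0"
        using 0 by (simp add: nn_integral_0_iff_AE)
      then have d0: "measure (R (d n)) (X \<times> C) = 0" for n
        using measure_marginal[OF dS C, of n]
        by (simp add: AE_measure_pmf_iff set_pmf_geometric measure_def)
      have "measure (R s) (X \<times> C) \<le> \<epsilon>" if \<epsilon>: "0 < \<epsilon>" for \<epsilon>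
      proof -
        obtain U where U: "openin S U" "s \<in> U"
          "\<And>s' C. s' \<in> U \<Longrightarrow> C \<in> sets BY \<Longrightarrow> \<bar>measure (R s') (X \<times> C) - measure (R s) (X \<times> C)\<bar> \<le> \<epsilon>"
          using uniform_near[OF base_Int_nonempty s \<epsilon>] by blast
        obtain n where "d n \<in> U" using dense[OF U(1,2)] by blast
        then show ?thesis using U(3)[OF _ C, of "d n"] d0[of n] by simp
      qed
      then have "measure (R s) (X \<times> C) = 0"
        by (meson dense_ge dual_order.antisym measure_nonneg order_refl)
      moreover interpret prob_space "R s" by (rule R_props[OF s])
      have "emeasure (R s) (B \<times> C) \<le> emeasure (R s) (X \<times> C)"
        using sets.sets_into_space[OF B] C R_props(2)[OF s] base_Int_sets[OF base_Int_nonempty]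
        by (intro emeasure_mono) auto
      ultimately have "emeasure (slice B s) C = 0"
        using emeasure_slice[OF s B C] by (simp add: emeasure_eq_measure)
      then show "C \<in> null_sets (slice B s)" using C by (auto simp: null_sets_def)
    qed
  qed
qed

end

locale dominated_joint_kernel = equicontinuous_joint_kernel X Y S R \<tau>
  for X :: "'x::polish_space set" and Y :: "'y::polish_space set"
    and S :: "'s topology" and R :: "'s \<Rightarrow> ('x \<times> 'y) measure" and \<tau> :: "'x set set" +
  fixes m :: "'y measure"
  assumes prob_m: "prob_space m" and sets_m: "sets m = sets BY"
    and dominated: "s \<in> topspace S \<Longrightarrow> B \<in> sets BX \<Longrightarrow> absolutely_continuous m (slice B s)"
begin

sublocale m: prob_space m by (rule prob_m)

definition dens :: "'x set \<Rightarrow> 's \<Rightarrow> 'y \<Rightarrow> ennreal" where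
  "dens B s = RN_deriv m (slice B s)"

lemma dens_measurable [measurable]: "dens B s \<in> borel_measurable m"
  unfolding dens_def by simp

lemma density_dens:
  assumes "s \<in> topspace S" "B \<in> sets BX"
  shows "density m (dens B s) = slice B s"
  unfolding dens_def using assms by (intro m.density_RN_deriv dominated) (auto simp: sets_m)

lemma finite_density_dens:
  "s \<in> topspace S \<Longrightarrow> B \<in> sets BX \<Longrightarrow> finite_measure (density m (dens B s))"
  by (simp add: density_dens finite_slice)

lemma integral_dens_diff_le:
  assumes s: "s \<in> topspace S" "s' \<in> topspace S" and B: "B \<in> sets BX"
    and le: "\<And>C. C \<in> sets BY \<Longrightarrow> \<bar>measure (R s) (B \<times> C) - measure (R s') (B \<times> C)\<bar> \<le> \<epsilon>"
  shows "(\<integral>y. \<bar>enn2real (dens B s y) - enn2real (dens B s' y)\<bar> \<partial>m) \<le> 2 * \<epsilon>"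
  using s B le
  by (intro integral_abs_diff_densities_le finite_density_dens)
     (auto simp: density_dens measure_slice sets_m)

text \<open>The map \<open>s \<mapsto> dens E s\<close> is continuous into \<open>L\<^sup>1(m)\<close>. At stage \<open>n\<close>, replace \<open>s\<close> by the first member of
the dense sequence that is within \<open>2\<^sup>-\<^sup>n\<close> of it; the resulting function takes countably many densities as
values and is jointly measurable. For each \<open>s\<close> the \<open>L\<^sup>1\<close>-errors are summable, so the stages converge
almost everywhere without passing to a subsequence, which would depend on \<open>s\<close>.\<close>

lemma jointly_measurable_density:
  assumes E: "E \<in> base_Int"
  obtains F where "case_prod F \<in> borel_measurable (borel_of S \<Otimes>\<^sub>M BY)"
    "\<And>s. s \<in> topspace S \<Longrightarrow> density m (F s) = slice E s"
proof -
  obtain d :: "nat \<Rightarrow> 's" where d: "range d \<subseteq> topspace S"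
    and dense: "\<And>U s. openin S U \<Longrightarrow> s \<in> U \<Longrightarrow> \<exists>n. d n \<in> U"
    using exists_dense_sequence by blast
  have dS: "d n \<in> topspace S" for n using d by blast
  note Es = base_Int_sets[OF E]
  define close where "close n i s \<longleftrightarrow>
    (\<forall>C\<in>sets BY. \<bar>measure (R s) (E \<times> C) - measure (R (d i)) (E \<times> C)\<bar> \<le> (1/2) ^ n)" for n i s
  define idx where "idx n s = (LEAST i. close n i s)" for n s
  have ex_close: "\<exists>i. close n i s" if s: "s \<in> topspace S" for n s
  proof -
    obtain U where U: "openin S U" "s \<in> U"
      "\<And>s' C. s' \<in> U \<Longrightarrow> C \<in> sets BY \<Longrightarrow> \<bar>measure (R s') (E \<times> C) - measure (R s) (E \<times> C)\<bar> \<le> (1/2) ^ n"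
      using uniform_near[OF E s, of "(1/2) ^ n"] by auto
    obtain i where "d i \<in> U" using dense[OF U(1,2)] by blast
    then have "close n i s" unfolding close_def using U(3)[of "d i"] by (simp add: abs_minus_commute)
    then show ?thesis by blast
  qed
  have idx: "close n (idx n s) s" if "s \<in> topspace S" for n s
    unfolding idx_def by (rule LeastI_ex) (rule ex_close[OF that])
  have close_meas: "Measurable.pred (borel_of S) (close n i)" for n i
  proof -
    have "openin S {s \<in> topspace S. measure (R s) (E \<times> C) \<in>
        {t. (1/2) ^ n < \<bar>t - measure (R (d i)) (E \<times> C)\<bar>}}" if "C \<in> sets BY" for C
      by (rule openin_continuous_map_preimage[OF continuous_map_rect[OF E that]])
         (auto intro!: open_Collect_less continuous_intros)
    then have "openin S (\<Union>C\<in>sets BY. {s \<in> topspace S. measure (R s) (E \<times> C) \<in>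
        {t. (1/2) ^ n < \<bar>t - measure (R (d i)) (E \<times> C)\<bar>}})"
      by blast
    then have "topspace S - (\<Union>C\<in>sets BY. {s \<in> topspace S. measure (R s) (E \<times> C) \<in>
        {t. (1/2) ^ n < \<bar>t - measure (R (d i)) (E \<times> C)\<bar>}}) \<in> sets (borel_of S)"
      using sets.compl_sets[OF borel_of_open] by simp
    also have "topspace S - (\<Union>C\<in>sets BY. {s \<in> topspace S. measure (R s) (E \<times> C) \<in>
        {t. (1/2) ^ n < \<bar>t - measure (R (d i)) (E \<times> C)\<bar>}}) = {s \<in> space (borel_of S). close n i s}"
      by (auto simp: close_def not_less)
    finally show ?thesis by (simp add: pred_def)
  qed
  then have idx_meas: "idx n \<in> borel_of S \<rightarrow>\<^sub>M count_space UNIV" for n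
    unfolding idx_def by (rule measurable_Least)
  define f where "f n s y = enn2real (dens E (d (idx n s)) y)" for n s y
  have densY: "(\<lambda>y. enn2real (dens E s y)) \<in> borel_measurable BY" for s
    using dens_measurable[of E s] by (simp add: measurable_cong_sets[OF sets_m refl])
  have f_meas: "(\<lambda>p. f n (fst p) (snd p)) \<in> borel_measurable (borel_of S \<Otimes>\<^sub>M BY)" for n
    unfolding f_def
    by (rule measurable_compose_countable[where f = "\<lambda>i p. enn2real (dens E (d i) (snd p))"])
       (intro measurable_compose[OF measurable_snd densY] measurable_compose[OF measurable_fst idx_meas])+
  \<comment> \<open>The limit superior is measurable and defined also at points where the stages diverge.\<close>
  define F where "F s y = limsup (\<lambda>n. ennreal (f n s y))" for s y
  show ?thesis
  proof (rule that[of F])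
    show "case_prod F \<in> borel_measurable (borel_of S \<Otimes>\<^sub>M BY)"
      unfolding F_def case_prod_beta using f_meas by measurable
    fix s assume s: "s \<in> topspace S"
    let ?g = "\<lambda>y. enn2real (dens E s y)"
    note D = finite_density_enn2real[OF dens_measurable finite_density_dens[OF _ Es]]
    have f_int: "integrable m (\<lambda>y. f n s y - ?g y)" for n
      unfolding f_def using D(2)[OF dS] D(2)[OF s] by simp
    have "(\<integral>y. \<bar>f n s y - ?g y\<bar> \<partial>m) \<le> 2 * (1/2) ^ n" for n
      unfolding f_def using idx[OF s, of n]
      by (intro integral_dens_diff_le dS s Es) (auto simp: close_def abs_minus_commute)
    then have L1: "(\<integral>\<^sup>+y. ennreal \<bar>f n s y - ?g y\<bar> \<partial>m) \<le> ennreal (2 * (1/2) ^ n)" for n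
      using f_int[of n] by (subst nn_integral_eq_integral) auto
    have sm: "summable (\<lambda>n. 2 * (1/2) ^ n :: real)" by (intro summable_mult summable_geometric) simp
    have "(\<integral>\<^sup>+y. (\<Sum>n. ennreal \<bar>f n s y - ?g y\<bar>) \<partial>m) = (\<Sum>n. \<integral>\<^sup>+y. ennreal \<bar>f n s y - ?g y\<bar> \<partial>m)"
      using f_int by (intro nn_integral_suminf) auto
    also have "\<dots> \<le> (\<Sum>n. ennreal (2 * (1/2) ^ n))" by (intro suminf_le L1) auto
    also have "\<dots> = ennreal (\<Sum>n. 2 * (1/2) ^ n)" using sm by (intro suminf_ennreal2) auto
    also have "\<dots> < \<infinity>" by simp
    finally have "AE y in m. (\<Sum>n. ennreal \<bar>f n s y - ?g y\<bar>) \<noteq> \<infinity>"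
      using f_int by (intro nn_integral_PInf_AE) auto
    then have "AE y in m. F s y = dens E s y"
      using D(1)[OF s]
    proof eventually_elim
      fix y assume "(\<Sum>n. ennreal \<bar>f n s y - ?g y\<bar>) \<noteq> \<infinity>" and fin: "dens E s y < \<infinity>"
      then have "summable (\<lambda>n. \<bar>f n s y - ?g y\<bar>)" by (intro summable_suminf_not_top) auto
      then have "(\<lambda>n. \<bar>f n s y - ?g y\<bar>) \<longlonglongrightarrow> 0" by (rule summable_LIMSEQ_zero)
      then have "(\<lambda>n. f n s y - ?g y) \<longlonglongrightarrow> 0" by (simp add: tendsto_rabs_zero_iff)
      then have "(\<lambda>n. f n s y) \<longlonglongrightarrow> ?g y" by (simp add: LIM_zero_iff)
      then have "(\<lambda>n. ennreal (f n s y)) \<longlonglongrightarrow> ennreal (?g y)" by (rule tendsto_ennrealI)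
      then have "F s y = ennreal (?g y)" unfolding F_def by (intro lim_imp_Limsup) auto
      then show "F s y = dens E s y" using fin by simp
    qed
    moreover have "F s \<in> borel_measurable m"
    proof -
      have "(\<lambda>y. f n s y) \<in> borel_measurable m" for n unfolding f_def by measurable
      then show ?thesis unfolding F_def by measurable
    qed
    ultimately have "density m (F s) = density m (dens E s)" by (intro density_cong) auto
    then show "density m (F s) = slice E s" using density_dens[OF s Es] by simp
  qed
qed

lemma jointly_measurable_conditional_prob:
  assumes E: "E \<in> base_Int"
  obtains h where "case_prod h \<in> borel_measurable (borel_of S \<Otimes>\<^sub>M BY)"
    "\<And>s C. s \<in> topspace S \<Longrightarrow> C \<in> sets BY \<Longrightarrow>
      emeasure (R s) (E \<times> C) = (\<integral>\<^sup>+y\<in>C. h s y \<partial>marginal s)"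
proof -
  obtain F where F: "case_prod F \<in> borel_measurable (borel_of S \<Otimes>\<^sub>M BY)"
    "\<And>s. s \<in> topspace S \<Longrightarrow> density m (F s) = slice E s"
    using jointly_measurable_density[OF E] by blast
  obtain G where G: "case_prod G \<in> borel_measurable (borel_of S \<Otimes>\<^sub>M BY)"
    "\<And>s. s \<in> topspace S \<Longrightarrow> density m (G s) = slice X s"
    using jointly_measurable_density[OF base_Int_nonempty] by blast
  note Es = base_Int_sets[OF E] and Xs = base_Int_sets[OF base_Int_nonempty]
  show ?thesis
  proof (rule that[of "\<lambda>s y. F s y / G s y"])
    show "(\<lambda>(s, y). F s y / G s y) \<in> borel_measurable (borel_of S \<Otimes>\<^sub>M BY)"
      using F(1) G(1) by (simp add: case_prod_beta)
    fix s C assume s: "s \<in> topspace S" and C: "C \<in> sets BY"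
    have sec: "F s \<in> borel_measurable m" "G s \<in> borel_measurable m"
      using measurable_Pair2[OF F(1), of s] measurable_Pair2[OF G(1), of s] s
      by (simp_all add: measurable_cong_sets[OF sets_m refl])
    note [measurable] = sec
    have emF: "(\<integral>\<^sup>+y\<in>D. F s y \<partial>m) = emeasure (R s) (E \<times> D)"
      and emG: "(\<integral>\<^sup>+y\<in>D. G s y \<partial>m) = emeasure (R s) (X \<times> D)" if "D \<in> sets BY" for D
      using F(2)[OF s] G(2)[OF s] emeasure_density[OF sec(1), of D] emeasure_density[OF sec(2), of D]
        emeasure_slice[OF s Es that] emeasure_slice[OF s Xs that] that by (simp_all add: sets_m)
    have fin: "finite_measure (density m (G s))" using G(2)[OF s] finite_slice[OF s Xs] by simp
    note GAE = finite_density_enn2real(1)[OF sec(2) fin]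
    have "AE y in m. F s y \<le> G s y"
    proof (rule AE_le_if_set_nn_integral_le[OF sec])
      show "(\<integral>\<^sup>+y\<in>D. F s y \<partial>m) \<le> (\<integral>\<^sup>+y\<in>D. G s y \<partial>m)" if "D \<in> sets m" for D
        using that emF emG R_props(2)[OF s] Xs sets.sets_into_space[OF Es]
        by (auto simp: sets_m intro!: emeasure_mono)
      interpret prob_space "R s" by (rule R_props[OF s])
      have "(\<integral>\<^sup>+y. G s y \<partial>m) = (\<integral>\<^sup>+y\<in>space m. G s y \<partial>m)" by (intro nn_integral_cong) auto
      also have "\<dots> = emeasure (R s) (X \<times> space m)"
        using emG[of "space m"] sets.top[of m] by (simp add: sets_m)
      also have "\<dots> < \<infinity>" by (simp add: less_top[symmetric])
      finally show "(\<integral>\<^sup>+y. G s y \<partial>m) < \<infinity>" .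
    qed
    then have eq: "AE y in m. F s y * indicator C y = G s y * (F s y / G s y * indicator C y)"
      using GAE
    proof eventually_elim
      fix y assume *: "F s y \<le> G s y" "G s y < \<infinity>"
      have "G s y * (F s y / G s y) = F s y"
      proof (cases "G s y = 0")
        case False
        then show ?thesis using *(2) by (simp add: ennreal_times_divide mult.commute mult_divide_eq_ennreal)
      qed (use * in simp)
      then show "F s y * indicator C y = G s y * (F s y / G s y * indicator C y)"
        by (simp add: mult.assoc[symmetric])
    qed
    have mC: "C \<in> sets m" using C by (simp add: sets_m)
    have "(\<integral>\<^sup>+y\<in>C. F s y / G s y \<partial>marginal s) = (\<integral>\<^sup>+y\<in>C. F s y / G s y \<partial>density m (G s))"
      using marginal_eq_slice[OF s] G(2)[OF s] by simp
    also have "\<dots> = (\<integral>\<^sup>+y. G s y * (F s y / G s y * indicator C y) \<partial>m)"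
      using mC by (intro nn_integral_density sec) auto
    also have "\<dots> = (\<integral>\<^sup>+y\<in>C. F s y \<partial>m)" using eq by (intro nn_integral_cong_AE) auto
    finally show "emeasure (R s) (E \<times> C) = (\<integral>\<^sup>+y\<in>C. F s y / G s y \<partial>marginal s)"
      using emF[OF C] by simp
  qed
qed

end

section \<open>Jointly measurable disintegration and continuity in total variation\<close>

lemma tendsto_zero_if_eventually_le:
  fixes u :: "nat \<Rightarrow> real"
  assumes "\<And>n. 0 \<le> u n" and "\<And>\<epsilon>. 0 < \<epsilon> \<Longrightarrow> \<forall>\<^sub>F n in sequentially. u n \<le> c * \<epsilon>" and c: "0 < c"
  shows "u \<longlonglongrightarrow> 0"
proof (rule tendstoI)
  fix e :: real assume "0 < e"
  then have "\<forall>\<^sub>F n in sequentially. u n \<le> c * (e / (2 * c))" using c by (intro assms(2)) simp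
  then show "\<forall>\<^sub>F n in sequentially. dist (u n) 0 < e"
    by (rule eventually_mono) (use assms(1) c \<open>0 < e\<close> in \<open>simp add: le_less_trans\<close>)
qed

context equicontinuous_joint_kernel
begin

text \<open>A filter kernel without joint measurability. The convergence results below concern every kernel of this
kind.\<close>

definition disintegration :: "('s \<Rightarrow> 'y \<Rightarrow> 'x measure) \<Rightarrow> bool" where
  "disintegration H \<longleftrightarrow> (\<forall>s\<in>topspace S. H s \<in> BY \<rightarrow>\<^sub>M prob_algebra BX \<and>
     (\<forall>B\<in>sets BX. \<forall>C\<in>sets BY.
        emeasure (R s) (B \<times> C) = (\<integral>\<^sup>+y\<in>C. emeasure (H s y) B \<partial>marginal s)))"

lemma disintegrationD:
  assumes "disintegration H" "s \<in> topspace S"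
  shows "H s \<in> BY \<rightarrow>\<^sub>M prob_algebra BX"
    and "B \<in> sets BX \<Longrightarrow> C \<in> sets BY \<Longrightarrow>
      emeasure (R s) (B \<times> C) = (\<integral>\<^sup>+y\<in>C. emeasure (H s y) B \<partial>marginal s)"
    and "y \<in> Y \<Longrightarrow> H s y \<in> prob_measures TX"
proof -
  show H: "H s \<in> BY \<rightarrow>\<^sub>M prob_algebra BX" using assms by (simp add: disintegration_def)
  show "H s y \<in> prob_measures TX" if "y \<in> Y"
    using measurable_space[OF H, of y] that by (simp add: space_prob_algebra prob_measures_def)
  show "B \<in> sets BX \<Longrightarrow> C \<in> sets BY \<Longrightarrow>
      emeasure (R s) (B \<times> C) = (\<integral>\<^sup>+y\<in>C. emeasure (H s y) B \<partial>marginal s)"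
    using assms by (simp add: disintegration_def)
qed

end

context dominated_joint_kernel
begin

lemma jointly_measurable_disintegration:
  obtains K where "K \<in> borel_of S \<Otimes>\<^sub>M BY \<rightarrow>\<^sub>M prob_algebra BX" "disintegration (\<lambda>s y. K (s, y))"
proof -
  let ?W = "borel_of S \<Otimes>\<^sub>M BY"
  define J where "J s = distr (R s) (BX \<Otimes>\<^sub>M ?W) (\<lambda>(x, y). (x, (s, y)))" for s
  have J_meas: "(\<lambda>(x, y). (x, (s, y))) \<in> R s \<rightarrow>\<^sub>M BX \<Otimes>\<^sub>M ?W" if s: "s \<in> topspace S" for s
    using s by (subst measurable_cong_sets[OF R_props(2)[OF s] refl]) simp
  have emJ: "emeasure (J s) (B \<times> C) = emeasure (R s) (B \<times> (Pair s -` C))"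
    if s: "s \<in> topspace S" and B: "B \<in> sets BX" and C: "C \<in> sets ?W" for s B C
  proof -
    have "emeasure (J s) (B \<times> C) = emeasure (R s) ((\<lambda>(x, y). (x, (s, y))) -` (B \<times> C) \<inter> space (R s))"
      unfolding J_def using B C by (intro emeasure_distr J_meas s) auto
    also have "(\<lambda>(x, y). (x, (s, y))) -` (B \<times> C) \<inter> space (R s) = B \<times> (Pair s -` C)"
      using R_props(3)[OF s] sets.sets_into_space[OF B] sets.sets_into_space[OF C]
      by (auto simp: space_pair_measure)
    finally show ?thesis .
  qed
  have marg: "distr (J s) ?W snd = distr (marginal s) ?W (Pair s)" if s: "s \<in> topspace S" for s
  proof -
    have P: "Pair s \<in> BY \<rightarrow>\<^sub>M ?W" using s by (intro measurable_Pair1') simp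
    show ?thesis
      unfolding J_def marginal_def distr_distr[OF measurable_snd J_meas[OF s]]
        distr_distr[OF P R_props(4)[OF s]] by (intro distr_cong) (auto simp: o_def)
  qed
  define \<Lambda> where "\<Lambda> = J ` topspace S"
  have fam: "measure_family BX ?W \<Lambda>"
  proof (rule measure_family.intro)
    show "prob_space \<rho>" if "\<rho> \<in> \<Lambda>" for \<rho>
      using that R_props(1) J_meas unfolding \<Lambda>_def J_def by (auto intro: prob_space.prob_space_distr)
    show "sets \<rho> = sets (BX \<Otimes>\<^sub>M ?W)" if "\<rho> \<in> \<Lambda>" for \<rho>
      using that unfolding \<Lambda>_def J_def by auto
  qed
  interpret measure_family BX ?W \<Lambda> by (rule fam)
  have int: "(\<integral>\<^sup>+w\<in>C. h w \<partial>distr (J s) ?W snd) = (\<integral>\<^sup>+y\<in>Pair s -` C. h (s, y) \<partial>marginal s)"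
    if s: "s \<in> topspace S" and C: "C \<in> sets ?W" and h: "h \<in> borel_measurable ?W" for s C h
  proof -
    have P: "Pair s \<in> marginal s \<rightarrow>\<^sub>M ?W"
      using measurable_Pair1'[of s "borel_of S" BY] s
      by (simp add: measurable_cong_sets[OF marginal_prob(2)[OF s] refl])
    show ?thesis
      unfolding marg[OF s] using C h
      by (subst nn_integral_distr[OF P]) (auto intro!: nn_integral_cong simp: indicator_def)
  qed
  have cond_iff: "cond_version B h \<longleftrightarrow> h \<in> borel_measurable ?W \<and> (\<forall>s\<in>topspace S. \<forall>C\<in>sets BY.
      emeasure (R s) (B \<times> C) = (\<integral>\<^sup>+y\<in>C. h (s, y) \<partial>marginal s))" if B: "B \<in> sets BX" for B h
  proof (rule iffI)
    assume c: "cond_version B h"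
    have h: "h \<in> borel_measurable ?W" by (rule cond_versionD(1)[OF c])
    have "emeasure (R s) (B \<times> C) = (\<integral>\<^sup>+y\<in>C. h (s, y) \<partial>marginal s)"
      if s: "s \<in> topspace S" and C: "C \<in> sets BY" for s C
    proof -
    have SC: "topspace S \<times> C \<in> sets ?W" using C sets.top[of "borel_of S"] by auto
    have "Pair s -` (topspace S \<times> C) = C" using s by auto
    then show ?thesis
      using emJ[OF s B SC] int[OF s SC h] cond_versionD(2)[OF c _ SC, of "J s"] s by (simp add: \<Lambda>_def)
    qed
    with h show "h \<in> borel_measurable ?W \<and> (\<forall>s\<in>topspace S. \<forall>C\<in>sets BY.
      emeasure (R s) (B \<times> C) = (\<integral>\<^sup>+y\<in>C. h (s, y) \<partial>marginal s))" by blast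
  next
    assume "h \<in> borel_measurable ?W \<and> (\<forall>s\<in>topspace S. \<forall>C\<in>sets BY.
      emeasure (R s) (B \<times> C) = (\<integral>\<^sup>+y\<in>C. h (s, y) \<partial>marginal s))"
    then have h: "h \<in> borel_measurable ?W" and *: "\<forall>s\<in>topspace S. \<forall>C\<in>sets BY.
      emeasure (R s) (B \<times> C) = (\<integral>\<^sup>+y\<in>C. h (s, y) \<partial>marginal s)"
      by auto
    show "cond_version B h"
      unfolding cond_version_def
    proof (intro conjI ballI h)
      fix \<rho> C assume "\<rho> \<in> \<Lambda>" and C: "C \<in> sets ?W"
      then obtain s where s: "s \<in> topspace S" "\<rho> = J s" by (auto simp: \<Lambda>_def)
      have "Pair s -` C \<in> sets BY" using C by (rule sets_Pair1)
      then show "emeasure \<rho> (B \<times> C) = (\<integral>\<^sup>+w\<in>C. h w \<partial>distr \<rho> ?W snd)"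
        using * s(1) emJ[OF s(1) B C] int[OF s(1) C h] by (simp add: s(2))
    qed
  qed
  have "X \<noteq> {}"
    using S_nonempty R_props(1,3) prob_space.not_empty by fastforce
  have ex: "\<exists>h. cond_version B h" if "B \<in> sets BX" for B
  proof (rule cond_version_exists_sigma_sets[of base_Int])
    show "Int_stable base_Int" using Int_base_Int by (auto intro: Int_stableI)
    show "base_Int \<subseteq> Pow (space BX)" using base_Int_sets sets.sets_into_space by fast
    show "\<exists>h. cond_version E h" if E: "E \<in> base_Int" for E
    proof -
      obtain h where "case_prod h \<in> borel_measurable ?W"
        "\<And>s C. s \<in> topspace S \<Longrightarrow> C \<in> sets BY \<Longrightarrow>
          emeasure (R s) (E \<times> C) = (\<integral>\<^sup>+y\<in>C. h s y \<partial>marginal s)"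
        using jointly_measurable_conditional_prob[OF E] by blast
      then have "cond_version E (case_prod h)" by (simp add: cond_iff[OF base_Int_sets[OF E]])
      then show ?thesis by blast
    qed
  qed (use sets_BX that in simp_all)
  obtain K where K: "K \<in> ?W \<rightarrow>\<^sub>M prob_algebra BX"
    "\<And>B. B \<in> sets BX \<Longrightarrow> cond_version B (\<lambda>w. emeasure (K w) B)"
    using disintegration_kernel[OF X_borel \<open>X \<noteq> {}\<close> fam ex] by blast
  have "disintegration (\<lambda>s y. K (s, y))"
    unfolding disintegration_def
  proof (intro ballI conjI)
    fix s assume s: "s \<in> topspace S"
    show "(\<lambda>y. K (s, y)) \<in> BY \<rightarrow>\<^sub>M prob_algebra BX"
      using measurable_compose[OF measurable_Pair1'[of s "borel_of S" BY] K(1)] s by simp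
    show "emeasure (R s) (B \<times> C) = (\<integral>\<^sup>+y\<in>C. emeasure (K (s, y)) B \<partial>marginal s)"
      if "B \<in> sets BX" "C \<in> sets BY" for B C
      using K(2)[OF that(1)] s that by (simp add: cond_iff)
  qed
  then show ?thesis by (rule that[OF K(1)])
qed

text \<open>Both integrals are integrals with respect to \<open>m\<close>, and the densities of the marginals differ by at most
\<open>2 * \<epsilon>\<close> in \<open>L\<^sup>1(m)\<close>.\<close>

lemma integral_marginal_diff_le:
  assumes s: "s \<in> topspace S" "s' \<in> topspace S"
    and le: "\<And>C. C \<in> sets BY \<Longrightarrow> \<bar>measure (R s) (X \<times> C) - measure (R s') (X \<times> C)\<bar> \<le> \<epsilon>"
    and f: "f \<in> borel_measurable BY" and b: "\<And>y. y \<in> Y \<Longrightarrow> \<bar>f y\<bar> \<le> b" and b0: "0 \<le> b"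
  shows "\<bar>(\<integral>y. f y \<partial>marginal s) - (\<integral>y. f y \<partial>marginal s')\<bar> \<le> b * (2 * \<epsilon>)"
proof -
  note Xs = base_Int_sets[OF base_Int_nonempty]
  have fm[measurable]: "f \<in> borel_measurable m" using f by (simp add: measurable_cong_sets[OF sets_m refl])
  have spm: "space m = Y" using sets_eq_imp_space_eq[OF sets_m] by simp
  let ?p = "\<lambda>t y. enn2real (dens X t y)"
  have eq: "(\<integral>y. f y \<partial>marginal t) = (\<integral>y. ?p t y * f y \<partial>m)"
    and int: "integrable m (\<lambda>y. ?p t y * f y)" and pint: "integrable m (?p t)"
    if t: "t \<in> topspace S" for t
  proof -
    note D = finite_density_enn2real[OF dens_measurable finite_density_dens[OF t Xs]]
    show pint: "integrable m (?p t)" by (rule D(2))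
    have "density m (dens X t) = density m (\<lambda>y. ennreal (?p t y))"
      using D(1) by (intro density_cong) (auto elim: eventually_mono)
    then have "marginal t = density m (\<lambda>y. ennreal (?p t y))"
      using marginal_eq_slice[OF t] density_dens[OF t Xs] by simp
    then show "(\<integral>y. f y \<partial>marginal t) = (\<integral>y. ?p t y * f y \<partial>m)"
      using integral_density[OF fm, of "?p t"] by simp
    show "integrable m (\<lambda>y. ?p t y * f y)"
    proof (rule Bochner_Integration.integrable_bound[where f = "\<lambda>y. b * ?p t y"])
      show "AE y in m. norm (?p t y * f y) \<le> norm (b * ?p t y)"
        using b b0 spm by (intro AE_I2) (auto simp: abs_mult mult.commute intro!: mult_right_mono)
    qed (use pint in auto)
  qed
  have "(\<integral>y. f y \<partial>marginal s) - (\<integral>y. f y \<partial>marginal s') = (\<integral>y. ?p s y * f y - ?p s' y * f y \<partial>m)"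
    using int s eq by simp
  also have "\<bar>\<dots>\<bar> \<le> (\<integral>y. \<bar>?p s y * f y - ?p s' y * f y\<bar> \<partial>m)" by (rule integral_abs_bound)
  also have "\<dots> \<le> (\<integral>y. b * \<bar>?p s y - ?p s' y\<bar> \<partial>m)"
  proof (rule integral_mono)
    show "integrable m (\<lambda>y. \<bar>?p s y * f y - ?p s' y * f y\<bar>)" using int s by simp
    show "integrable m (\<lambda>y. b * \<bar>?p s y - ?p s' y\<bar>)" using pint s by simp
    fix y assume "y \<in> space m"
    then have "\<bar>?p s y - ?p s' y\<bar> * \<bar>f y\<bar> \<le> \<bar>?p s y - ?p s' y\<bar> * b"
      using b spm by (intro mult_left_mono) auto
    then show "\<bar>?p s y * f y - ?p s' y * f y\<bar> \<le> b * \<bar>?p s y - ?p s' y\<bar>"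
      by (simp only: left_diff_distrib[symmetric] abs_mult mult.commute[of b])
  qed
  also have "\<dots> = b * (\<integral>y. \<bar>?p s y - ?p s' y\<bar> \<partial>m)" by simp
  also have "\<dots> \<le> b * (2 * \<epsilon>)" by (intro mult_left_mono integral_dens_diff_le s Xs le b0)
  finally show ?thesis .
qed

lemma eventually_uniform_near:
  assumes E: "E \<in> base_Int" and lim: "limitin S sn s sequentially" and \<epsilon>: "0 < \<epsilon>"
  shows "\<forall>\<^sub>F n in sequentially. \<forall>C\<in>sets BY. \<bar>measure (R (sn n)) (E \<times> C) - measure (R s) (E \<times> C)\<bar> \<le> \<epsilon>"
proof -
  have s: "s \<in> topspace S" using lim by (rule limitin_topspace)
  obtain U where U: "openin S U" "s \<in> U"
    "\<And>s' C. s' \<in> U \<Longrightarrow> C \<in> sets BY \<Longrightarrow> \<bar>measure (R s') (E \<times> C) - measure (R s) (E \<times> C)\<bar> \<le> \<epsilon>"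
    using uniform_near[OF E s \<epsilon>] by blast
  have "\<forall>\<^sub>F n in sequentially. sn n \<in> U" using lim U(1,2) unfolding limitin_def by blast
  then show ?thesis by (rule eventually_mono) (use U(3) in blast)
qed

lemma marginal_tv_continuous: "tv_continuous_kernel TY S marginal"
  unfolding tv_continuous_kernel_def
proof (intro conjI allI impI marginal_stochastic_kernel)
  fix sn s assume sn: "\<forall>n. sn n \<in> topspace S" and lim: "limitin S sn s sequentially"
  have s: "s \<in> topspace S" using lim by (rule limitin_topspace)
  let ?F = "{f \<in> borel_measurable BY. \<forall>y \<in> topspace TY. f y \<in> {-1..1::real}}"
  let ?d = "\<lambda>n f. \<bar>(\<integral>y. f y \<partial>marginal (sn n)) - (\<integral>y. f y \<partial>marginal s)\<bar>"
  have zero: "(\<lambda>_. 0) \<in> ?F" by simp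
  have bound: "?d n f \<le> 1 * (2 * \<epsilon>)"
    if "f \<in> ?F" "\<forall>C\<in>sets BY. \<bar>measure (R (sn n)) (X \<times> C) - measure (R s) (X \<times> C)\<bar> \<le> \<epsilon>" for n f \<epsilon>
    using that sn by (intro integral_marginal_diff_le s) (auto simp: abs_le_iff)
  have bdd: "bdd_above (?d n ` ?F)" for n
  proof (rule bdd_aboveI2)
    have "\<bar>measure (R (sn n)) D - measure (R s) D\<bar> \<le> 1" for D
      using prob_space.prob_le_1[OF R_props(1)[OF s], of D]
        prob_space.prob_le_1[OF R_props(1), of "sn n" D] sn measure_nonneg[of "R s" D]
        measure_nonneg[of "R (sn n)" D] by (smt (verit))
    then show "?d n f \<le> 1 * (2 * 1)" if "f \<in> ?F" for f using that by (intro bound) auto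
  qed
  show "(\<lambda>n. tv_dist TY (marginal (sn n)) (marginal s)) \<longlonglongrightarrow> 0"
  proof (rule tendsto_zero_if_eventually_le[of _ 2])
    show "0 \<le> tv_dist TY (marginal (sn n)) (marginal s)" for n
      unfolding tv_dist_def by (rule cSUP_upper2[OF bdd zero]) simp
    fix \<epsilon> :: real assume "0 < \<epsilon>"
    from eventually_uniform_near[OF base_Int_nonempty lim this]
    show "\<forall>\<^sub>F n in sequentially. tv_dist TY (marginal (sn n)) (marginal s) \<le> 2 * \<epsilon>"
    proof (rule eventually_mono)
      fix n assume "\<forall>C\<in>sets BY. \<bar>measure (R (sn n)) (X \<times> C) - measure (R s) (X \<times> C)\<bar> \<le> \<epsilon>"
      then show "tv_dist TY (marginal (sn n)) (marginal s) \<le> 2 * \<epsilon>"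
        unfolding tv_dist_def using bound[of _ n \<epsilon>] by (intro cSUP_least[OF ex_in_conv[THEN iffD1, OF exI, OF zero]]) auto
    qed
  qed simp
qed

end

section \<open>Convergence of disintegrations\<close>

text \<open>Inclusion-exclusion, by induction on the number of sets: with \<open>xs = A # ys\<close>, both \<open>ys\<close> and the
intersections of its members with \<open>A\<close> are shorter lists of sets from \<open>\<C>\<close>.\<close>

lemma tendsto_measure_Union_list:
  assumes \<mu>: "\<And>n. finite_measure (\<mu> n)" "finite_measure \<nu>"
    and Int: "\<And>A B. A \<in> \<C> \<Longrightarrow> B \<in> \<C> \<Longrightarrow> A \<inter> B \<in> \<C>"
    and sets: "\<And>n. \<C> \<subseteq> sets (\<mu> n)" "\<C> \<subseteq> sets \<nu>"
    and lim: "\<And>A. A \<in> \<C> \<Longrightarrow> (\<lambda>n. measure (\<mu> n) A) \<longlonglongrightarrow> measure \<nu> A"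
    and xs: "set xs \<subseteq> \<C>"
  shows "(\<lambda>n. measure (\<mu> n) (\<Union>(set xs))) \<longlonglongrightarrow> measure \<nu> (\<Union>(set xs))"
  using xs
proof (induction "length xs" arbitrary: xs)
  case (Suc k)
  then obtain A ys where xs: "xs = A # ys" "length ys = k" by (metis length_Suc_conv)
  have A: "A \<in> \<C>" and ys: "set ys \<subseteq> \<C>" using Suc.prems xs by auto
  define zs where "zs = map ((\<inter>) A) ys"
  have zs: "set zs \<subseteq> \<C>" using Int A ys by (auto simp: zs_def)
  have incl_excl: "measure \<rho> (\<Union>(set xs)) = measure \<rho> A + measure \<rho> (\<Union>(set ys)) - measure \<rho> (\<Union>(set zs))"
    if fin: "finite_measure \<rho>" and s: "\<C> \<subseteq> sets \<rho>" for \<rho>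
  proof -
    have m: "A \<in> sets \<rho>" "\<Union>(set ys) \<in> sets \<rho>" using A ys s by (auto intro!: sets.finite_Union)
    have "A \<inter> \<Union>(set ys) = \<Union>(set zs)" by (auto simp: zs_def)
    moreover have "\<Union>(set xs) = A \<union> \<Union>(set ys)" by (simp add: xs)
    ultimately show ?thesis
      using measure_Un3[of A \<rho> "\<Union>(set ys)"] m finite_measure.emeasure_finite[OF fin]
      by (simp add: fmeasurable_def less_top[symmetric])
  qed
  have "(\<lambda>n. measure (\<mu> n) A + measure (\<mu> n) (\<Union>(set ys)) - measure (\<mu> n) (\<Union>(set zs)))
      \<longlonglongrightarrow> measure \<nu> A + measure \<nu> (\<Union>(set ys)) - measure \<nu> (\<Union>(set zs))"
  proof (rule tendsto_diff[OF tendsto_add[OF lim[OF A]]])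
    show "(\<lambda>n. measure (\<mu> n) (\<Union>(set ys))) \<longlonglongrightarrow> measure \<nu> (\<Union>(set ys))"
      by (rule Suc.hyps(1)) (use Suc.hyps(2) xs ys in auto)
    show "(\<lambda>n. measure (\<mu> n) (\<Union>(set zs))) \<longlonglongrightarrow> measure \<nu> (\<Union>(set zs))"
      by (rule Suc.hyps(1)) (use Suc.hyps(2) xs zs in \<open>auto simp: zs_def\<close>)
  qed
  then show ?case by (simp only: incl_excl[OF \<mu>(1) sets(1)] incl_excl[OF \<mu>(2) sets(2)])
qed simp

text \<open>Finite unions of base sets form the subbase of \<open>weak_topology_eq_generated\<close>, and their measures are
determined by those of finite intersections through inclusion-exclusion.\<close>

lemma (in equicontinuous_joint_kernel) limitin_weak_topology_of_base_Int:
  assumes \<mu>: "\<And>n. \<mu> n \<in> prob_measures TX" and \<nu>: "\<nu> \<in> prob_measures TX"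
    and lim: "\<And>E. E \<in> base_Int \<Longrightarrow> (\<lambda>n. measure (\<mu> n) E) \<longlonglongrightarrow> measure \<nu> E"
  shows "limitin (weak_topology TX) \<mu> \<nu> sequentially"
  unfolding weak_topology_eq_generated[OF base]
proof (rule limitin_topology_generated_by)
  show "\<nu> \<in> \<Union> (weak_subbase TX \<tau>)" using \<nu> by (simp add: Union_weak_subbase)
  fix V assume "V \<in> weak_subbase TX \<tau>" "\<nu> \<in> V"
  then obtain q \<F> where V: "V = {z \<in> prob_measures TX. real_of_rat q < measure z (\<Union>\<F>)}"
    and \<F>: "finite \<F>" "\<F> \<subseteq> \<tau>" and q: "real_of_rat q < measure \<nu> (\<Union>\<F>)"
    by (auto simp: weak_subbase_def)
  obtain xs where xs: "set xs = \<F>" using finite_list[OF \<F>(1)] by blast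
  have "(\<lambda>n. measure (\<mu> n) (\<Union>(set xs))) \<longlonglongrightarrow> measure \<nu> (\<Union>(set xs))"
  proof (rule tendsto_measure_Union_list[OF _ _ Int_base_Int _ _ lim])
    show "finite_measure (\<mu> n)" for n using prob_measuresD(1)[OF \<mu>] by (simp add: prob_space_def)
    show "finite_measure \<nu>" using prob_measuresD(1)[OF \<nu>] by (simp add: prob_space_def)
    show "base_Int \<subseteq> sets (\<mu> n)" for n using prob_measuresD(2)[OF \<mu>] base_Int_sets by blast
    show "base_Int \<subseteq> sets \<nu>" using prob_measuresD(2)[OF \<nu>] base_Int_sets by blast
    show "set xs \<subseteq> base_Int" using xs \<F>(2) base_subset_base_Int by blast
  qed
  then have "\<forall>\<^sub>F n in sequentially. real_of_rat q < measure (\<mu> n) (\<Union>\<F>)"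
    using q unfolding xs by (rule order_tendstoD)
  then show "\<forall>\<^sub>F n in sequentially. \<mu> n \<in> V" by (rule eventually_mono) (simp add: V \<mu>)
qed

context dominated_joint_kernel
begin

text \<open>The function \<open>w t\<close> is the density with respect to \<open>m\<close> of the slice \<open>C \<mapsto> R(E \<times> C | t)\<close>, whichever
disintegration \<open>H\<close> is used, and uniform closeness of slices is \<open>L\<^sup>1\<close>-closeness of densities.\<close>

lemma integral_weighted_disintegration_diff_tendsto:
  assumes H: "disintegration H" and sn: "\<And>n. sn n \<in> topspace S"
    and lim: "limitin S sn s sequentially" and E: "E \<in> base_Int"
  defines "w \<equiv> \<lambda>t y. measure (H t y) E * enn2real (dens X t y)"
  shows "integrable m (\<lambda>y. w (sn n) y - w s y)"
    and "(\<lambda>n. \<integral>y. \<bar>w (sn n) y - w s y\<bar> \<partial>m) \<longlonglongrightarrow> 0"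
proof -
  have s: "s \<in> topspace S" using lim by (rule limitin_topspace)
  note Es = base_Int_sets[OF E] and Xs = base_Int_sets[OF base_Int_nonempty]
  have spm: "space m = Y" using sets_eq_imp_space_eq[OF sets_m] by simp
  define f where "f t y = dens X t y * emeasure (H t y) E" for t y
  have f: "f t \<in> borel_measurable m" "density m (f t) = slice E t" "\<And>y. y \<in> space m \<Longrightarrow> enn2real (f t y) = w t y"
    if t: "t \<in> topspace S" for t
  proof -
    have "(\<lambda>\<mu>. emeasure \<mu> E) \<in> borel_measurable (subprob_algebra BX)"
      by (rule measurable_emeasure_subprob_algebra[OF Es])
    from measurable_compose[OF measurable_prob_algebraD[OF disintegrationD(1)[OF H t]] this]
    have HE[measurable]: "(\<lambda>y. emeasure (H t y) E) \<in> borel_measurable m"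
      by (simp add: measurable_cong_sets[OF sets_m refl])
    show fm: "f t \<in> borel_measurable m" unfolding f_def by measurable
    show "density m (f t) = slice E t"
    proof (rule measure_eqI)
      fix C assume "C \<in> sets (density m (f t))"
      then have C: "C \<in> sets BY" and Cm[measurable]: "C \<in> sets m" by (simp_all add: sets_m)
      have "emeasure (density m (f t)) C = (\<integral>\<^sup>+y\<in>C. f t y \<partial>m)"
        using fm Cm by (rule emeasure_density)
      also have "\<dots> = (\<integral>\<^sup>+y. dens X t y * (emeasure (H t y) E * indicator C y) \<partial>m)"
        by (simp add: f_def mult.assoc)
      also have "\<dots> = (\<integral>\<^sup>+y\<in>C. emeasure (H t y) E \<partial>density m (dens X t))"
        by (rule nn_integral_density[symmetric]) measurable
      also have "\<dots> = emeasure (R t) (E \<times> C)"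
        using disintegrationD(2)[OF H t Es C] marginal_eq_slice[OF t] density_dens[OF t Xs] by simp
      also have "\<dots> = emeasure (slice E t) C" using emeasure_slice[OF t Es C] by simp
      finally show "emeasure (density m (f t)) C = emeasure (slice E t) C" .
    qed (simp add: sets_m)
    show "enn2real (f t y) = w t y" if "y \<in> space m" for y
      by (simp add: f_def w_def enn2real_mult measure_def mult.commute)
  qed
  have fin: "finite_measure (density m (f t))" if "t \<in> topspace S" for t
    using f(2)[OF that] finite_slice[OF that Es] by simp
  show "integrable m (\<lambda>y. w (sn n) y - w s y)"
    using finite_density_enn2real(2)[OF f(1) fin] f(3) s sn
    by (subst Bochner_Integration.integrable_cong[OF refl, of _ _ "\<lambda>y. enn2real (f (sn n) y) - enn2real (f s y)"]) auto
  show "(\<lambda>n. \<integral>y. \<bar>w (sn n) y - w s y\<bar> \<partial>m) \<longlonglongrightarrow> 0"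
  proof (rule tendsto_zero_if_eventually_le[of _ 2])
    fix \<epsilon> :: real assume "0 < \<epsilon>"
    from eventually_uniform_near[OF E lim this]
    show "\<forall>\<^sub>F n in sequentially. (\<integral>y. \<bar>w (sn n) y - w s y\<bar> \<partial>m) \<le> 2 * \<epsilon>"
    proof (rule eventually_mono)
      fix n assume *: "\<forall>C\<in>sets BY. \<bar>measure (R (sn n)) (E \<times> C) - measure (R s) (E \<times> C)\<bar> \<le> \<epsilon>"
      have "(\<integral>y. \<bar>w (sn n) y - w s y\<bar> \<partial>m) = (\<integral>y. \<bar>enn2real (f (sn n) y) - enn2real (f s y)\<bar> \<partial>m)"
        using f(3) s sn by (intro Bochner_Integration.integral_cong) auto
      also have "\<dots> \<le> 2 * \<epsilon>"
        using * s sn f(1,2) fin Es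
        by (intro integral_abs_diff_densities_le) (auto simp: measure_slice sets_m)
      finally show "(\<integral>y. \<bar>w (sn n) y - w s y\<bar> \<partial>m) \<le> 2 * \<epsilon>" .
    qed
  qed simp_all
qed

text \<open>The diagonal subsequence makes the weighted probabilities \<open>w E\<close> converge almost everywhere for all
finite intersections \<open>E\<close> of base sets. The case \<open>E = X\<close> is convergence of the weights \<open>p\<close> themselves,
and dividing by them is possible where the limit weight is positive, which is almost everywhere for the
marginal at \<open>s\<close>.\<close>

lemma disintegration_subsequence:
  assumes H: "disintegration H" and sn: "\<And>n. sn n \<in> topspace S"
    and lim: "limitin S sn s sequentially"
  obtains r C where "strict_mono (r :: nat \<Rightarrow> nat)" "C \<in> sets BY" "measure (marginal s) C = 1"
    "\<And>y. y \<in> C \<Longrightarrow> limitin (weak_topology TX) (\<lambda>k. H (sn (r k)) y) (H s y) sequentially"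
proof -
  have s: "s \<in> topspace S" using lim by (rule limitin_topspace)
  note Xs = base_Int_sets[OF base_Int_nonempty]
  define p where "p t y = enn2real (dens X t y)" for t y
  define w where "w E t y = measure (H t y) E * p t y" for E t y
  define e where "e = from_nat_into base_Int"
  have e: "range e = base_Int"
    unfolding e_def using countable_base_Int base_Int_nonempty by (intro range_from_nat_into) auto
  then have eb: "e j \<in> base_Int" for j by blast
  define AE_conv where "AE_conv j r \<longleftrightarrow> (AE y in m. (\<lambda>k. w (e j) (sn (r k)) y - w (e j) s y) \<longlonglongrightarrow> 0)"
    for j and r :: "nat \<Rightarrow> nat"
  interpret subseqs AE_conv
  proof
    fix j and \<sigma> :: "nat \<Rightarrow> nat" assume \<sigma>: "strict_mono \<sigma>"
    note L1 = integral_weighted_disintegration_diff_tendsto[OF H sn lim eb, folded p_def w_def]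
    have "\<exists>r. strict_mono r \<and> (AE y in m. (\<lambda>k. w (e j) (sn (\<sigma> (r k))) y - w (e j) s y) \<longlonglongrightarrow> 0)"
    proof (rule tendsto_L1_AE_subseq)
      show "integrable m (\<lambda>y. w (e j) (sn (\<sigma> n)) y - w (e j) s y)" for n by (rule L1(1))
      show "(\<lambda>n. \<integral>y. norm (w (e j) (sn (\<sigma> n)) y - w (e j) s y) \<partial>m) \<longlonglongrightarrow> 0"
        using LIMSEQ_subseq_LIMSEQ[OF L1(2) \<sigma>] by (simp add: o_def)
    qed
    then show "\<exists>r'. strict_mono r' \<and> AE_conv j (\<sigma> \<circ> r')" by (simp add: AE_conv_def)
  qed
  have conv: "AE y in m. (\<lambda>k. w (e j) (sn (diagseq k)) y - w (e j) s y) \<longlonglongrightarrow> 0" for j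
  proof -
    have "AE_conv j (diagseq \<circ> (+) (Suc j))"
    proof (rule diagseq_holds)
      show "AE_conv n (\<sigma> \<circ> r)" if "strict_mono r" "AE_conv n \<sigma>" for r \<sigma> n
        using that(2) unfolding AE_conv_def
        by (rule eventually_mono) (use LIMSEQ_subseq_LIMSEQ[OF _ that(1)] in \<open>force simp: o_def\<close>)
    qed
    then show ?thesis
      unfolding AE_conv_def
      by (rule eventually_mono) (rule LIMSEQ_offset[where k = "Suc j"], simp add: add.commute)
  qed
  define good where "good y \<longleftrightarrow> (\<forall>E\<in>base_Int. (\<lambda>k. w E (sn (diagseq k)) y) \<longlonglongrightarrow> w E s y) \<and> 0 < p s y" for y
  have good: "limitin (weak_topology TX) (\<lambda>k. H (sn (diagseq k)) y) (H s y) sequentially"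
    if y: "y \<in> Y" and g: "good y" for y
  proof (rule limitin_weak_topology_of_base_Int)
    show Hn: "H (sn n) y \<in> prob_measures TX" for n by (rule disintegrationD(3)[OF H sn y])
    show Hs: "H s y \<in> prob_measures TX" by (rule disintegrationD(3)[OF H s y])
    have one: "measure (H t y) X = 1" if "t \<in> topspace S" for t
      using prob_measuresD[OF disintegrationD(3)[OF H that y]] prob_space.prob_space[of "H t y"]
      by simp
    have p: "(\<lambda>k. p (sn (diagseq k)) y) \<longlonglongrightarrow> p s y"
      using g base_Int_nonempty sn s unfolding good_def w_def by (auto simp: one)
    have ppos: "0 < p s y" using g by (simp add: good_def)
    fix E assume E: "E \<in> base_Int"
    have "(\<lambda>k. w E (sn (diagseq k)) y / p (sn (diagseq k)) y) \<longlonglongrightarrow> w E s y / p s y"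
      using g E ppos by (intro tendsto_divide p) (auto simp: good_def)
    also have "w E s y / p s y = measure (H s y) E" using ppos by (simp add: w_def)
    finally show "(\<lambda>k. measure (H (sn (diagseq k)) y) E) \<longlonglongrightarrow> measure (H s y) E"
    proof (rule Lim_transform_eventually)
      show "\<forall>\<^sub>F k in sequentially. w E (sn (diagseq k)) y / p (sn (diagseq k)) y = measure (H (sn (diagseq k)) y) E"
        using order_tendstoD(1)[OF p ppos] by eventually_elim (simp add: w_def)
    qed
  qed
  have ae: "AE y in m. \<forall>j. (\<lambda>k. w (e j) (sn (diagseq k)) y - w (e j) s y) \<longlonglongrightarrow> 0"
    by (rule AE_all_countable[THEN iffD2, OF allI]) (rule conv)
  have fin: "AE y in m. dens X s y < \<infinity>"
    by (rule finite_density_enn2real(1)[OF dens_measurable finite_density_dens[OF s Xs]])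
  have "AE y in m. 0 < dens X s y \<longrightarrow> good y"
  proof (rule eventually_mono[OF eventually_conj[OF ae fin]])
    fix y
    assume *: "(\<forall>j. (\<lambda>k. w (e j) (sn (diagseq k)) y - w (e j) s y) \<longlonglongrightarrow> 0) \<and> dens X s y < \<infinity>"
    have "(\<lambda>k. w E (sn (diagseq k)) y) \<longlonglongrightarrow> w E s y" if E: "E \<in> base_Int" for E
    proof -
      obtain j where "E = e j" using E unfolding e[symmetric] by (rule rangeE)
      then show ?thesis using * by (simp add: LIM_zero_iff)
    qed
    then show "0 < dens X s y \<longrightarrow> good y"
      using * by (auto simp: good_def p_def enn2real_positive_iff)
  qed
  then have "AE y in density m (dens X s). good y" by (simp add: AE_density)
  then have "AE y in marginal s. good y"
    unfolding marginal_eq_slice[OF s] density_dens[OF s Xs] .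
  then obtain N where N: "{y \<in> space (marginal s). \<not> good y} \<subseteq> N" "N \<in> sets (marginal s)" "emeasure (marginal s) N = 0"
    by (rule AE_E)
  interpret \<nu>: prob_space "marginal s" by (rule marginal_prob[OF s])
  show ?thesis
  proof (rule that[OF subseq_diagseq, of "Y - N"])
    show "Y - N \<in> sets BY" using N(2) marginal_prob[OF s] sets.compl_sets[of N "marginal s"] by simp
    show "measure (marginal s) (Y - N) = 1"
      using \<nu>.prob_compl[OF N(2)] N(3) marginal_prob(3)[OF s] by (simp add: measure_def)
    show "limitin (weak_topology TX) (\<lambda>k. H (sn (diagseq k)) y) (H s y) sequentially" if "y \<in> Y - N" for y
      using that N(1) marginal_prob(3)[OF s] by (intro good) auto
  qed
qed

text \<open>It suffices to refute a subsequence that stays away from the limit. A further subsequence has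
\<open>H(s\<^sub>n, y) \<rightarrow> H(s, y)\<close> weakly for almost all \<open>y\<close>. Dominated convergence handles the integrals against the
fixed marginal at \<open>s\<close>; exchanging that marginal for the one at \<open>s\<^sub>n\<close> costs at most the bound of \<open>\<Phi>\<close> times
the total variation distance.\<close>

lemma integral_disintegration_tendsto:
  assumes H: "disintegration H" and sn: "\<And>n. sn n \<in> topspace S"
    and lim: "limitin S sn s sequentially" and \<Phi>: "\<Phi> \<in> bounded_continuous (weak_topology TX)"
  shows "(\<lambda>n. \<integral>y. \<Phi> (H (sn n) y) \<partial>marginal (sn n)) \<longlonglongrightarrow> (\<integral>y. \<Phi> (H s y) \<partial>marginal s)"
proof (rule ccontr)
  let ?I = "\<lambda>t t'. \<integral>y. \<Phi> (H t y) \<partial>marginal t'"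
  have s: "s \<in> topspace S" using lim by (rule limitin_topspace)
  obtain b0 where b0: "\<And>z. z \<in> prob_measures TX \<Longrightarrow> \<bar>\<Phi> z\<bar> \<le> b0"
    using \<Phi> by (auto simp: bounded_continuous_def bounded_iff)
  define b where "b = max b0 1"
  have b: "0 < b" "\<And>z. z \<in> prob_measures TX \<Longrightarrow> \<bar>\<Phi> z\<bar> \<le> b" using b0 by (force simp: b_def)+
  have \<Phi>H: "(\<lambda>y. \<Phi> (H t y)) \<in> borel_measurable BY" if t: "t \<in> topspace S" for t
  proof -
    have "\<Phi> \<in> borel_measurable (borel_of (weak_topology TX))"
      using \<Phi> by (intro continuous_map_borel_measurable) (simp add: bounded_continuous_def)
    from measurable_compose[OF measurable_borel_of_weak_topology[OF disintegrationD(1)[OF H t]] this]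
    show ?thesis .
  qed
  assume "\<not> (\<lambda>n. ?I (sn n) (sn n)) \<longlonglongrightarrow> ?I s s"
  then obtain \<epsilon> where \<epsilon>: "0 < \<epsilon>" "\<not> (\<forall>\<^sub>F n in sequentially. dist (?I (sn n) (sn n)) (?I s s) < \<epsilon>)"
    unfolding tendsto_iff by blast
  then obtain r :: "nat \<Rightarrow> nat" where r: "strict_mono r" "\<And>n. \<epsilon> \<le> dist (?I (sn (r n)) (sn (r n))) (?I s s)"
    using not_eventually_sequentiallyD[OF \<epsilon>(2)] by (auto simp: not_less)
  have lim_r: "limitin S (sn \<circ> r) s sequentially" by (rule limitin_subsequence[OF r(1) lim])
  have sn_r: "(sn \<circ> r) n \<in> topspace S" for n using sn by simp
  obtain r' :: "nat \<Rightarrow> nat" and C where r': "strict_mono r'" "C \<in> sets BY" "measure (marginal s) C = 1"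
    and conv: "\<And>y. y \<in> C \<Longrightarrow> limitin (weak_topology TX) (\<lambda>k. H ((sn \<circ> r) (r' k)) y) (H s y) sequentially"
    using disintegration_subsequence[OF H sn_r lim_r] by blast
  let ?t = "\<lambda>k. sn (r (r' k))"
  interpret \<nu>: prob_space "marginal s" by (rule marginal_prob[OF s])
  have meas: "(\<lambda>y. \<Phi> (H t y)) \<in> borel_measurable (marginal s)" if "t \<in> topspace S" for t
    using \<Phi>H[OF that] by (simp add: measurable_cong_sets[OF marginal_prob(2)[OF s] refl])
  have "(\<lambda>k. ?I (?t k) s) \<longlonglongrightarrow> ?I s s"
  proof (rule integral_dominated_convergence[where w = "\<lambda>_. b"])
    have "AE y in marginal s. y \<in> C"
      using r'(2,3) by (subst \<nu>.AE_in_set_eq_1) (simp_all add: marginal_prob(2)[OF s])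
    then show "AE y in marginal s. (\<lambda>k. \<Phi> (H (?t k) y)) \<longlonglongrightarrow> \<Phi> (H s y)"
    proof (rule eventually_mono)
      fix y assume "y \<in> C"
      have "continuous_map (weak_topology TX) euclideanreal \<Phi>" using \<Phi> by (simp add: bounded_continuous_def)
      from continuous_map_limit[OF this conv[OF \<open>y \<in> C\<close>]]
      show "(\<lambda>k. \<Phi> (H (?t k) y)) \<longlonglongrightarrow> \<Phi> (H s y)" by (simp add: o_def)
    qed
    show "AE y in marginal s. norm (\<Phi> (H (?t k) y)) \<le> b" for k
      using b(2) disintegrationD(3)[OF H sn] marginal_prob(3)[OF s] by (intro AE_I2) auto
  qed (use meas s sn in auto)
  moreover have "(\<lambda>k. \<bar>?I (?t k) (?t k) - ?I (?t k) s\<bar>) \<longlonglongrightarrow> 0"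
  proof (rule tendsto_zero_if_eventually_le[of _ "2 * b"])
    fix \<eta> :: real assume \<eta>: "0 < \<eta>"
    have "limitin S ((sn \<circ> r) \<circ> r') s sequentially" by (rule limitin_subsequence[OF r'(1) lim_r])
    from eventually_uniform_near[OF base_Int_nonempty this \<eta>]
    show "\<forall>\<^sub>F k in sequentially. \<bar>?I (?t k) (?t k) - ?I (?t k) s\<bar> \<le> 2 * b * \<eta>"
    proof (rule eventually_mono)
      fix k assume "\<forall>C\<in>sets BY. \<bar>measure (R (((sn \<circ> r) \<circ> r') k)) (X \<times> C) - measure (R s) (X \<times> C)\<bar> \<le> \<eta>"
      then have "\<bar>?I (?t k) (?t k) - ?I (?t k) s\<bar> \<le> b * (2 * \<eta>)"
        using b disintegrationD(3)[OF H sn] by (intro integral_marginal_diff_le sn s \<Phi>H) auto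
      then show "\<bar>?I (?t k) (?t k) - ?I (?t k) s\<bar> \<le> 2 * b * \<eta>" by (simp add: mult_ac)
    qed
  qed (use b in auto)
  ultimately have "(\<lambda>k. (?I (?t k) (?t k) - ?I (?t k) s) + ?I (?t k) s) \<longlonglongrightarrow> 0 + ?I s s"
    by (intro tendsto_add) (simp_all add: tendsto_rabs_zero_iff)
  then have "\<forall>\<^sub>F k in sequentially. dist (?I (?t k) (?t k)) (?I s s) < \<epsilon>"
    using \<epsilon>(1) by (simp add: tendsto_iff)
  then show False using r(2) by (auto simp: eventually_sequentially not_less[symmetric])
qed

end

section \<open>Total variation continuity and weak continuity of the filter\<close>

lemma (in equicontinuous_joint_kernel) obtain_dominating:
  obtains m where "dominated_joint_kernel X Y S R \<tau> m"
proof -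
  obtain m where "prob_space m" "sets m = sets BY"
    "\<And>s B. s \<in> topspace S \<Longrightarrow> B \<in> sets BX \<Longrightarrow> absolutely_continuous m (slice B s)"
    using dominating_measure by blast
  then show ?thesis
    by (intro that[of m] dominated_joint_kernel.intro dominated_joint_kernel_axioms.intro
        equicontinuous_joint_kernel_axioms)
qed

lemma stochastic_kernel_empty: "topspace T2 = {} \<Longrightarrow> stochastic_kernel T1 T2 K"
  by (auto simp: stochastic_kernel_def measurable_def)

theorem theorem5p5:
  fixes X :: "'x::polish_space set" and Y :: "'y::polish_space set" and A :: "'a::polish_space set"
    and P :: "'x \<times> 'a \<Rightarrow> 'x measure" and Q :: "'a \<times> 'x \<Rightarrow> 'y measure"
    and \<tau> :: "'x set set"
  defines "TX \<equiv> top_of_set X" and "TY \<equiv> top_of_set Y" and "TA \<equiv> top_of_set A"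
  assumes "X \<in> sets borel" and "Y \<in> sets borel" and "A \<in> sets borel"
    and "stochastic_kernel TX (prod_topology TX TA) P"
    and "stochastic_kernel TY (prod_topology TA TX) Q"
    and "countable_base TX \<tau>"
    and "X \<in> \<tau>"
    and "\<And>\<F> z a. \<F> \<subseteq> \<tau> \<Longrightarrow> finite \<F> \<Longrightarrow> \<F> \<noteq> {} \<Longrightarrow> z \<in> prob_measures TX \<Longrightarrow> a \<in> A \<Longrightarrow>
           equicontinuous_at (prod_topology (weak_topology TX) TA)
             (rect_family TX TY P Q (\<Inter>\<F>)) (z, a)"
  shows "tv_continuous_kernel TY (prod_topology (weak_topology TX) TA) (obs_kernel TX TY P Q)
       \<and> (\<exists>H. is_filter_kernel TX TY TA P Q H \<and>
            (\<forall>zn z an a.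
               (\<forall>n. zn n \<in> prob_measures TX) \<longrightarrow> z \<in> prob_measures TX \<longrightarrow>
               (\<forall>n. an n \<in> A) \<longrightarrow> a \<in> A \<longrightarrow>
               limitin (weak_topology TX) zn z sequentially \<longrightarrow>
               limitin TA an a sequentially \<longrightarrow>
               (\<exists>r C. strict_mono (r :: nat \<Rightarrow> nat) \<and> C \<in> sets (borel_of TY) \<and>
                  measure (obs_kernel TX TY P Q (z, a)) C = 1 \<and>
                  (\<forall>y \<in> C. limitin (weak_topology TX)
                     (\<lambda>k. H (zn (r k), an (r k), y)) (H (z, a, y)) sequentially))))
       \<and> (\<forall>H. is_filter_kernel TX TY TA P Q H \<longrightarrow>
            weakly_continuous_kernel (weak_topology TX) (prod_topology (weak_topology TX) TA)
              (belief_transition TX TY P Q H))"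
proof (cases "prob_measures TX = {} \<or> A = {}")
  case True
  \<comment> \<open>Without points \<open>(z, a)\<close> every assertion is vacuous.\<close>
  let ?S = "prod_topology (weak_topology TX) TA"
  have S: "topspace ?S = {}" using True by (auto simp: TA_def)
  have "is_filter_kernel TX TY TA P Q H" for H
    unfolding is_filter_kernel_def using True by (auto simp: TA_def intro!: stochastic_kernel_empty)
  moreover have "tv_continuous_kernel T1 ?S K" for T1 :: "'y topology" and K
    by (simp only: tv_continuous_kernel_def S empty_iff stochastic_kernel_empty[OF S] simp_thms)
  moreover have "weakly_continuous_kernel T1 ?S K" for T1 :: "'x measure topology" and K
    by (simp only: weakly_continuous_kernel_def S empty_iff stochastic_kernel_empty[OF S] simp_thms)
  ultimately show ?thesis using True by blast
next
  case False
  let ?S = "prod_topology (weak_topology TX) TA" and ?R = "joint_kernel TX TY P Q"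
  have S: "topspace ?S = prob_measures TX \<times> A" by (simp add: TA_def)
  note R = joint_kernel_rect[OF assms(7,8)[unfolded TX_def TY_def TA_def], folded TX_def TY_def TA_def]
  have scS: "second_countable ?S" and scX: "second_countable (weak_topology TX)"
    and scY: "second_countable TY" and scA: "second_countable TA"
    unfolding TX_def TY_def TA_def
    by (intro second_countable_prod_topology second_countable_weak_topology second_countable_top_of_set)+
  have "equicontinuous_joint_kernel X Y ?S ?R \<tau>"
  proof (rule equicontinuous_joint_kernel.intro)
    show "?R s \<in> prob_measures (prod_topology (top_of_set X) (top_of_set Y))" if "s \<in> topspace ?S" for s
      using that R(1)[of "fst s" "snd s"] unfolding S by (auto simp: TX_def TY_def)
    show "equicontinuous_at ?S {\<lambda>s. measure (?R s) (\<Inter>\<F> \<times> C) | C. openin (top_of_set Y) C} s"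
      if "\<F> \<subseteq> \<tau>" "finite \<F>" "\<F> \<noteq> {}" "s \<in> topspace ?S" for \<F> s
      using assms(11)[OF that(1-3), of "fst s" "snd s"] that(4) unfolding S rect_family_def TY_def by auto
    show "topspace ?S \<noteq> {}" using False unfolding S by blast
  qed (use assms(4,9,10) scS in \<open>simp_all add: TX_def\<close>)
  then interpret equicontinuous_joint_kernel X Y ?S ?R \<tau> .
  obtain m where "dominated_joint_kernel X Y ?S ?R \<tau> m" using obtain_dominating by blast
  then interpret dominated_joint_kernel X Y ?S ?R \<tau> m .
  note fold = TX_def[symmetric] TY_def[symmetric]
  have obs: "obs_kernel TX TY P Q = marginal"
    by (rule ext) (simp only: obs_kernel_def marginal_def fold)
  \<comment> \<open>Up to regrouping its arguments, every filter kernel is a disintegration.\<close>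
  have dis: "disintegration (\<lambda>s y. H (fst s, snd s, y))" if H: "is_filter_kernel TX TY TA P Q H" for H
    unfolding disintegration_def
  proof (intro ballI conjI)
    fix s assume s: "s \<in> topspace ?S"
    have "H \<in> borel_of (prod_topology (weak_topology TX) (prod_topology TA TY)) \<rightarrow>\<^sub>M prob_algebra (borel_of TX)"
      using H by (intro stochastic_kernel_measurable) (simp add: is_filter_kernel_def)
    moreover have "(\<lambda>y. (fst s, snd s, y)) \<in> borel_of TY \<rightarrow>\<^sub>M borel_of (prod_topology (weak_topology TX) (prod_topology TA TY))"
      using s by (intro continuous_map_measurable_borel_of) (auto simp: continuous_map_pairwise o_def TA_def)
    ultimately show "(\<lambda>y. H (fst s, snd s, y)) \<in> borel_of (top_of_set Y) \<rightarrow>\<^sub>M prob_algebra (borel_of (top_of_set X))"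
      unfolding fold by (rule measurable_compose[rotated])
    show "emeasure (?R s) (B \<times> C) = (\<integral>\<^sup>+y\<in>C. emeasure (H (fst s, snd s, y)) B \<partial>marginal s)"
      if "B \<in> sets (borel_of (top_of_set X))" "C \<in> sets (borel_of (top_of_set Y))" for B C
      using H that s unfolding is_filter_kernel_def S obs fold by (auto simp: TA_def)
  qed
  have seq: "\<exists>r C. strict_mono (r :: nat \<Rightarrow> nat) \<and> C \<in> sets (borel_of TY) \<and>
      measure (obs_kernel TX TY P Q (z, a)) C = 1 \<and>
      (\<forall>y \<in> C. limitin (weak_topology TX) (\<lambda>k. H (zn (r k), an (r k), y)) (H (z, a, y)) sequentially)"
    if H: "is_filter_kernel TX TY TA P Q H" and zn: "\<forall>n. zn n \<in> prob_measures TX" and an: "\<forall>n. an n \<in> A"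
      and lim: "limitin (weak_topology TX) zn z sequentially" "limitin TA an a sequentially" for H zn z an a
  proof -
    have "limitin ?S (\<lambda>n. (zn n, an n)) (z, a) sequentially"
      using lim by (simp add: limitin_pairwise o_def)
    moreover have "(zn n, an n) \<in> topspace ?S" for n using zn an unfolding S by simp
    ultimately obtain r :: "nat \<Rightarrow> nat" and C where "strict_mono r" "C \<in> sets (borel_of TY)" "measure (marginal (z, a)) C = 1"
      "\<And>y. y \<in> C \<Longrightarrow> limitin (weak_topology TX) (\<lambda>k. H (zn (r k), an (r k), y)) (H (z, a, y)) sequentially"
      using disintegration_subsequence[OF dis[OF H], of "\<lambda>n. (zn n, an n)" "(z, a)"] unfolding fold by auto
    then show ?thesis unfolding obs by blast
  qed
  have ex: "\<exists>H. is_filter_kernel TX TY TA P Q H"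
  proof -
    obtain K where K: "K \<in> borel_of ?S \<Otimes>\<^sub>M borel_of TY \<rightarrow>\<^sub>M prob_algebra (borel_of TX)"
      and disK: "disintegration (\<lambda>s y. K (s, y))"
      using jointly_measurable_disintegration unfolding fold by blast
    define H where "H = (\<lambda>(z, a, y). K ((z, a), y))"
    let ?W = "prod_topology (weak_topology TX) (prod_topology TA TY)"
    have "(\<lambda>p. (fst p, fst (snd p))) \<in> borel_of ?W \<rightarrow>\<^sub>M borel_of ?S"
      by (intro continuous_map_measurable_borel_of)
         (auto simp: continuous_map_pairwise o_def intro: continuous_map_compose[unfolded o_def, OF continuous_map_snd continuous_map_fst] continuous_map_fst)
    moreover have "(\<lambda>p. snd (snd p)) \<in> borel_of ?W \<rightarrow>\<^sub>M borel_of TY"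
      by (intro continuous_map_measurable_borel_of continuous_map_compose[unfolded o_def, OF continuous_map_snd continuous_map_snd])
    ultimately have "(\<lambda>p. K ((fst p, fst (snd p)), snd (snd p))) \<in> borel_of ?W \<rightarrow>\<^sub>M prob_algebra (borel_of TX)"
      by (intro measurable_compose[OF measurable_Pair K])
    then have Hm: "H \<in> borel_of ?W \<rightarrow>\<^sub>M prob_algebra (borel_of TX)" by (simp add: H_def case_prod_beta)
    have "stochastic_kernel TX ?W H"
      unfolding stochastic_kernel_def
    proof (intro conjI ballI)
      show "H w \<in> prob_measures TX" if "w \<in> topspace ?W" for w
        using measurable_space[OF Hm, of w] that by (simp add: space_prob_algebra prob_measures_def)
      show "(\<lambda>w. measure (H w) B) \<in> borel_measurable (borel_of ?W)" if "B \<in> sets (borel_of TX)" for B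
        by (rule measurable_compose[OF Hm measurable_measure_prob_algebra[OF that]])
    qed
    moreover have "emeasure (?R (z, a)) (B \<times> C) = (\<integral>\<^sup>+y\<in>C. emeasure (H (z, a, y)) B \<partial>obs_kernel TX TY P Q (z, a))"
      if "B \<in> sets (borel_of TX)" "C \<in> sets (borel_of TY)" "z \<in> prob_measures TX" "a \<in> A" for B C z a
      using disintegrationD(2)[OF disK, of "(z, a)"] that unfolding S fold obs by (simp add: H_def)
    ultimately show ?thesis unfolding is_filter_kernel_def TA_def by (intro exI[of _ H]) auto
  qed
  have weak: "weakly_continuous_kernel (weak_topology TX) ?S (belief_transition TX TY P Q H)"
    if H: "is_filter_kernel TX TY TA P Q H" for H
  proof -
    let ?H = "\<lambda>s y. H (fst s, snd s, y)" and ?q = "belief_transition TX TY P Q H"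
    have q: "?q s = distr (marginal s) (borel_of (weak_topology TX)) (?H s)" for s
      by (simp add: belief_transition_def obs case_prod_beta)
    have Hs: "?H s \<in> marginal s \<rightarrow>\<^sub>M borel_of (weak_topology TX)" if s: "s \<in> topspace ?S" for s
      using measurable_borel_of_weak_topology[OF disintegrationD(1)[OF dis[OF H] s]] unfolding fold
      by (simp add: measurable_cong_sets[OF marginal_prob(2)[OF s] refl] fold)
    have qp: "?q s \<in> prob_measures (weak_topology TX)" if s: "s \<in> topspace ?S" for s
      unfolding prob_measures_def q using prob_space.prob_space_distr[OF marginal_prob(1)[OF s] Hs[OF s]] by simp
    \<comment> \<open>The Borel sets of the triple product are generated by rectangles, so \<open>H\<close> is measurable for the product \<open>\<sigma>\<close>-algebra.\<close>
    have Hjoint: "case_prod ?H \<in> borel_of ?S \<Otimes>\<^sub>M borel_of TY \<rightarrow>\<^sub>M borel_of (weak_topology TX)"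
    proof -
      have Hm: "H \<in> borel_of (prod_topology (weak_topology TX) (prod_topology TA TY)) \<rightarrow>\<^sub>M prob_algebra (borel_of TX)"
        using H by (intro stochastic_kernel_measurable) (simp add: is_filter_kernel_def)
      have f: "fst \<in> borel_of ?S \<rightarrow>\<^sub>M borel_of (weak_topology TX)" and g: "snd \<in> borel_of ?S \<rightarrow>\<^sub>M borel_of TA"
        by (intro continuous_map_measurable_borel_of continuous_map_fst continuous_map_snd)+
      have "(\<lambda>p. (fst (fst p), snd (fst p), snd p)) \<in> borel_of ?S \<Otimes>\<^sub>M borel_of TY \<rightarrow>\<^sub>M
          borel_of (prod_topology (weak_topology TX) (prod_topology TA TY))"
        by (intro measurable_borel_of_prod_topology second_countable_prod_topology scX scA scY
            measurable_compose[OF measurable_fst f] measurable_compose[OF measurable_fst g] measurable_snd)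
      from measurable_borel_of_weak_topology[OF measurable_compose[OF this Hm, unfolded TX_def]]
      show ?thesis by (simp add: case_prod_beta TX_def)
    qed
    have "marginal \<in> borel_of ?S \<rightarrow>\<^sub>M subprob_algebra (borel_of TY)"
      using measurable_prob_algebraD[OF stochastic_kernel_measurable[OF marginal_stochastic_kernel]] unfolding fold .
    from measurable_distr2[OF Hjoint this]
    have qm: "?q \<in> borel_of ?S \<rightarrow>\<^sub>M subprob_algebra (borel_of (weak_topology TX))"
      unfolding q[abs_def] .
    have "stochastic_kernel (weak_topology TX) ?S ?q"
      unfolding stochastic_kernel_def
      using qp measurable_compose[OF qm measurable_measure_subprob_algebra] by blast
    moreover have "limitin (weak_topology (weak_topology TX)) (\<lambda>n. ?q (sn n)) (?q s) sequentially"
      if sn: "\<forall>n. sn n \<in> topspace ?S" and lim: "limitin ?S sn s sequentially" for sn s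
      unfolding limitin_weak_topology
    proof (intro conjI ballI)
      have s: "s \<in> topspace ?S" using lim by (rule limitin_topspace)
      show "?q s \<in> prob_measures (weak_topology TX)" by (rule qp[OF s])
      show "\<forall>\<^sub>F n in sequentially. ?q (sn n) \<in> prob_measures (weak_topology TX)" using qp sn by simp
      fix \<Phi> assume \<Phi>: "\<Phi> \<in> bounded_continuous (weak_topology TX)"
      have "\<Phi> \<in> borel_measurable (borel_of (weak_topology TX))"
        using \<Phi> by (intro continuous_map_borel_measurable) (simp add: bounded_continuous_def)
      then have "(\<integral>z. \<Phi> z \<partial>?q t) = (\<integral>y. \<Phi> (?H t y) \<partial>marginal t)" if "t \<in> topspace ?S" for t
        unfolding q using integral_distr[OF Hs[OF that]] by blast
      then show "(\<lambda>n. \<integral>z. \<Phi> z \<partial>?q (sn n)) \<longlonglongrightarrow> (\<integral>z. \<Phi> z \<partial>?q s)"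
        using integral_disintegration_tendsto[OF dis[OF H] _ lim, of \<Phi>] sn s \<Phi> unfolding fold by simp
    qed
    ultimately show ?thesis unfolding weakly_continuous_kernel_def by blast
  qed
  show ?thesis
    using marginal_tv_continuous ex seq weak unfolding obs[symmetric] fold by blast
qed

end
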